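(* Let $U\in C^1\big([0,\infty);(H_0^1(\Omega))^N\big)$ be the solution of $$\frac{\mathrm{d}U}{\mathrm{d}t}=\mathcal{G}U-U\langle\mathcal{G}U,U\rangle,\qquad U(0)=U_0,$$ with initial data $U_0\in\mathcal{M}^N_{\geqslant}$. Then $$\|\langle U(t),U(t)\rangle-I_N\|\leqslant\|\langle U_0,U_0\rangle-I_N\|\exp\Big(-\frac{t}{E(U_0)}\Big)\quad\text{for all } t\geqslant0,$$ and consequently $\lim_{t\to\infty}\langle U(t),U(t)\rangle=I_N$.
   Context: $\Omega\subset\mathbb{R}^d$ is a bounded domain, and $(\cdot,\cdot)$ denotes the $L^2(\Omega)$ inner product. $\mathcal{V}:\Omega\to\mathbb{R}$ is a potential such that $a(u,v)=\int_\Omega(\nabla u\cdot\nabla v+\mathcal{V}uv)\,dx$ on $H_0^1(\Omega)$ is symmetric, bounded and coercive, with $c_1\|\nabla u\|^2\leqslant a(u,u)\leqslant c_2\|\nabla u\|^2$ for constants $c_1,c_2>0$. $\mathcal{G}=(-\Delta+\mathcal{V})^{-1}$: $\mathcal{G}f\in H_0^1(\Omega)$ is the unique element with $a(\mathcal{G}f,v)=(f,v)$ for all $v\in H_0^1(\Omega)$. For $N$-tuples: - $\mathcal{G}U=(\mathcal{G}u_1,\dots,\mathcal{G}u_N)$; - $UA$ has $j$-th entry $\sum_iu_iA_{ij}$; - $\langle U,V\rangle=((u_i,v_j))_{i,j}$ and $\langle U,V\rangle_a=(a(u_i,v_j))_{i,j}$. The energy is $E(U)=\frac12\operatorname{tr}\langle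 U,U\rangle_a$. For matrices, $\|\cdot\|$ is the Frobenius norm. The quasi-Stiefel set is $\mathcal{M}^N_{\geqslant}=\{U\in(H_0^1(\Omega))^N:\langle U,U\rangle-I_N\text{ is positive semidefinite}\}$. *)

theory Defs
  imports "HOL-Analysis.Analysis"
begin

(* Functions on \<Omega> are modelled as total functions 'a \<Rightarrow> real on a Euclidean space 'a
   (dimension d = DIM('a)); all integrals are Lebesgue integrals over \<Omega>. *)

fun Ck :: "nat \<Rightarrow> ('a::euclidean_space \<Rightarrow> real) \<Rightarrow> bool" where
  "Ck 0 f = continuous_on UNIV f"
| "Ck (Suc k) f = (\<exists>f'. (\<forall>x. (f has_derivative (\<lambda>h. f' x \<bullet> h)) (at x)) \<and>
                        continuous_on UNIV f \<and> (\<forall>i\<in>Basis. Ck k (\<lambda>x. f' x \<bullet> i)))"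

definition smooth :: "('a::euclidean_space \<Rightarrow> real) \<Rightarrow> bool" where
  "smooth f \<longleftrightarrow> (\<forall>k. Ck k f)"

definition tsupport :: "('a::euclidean_space \<Rightarrow> real) \<Rightarrow> 'a set" where
  "tsupport f = closure {x. f x \<noteq> 0}"

definition test_fun :: "'a::euclidean_space set \<Rightarrow> ('a \<Rightarrow> real) \<Rightarrow> bool" where
  "test_fun \<Omega> f \<longleftrightarrow> smooth f \<and> compact (tsupport f) \<and> tsupport f \<subseteq> \<Omega>"

definition grad :: "('a::euclidean_space \<Rightarrow> real) \<Rightarrow> 'a \<Rightarrow> 'a" where
  "grad f x = (SOME g. (f has_derivative (\<lambda>h. g \<bullet> h)) (at x))"

definition L2 :: "'a::euclidean_space set \<Rightarrow> ('a \<Rightarrow> real) \<Rightarrow> bool" where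
  "L2 \<Omega> u \<longleftrightarrow> set_borel_measurable lebesgue \<Omega> u \<and> set_integrable lebesgue \<Omega> (\<lambda>x. (u x)\<^sup>2)"

definition L2vec :: "'a::euclidean_space set \<Rightarrow> ('a \<Rightarrow> 'a) \<Rightarrow> bool" where
  "L2vec \<Omega> g \<longleftrightarrow> set_borel_measurable lebesgue \<Omega> g \<and> set_integrable lebesgue \<Omega> (\<lambda>x. (norm (g x))\<^sup>2)"

(* g is a weak gradient of u in the H_0^1 sense: u is the H^1-limit of test functions *)
definition H01_approx :: "'a::euclidean_space set \<Rightarrow> ('a \<Rightarrow> real) \<Rightarrow> ('a \<Rightarrow> 'a) \<Rightarrow> bool" where
  "H01_approx \<Omega> u g \<longleftrightarrow> L2 \<Omega> u \<and> L2vec \<Omega> g \<and>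
     (\<exists>\<phi>::nat \<Rightarrow> 'a \<Rightarrow> real. (\<forall>n. test_fun \<Omega> (\<phi> n)) \<and>
        (\<lambda>n. LINT x:\<Omega>|lebesgue. (\<phi> n x - u x)\<^sup>2) \<longlonglongrightarrow> 0 \<and>
        (\<lambda>n. LINT x:\<Omega>|lebesgue. (norm (grad (\<phi> n) x - g x))\<^sup>2) \<longlonglongrightarrow> 0)"

definition H01 :: "'a::euclidean_space set \<Rightarrow> ('a \<Rightarrow> real) set" where
  "H01 \<Omega> = {u. \<exists>g. H01_approx \<Omega> u g}"

definition wgrad :: "'a::euclidean_space set \<Rightarrow> ('a \<Rightarrow> real) \<Rightarrow> 'a \<Rightarrow> 'a" where
  "wgrad \<Omega> u = (SOME g. H01_approx \<Omega> u g)"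

definition l2inner :: "'a::euclidean_space set \<Rightarrow> ('a \<Rightarrow> real) \<Rightarrow> ('a \<Rightarrow> real) \<Rightarrow> real" where
  "l2inner \<Omega> u v = (LINT x:\<Omega>|lebesgue. u x * v x)"

definition grad_sq :: "'a::euclidean_space set \<Rightarrow> ('a \<Rightarrow> real) \<Rightarrow> real" where
  "grad_sq \<Omega> u = (LINT x:\<Omega>|lebesgue. (norm (wgrad \<Omega> u x))\<^sup>2)"

definition h1norm_sq :: "'a::euclidean_space set \<Rightarrow> ('a \<Rightarrow> real) \<Rightarrow> real" where
  "h1norm_sq \<Omega> u = l2inner \<Omega> u u + grad_sq \<Omega> u"

definition aform :: "'a::euclidean_space set \<Rightarrow> ('a \<Rightarrow> real) \<Rightarrow> ('a \<Rightarrow> real) \<Rightarrow> ('a \<Rightarrow> real) \<Rightarrow> real" where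
  "aform \<Omega> V u v = (LINT x:\<Omega>|lebesgue. wgrad \<Omega> u x \<bullet> wgrad \<Omega> v x + V x * u x * v x)"

(* \<G> = (-\<Delta>+V)^{-1} *)
definition Gop :: "'a::euclidean_space set \<Rightarrow> ('a \<Rightarrow> real) \<Rightarrow> ('a \<Rightarrow> real) \<Rightarrow> ('a \<Rightarrow> real)" where
  "Gop \<Omega> V f = (SOME w. w \<in> H01 \<Omega> \<and> (\<forall>v\<in>H01 \<Omega>. aform \<Omega> V w v = l2inner \<Omega> f v))"

(* N-tuples: nat \<Rightarrow> ('a \<Rightarrow> real), entries indexed by i < N; matrices nat \<Rightarrow> nat \<Rightarrow> real *)
definition gram :: "'a::euclidean_space set \<Rightarrow> nat \<Rightarrow> (nat \<Rightarrow> 'a \<Rightarrow> real) \<Rightarrow> (nat \<Rightarrow> 'a \<Rightarrow> real) \<Rightarrow> nat \<Rightarrow> nat \<Rightarrow> real" where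
  "gram \<Omega> N U W i j = l2inner \<Omega> (U i) (W j)"

definition tuple_mult :: "nat \<Rightarrow> (nat \<Rightarrow> 'a \<Rightarrow> real) \<Rightarrow> (nat \<Rightarrow> nat \<Rightarrow> real) \<Rightarrow> nat \<Rightarrow> 'a \<Rightarrow> real" where
  "tuple_mult N U A j = (\<lambda>x. \<Sum>i<N. U i x * A i j)"

definition Gtuple :: "'a::euclidean_space set \<Rightarrow> ('a \<Rightarrow> real) \<Rightarrow> (nat \<Rightarrow> 'a \<Rightarrow> real) \<Rightarrow> nat \<Rightarrow> 'a \<Rightarrow> real" where
  "Gtuple \<Omega> V U i = Gop \<Omega> V (U i)"

definition energy :: "'a::euclidean_space set \<Rightarrow> ('a \<Rightarrow> real) \<Rightarrow> nat \<Rightarrow> (nat \<Rightarrow> 'a \<Rightarrow> real) \<Rightarrow> real" where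
  "energy \<Omega> V N U = (1/2) * (\<Sum>i<N. aform \<Omega> V (U i) (U i))"

definition idm :: "nat \<Rightarrow> nat \<Rightarrow> real" where
  "idm i j = (if i = j then 1 else 0)"

definition frob :: "nat \<Rightarrow> (nat \<Rightarrow> nat \<Rightarrow> real) \<Rightarrow> real" where
  "frob N A = sqrt (\<Sum>i<N. \<Sum>j<N. (A i j)\<^sup>2)"

definition psd :: "nat \<Rightarrow> (nat \<Rightarrow> nat \<Rightarrow> real) \<Rightarrow> bool" where
  "psd N A \<longleftrightarrow> (\<forall>i<N. \<forall>j<N. A i j = A j i) \<and> (\<forall>z::nat \<Rightarrow> real. (\<Sum>i<N. \<Sum>j<N. z i * A i j * z j) \<ge> 0)"

definition quasi_stiefel :: "'a::euclidean_space set \<Rightarrow> nat \<Rightarrow> (nat \<Rightarrow> 'a \<Rightarrow> real) set" where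
  "quasi_stiefel \<Omega> N = {U. (\<forall>i<N. U i \<in> H01 \<Omega>) \<and> psd N (\<lambda>i j. gram \<Omega> N U U i j - idm i j)}"

definition flow_rhs :: "'a::euclidean_space set \<Rightarrow> ('a \<Rightarrow> real) \<Rightarrow> nat \<Rightarrow> (nat \<Rightarrow> 'a \<Rightarrow> real) \<Rightarrow> nat \<Rightarrow> 'a \<Rightarrow> real" where
  "flow_rhs \<Omega> V N U i = (\<lambda>x. Gtuple \<Omega> V U i x - tuple_mult N U (gram \<Omega> N (Gtuple \<Omega> V U) U) i x)"

end

theory Submission
  imports Defs "HOL-Library.Function_Algebras" "HOL-Real_Asymp.Real_Asymp"
begin

text \<open>
  Write \<open>S = \<langle>U,U\<rangle>\<close>, \<open>K = \<langle>U,U\<rangle>\<^sub>a\<close>, \<open>A = \<langle>GU,U\<rangle> = \<langle>GU,GU\<rangle>\<^sub>a\<close> and \<open>D = S - I\<close>. The flow gives the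
  Lyapunov equation \<open>D' = -(AD + DA)\<close> with \<open>A \<ge> 0\<close>, which preserves \<open>D \<ge> 0\<close>. The energy decreases,
  because \<open>E' = tr S - tr (KA)\<close> while \<open>tr (KA) \<ge> tr S\<^sup>2 \<ge> tr S\<close>: the first inequality holds since
  \<open>S = \<langle>U,GU\<rangle>\<^sub>a\<close> is the off-diagonal block of the Gram matrix of \<open>(U, GU)\<close>, the second since \<open>S \<ge> I\<close>.
  Cauchy--Schwarz for \<open>a\<close> yields \<open>A \<ge> I / tr K \<ge> I / (2 E(U\<^sub>0))\<close>, and the decay follows from
  \<open>(\<parallel>D\<parallel>\<^sup>2)' = -4 tr (DAD)\<close>.

  The operator \<open>G\<close> exists by the Riesz representation theorem, which rests on the completeness of
  \<open>H\<^sup>1\<^sub>0\<close> and the Poincare inequality. The bilinearity of \<open>a\<close> needs the uniqueness of weak gradients.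
\<close>

subsection \<open>Semi-inner products\<close>

text \<open>Functions equal almost everywhere are not identified, and \<open>wgrad\<close> and
  \<open>Gop\<close> are picked by \<open>SOME\<close>. Hence both forms are only semidefinite, weak
  gradients are linear only almost everywhere, and the differential equation holds only up to an
  element of zero Sobolev norm. Semi-inner products fit this setting: Cauchy-Schwarz makes null
  vectors invisible to the form, which stands in for definiteness. Positivity of D has to be settled
  before anything quantitative, because both the energy decay and the lower bound on A use S >= I at
  every time. At that stage A is known only to be semidefinite, so the positivity argument gets its
  strictness from a perturbation. Spectral theory is avoided throughout: the diagonal entries of S
  are at least 1, which already gives tr S <= tr S^2; a Schur complement factorisation provides
  Euclidean coordinates; and tr K replaces the largest eigenvalue of K. The rate arises from A >= m
  I with m = 1 / (2 E(U_0)): A acts on D from both sides, so the norm of D decays at rate 2m = 1 /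
  E(U_0).\<close>

instantiation "fun" :: (type, real_vector) real_vector
begin

definition scaleR_fun_def: "c *\<^sub>R f = (\<lambda>x. c *\<^sub>R f x)"

instance
  by standard (auto simp: scaleR_fun_def fun_eq_iff algebra_simps)

end

lemma scaleR_fun_apply [simp]: "(c *\<^sub>R f) x = c *\<^sub>R f x"
  by (simp add: scaleR_fun_def)

lemma sum_fun_apply [simp]: "(\<Sum>i\<in>I. f i) x = (\<Sum>i\<in>I. f i x)"
  by (induction I rule: infinite_finite_induct) auto

text \<open>The carrier is a subspace of a type rather than the whole type, because integrals are
  additive only where the integrands are integrable.\<close>

locale semi_inner_product =
  fixes X :: "'v::real_vector set" and b :: "'v \<Rightarrow> 'v \<Rightarrow> real"
  assumes subspace_X: "subspace X"
    and form_sym: "u \<in> X \<Longrightarrow> v \<in> X \<Longrightarrow> b u v = b v u"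
    and form_add_left: "u \<in> X \<Longrightarrow> v \<in> X \<Longrightarrow> w \<in> X \<Longrightarrow> b (u + v) w = b u w + b v w"
    and form_scale_left: "u \<in> X \<Longrightarrow> w \<in> X \<Longrightarrow> b (c *\<^sub>R u) w = c * b u w"
    and form_nonneg: "u \<in> X \<Longrightarrow> 0 \<le> b u u"
begin

lemma mem_add [simp, intro]: "u \<in> X \<Longrightarrow> v \<in> X \<Longrightarrow> u + v \<in> X"
  and mem_scale [simp, intro]: "u \<in> X \<Longrightarrow> c *\<^sub>R u \<in> X"
  and mem_diff [simp, intro]: "u \<in> X \<Longrightarrow> v \<in> X \<Longrightarrow> u - v \<in> X"
  and mem_zero [simp, intro]: "0 \<in> X"
  and mem_sum [simp, intro]: "(\<And>i. i \<in> I \<Longrightarrow> f i \<in> X) \<Longrightarrow> sum f I \<in> X"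
  using subspace_X by (auto intro: subspace_add subspace_scale subspace_diff subspace_0 subspace_sum)

lemma form_add_right: "u \<in> X \<Longrightarrow> v \<in> X \<Longrightarrow> w \<in> X \<Longrightarrow> b w (u + v) = b w u + b w v"
  by (metis form_sym form_add_left mem_add)

lemma form_scale_right: "u \<in> X \<Longrightarrow> w \<in> X \<Longrightarrow> b w (c *\<^sub>R u) = c * b w u"
  by (metis form_sym form_scale_left mem_scale)

lemma form_diff_left: "u \<in> X \<Longrightarrow> v \<in> X \<Longrightarrow> w \<in> X \<Longrightarrow> b (u - v) w = b u w - b v w"
  using form_add_left[of u "(-1) *\<^sub>R v" w] form_scale_left[of v w "-1"] mem_scale[of v "-1"] by simp

lemma form_diff_right: "u \<in> X \<Longrightarrow> v \<in> X \<Longrightarrow> w \<in> X \<Longrightarrow> b w (u - v) = b w u - b w v"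
  by (metis form_sym form_diff_left mem_diff)

lemmas form_simps = form_add_left form_add_right form_scale_left form_scale_right
  form_diff_left form_diff_right

lemma form_zero_left: "w \<in> X \<Longrightarrow> b 0 w = 0"
  using form_scale_left[of 0 w 0] by simp

lemma form_zero_right: "w \<in> X \<Longrightarrow> b w 0 = 0"
  using form_scale_right[of 0 w 0] by simp

lemma form_sum_left:
  assumes "w \<in> X" "\<And>i. i \<in> I \<Longrightarrow> f i \<in> X"
  shows "b (sum f I) w = (\<Sum>i\<in>I. b (f i) w)"
  using assms(2)
  by (induction I rule: infinite_finite_induct) (simp_all add: assms(1) form_zero_left form_add_left)

lemma form_sum_right:
  assumes "w \<in> X" "\<And>i. i \<in> I \<Longrightarrow> f i \<in> X"
  shows "b w (sum f I) = (\<Sum>i\<in>I. b w (f i))"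
  using assms(2)
  by (induction I rule: infinite_finite_induct) (simp_all add: assms(1) form_zero_right form_add_right)

lemma Cauchy_Schwarz_form:
  assumes [simp]: "u \<in> X" "v \<in> X"
  shows "(b u v)\<^sup>2 \<le> b u u * b v v"
proof -
  have expand: "b (s *\<^sub>R u + t *\<^sub>R v) (s *\<^sub>R u + t *\<^sub>R v)
      = s\<^sup>2 * b u u + 2 * s * t * b u v + t\<^sup>2 * b v v" for s t
    using form_sym[of u v] by (simp add: form_simps algebra_simps power2_eq_square)
  have pos: "0 \<le> s\<^sup>2 * b u u + 2 * s * t * b u v + t\<^sup>2 * b v v" for s t
    using form_nonneg[of "s *\<^sub>R u + t *\<^sub>R v"] expand by simp
  show ?thesis
  proof (cases "b v v = 0")
    case True
    have "b u v = 0"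
    proof (rule ccontr)
      assume "b u v \<noteq> 0"
      \<comment> \<open>When \<open>b v v = 0\<close> the expression is affine in the second
        parameter; this value brings it to -1.\<close>
      then show False
        using pos[of 1 "- (b u u + 1) / (2 * b u v)"] True by (simp add: field_simps)
    qed
    then show ?thesis using True by simp
  next
    case False
    then have v: "b v v > 0" using form_nonneg[of v] by simp
    \<comment> \<open>The minimising ratio is \<open>t / s = - b u v / b v v\<close>; taking
      \<open>s = b v v\<close> clears the denominator.\<close>
    have "0 \<le> b v v * (b u u * b v v - (b u v)\<^sup>2)"
      using pos[of "b v v" "- b u v"] by (simp add: algebra_simps power2_eq_square)
    then show ?thesis using v by (simp add: zero_le_mult_iff)
  qed
qed

lemma abs_form_le: "u \<in> X \<Longrightarrow> v \<in> X \<Longrightarrow> \<bar>b u v\<bar> \<le> sqrt (b u u) * sqrt (b v v)"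
  using Cauchy_Schwarz_form[of u v] by (metis real_sqrt_abs real_sqrt_le_mono real_sqrt_mult)

text \<open>The substitute for definiteness. It lets elements at distance zero be exchanged inside
  the form, and for a matrix it says that a null vector of a semidefinite form lies in the
  kernel.\<close>

lemma form_null_left: "u \<in> X \<Longrightarrow> v \<in> X \<Longrightarrow> b u u = 0 \<Longrightarrow> b u v = 0"
  using Cauchy_Schwarz_form[of u v] by simp

text \<open>The parallelogram law with the term in \<open>u - v\<close> dropped. Its factor 2 is why
  later approximations start from \<open>e / 4\<close>.\<close>

lemma form_add_sq_le:
  assumes [simp]: "u \<in> X" "v \<in> X"
  shows "b (u + v) (u + v) \<le> 2 * b u u + 2 * b v v"
  using form_nonneg[of "u - v"] form_sym[of u v] by (simp add: form_simps)

lemma form_triangle_sq: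
  assumes [simp]: "u \<in> X" "v \<in> X" "w \<in> X"
  shows "b (u - w) (u - w) \<le> 2 * b (u - v) (u - v) + 2 * b (v - w) (v - w)"
  using form_add_sq_le[of "u - v" "v - w"] by simp

text \<open>Expand around the limit and bound the three error terms by Cauchy-Schwarz. Membership is
  required only eventually, since difference quotients lie in the space only for admissible
  increments.\<close>

lemma tendsto_form:
  assumes f: "\<forall>\<^sub>F n in F. f n \<in> X" "x \<in> X" "((\<lambda>n. b (f n - x) (f n - x)) \<longlongrightarrow> 0) F"
    and g: "\<forall>\<^sub>F n in F. g n \<in> X" "y \<in> X" "((\<lambda>n. b (g n - y) (g n - y)) \<longlongrightarrow> 0) F"
  shows "((\<lambda>n. b (f n) (g n)) \<longlongrightarrow> b x y) F"
proof -
  let ?p = "\<lambda>n. sqrt (b (f n - x) (f n - x))" and ?q = "\<lambda>n. sqrt (b (g n - y) (g n - y))"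
  have p: "(?p \<longlongrightarrow> 0) F" and q: "(?q \<longlongrightarrow> 0) F"
    using tendsto_real_sqrt[OF f(3)] tendsto_real_sqrt[OF g(3)] by simp_all
  have lim: "((\<lambda>n. ?p n * ?q n + ?p n * sqrt (b y y) + sqrt (b x x) * ?q n) \<longlongrightarrow> 0) F"
    using tendsto_add[OF tendsto_add[OF tendsto_mult[OF p q] tendsto_mult_right[OF p]]
        tendsto_mult_left[OF q]] by simp
  have "((\<lambda>n. b (f n) (g n) - b x y) \<longlongrightarrow> 0) F"
  proof (rule Lim_null_comparison[OF _ lim])
    show "\<forall>\<^sub>F n in F. norm (b (f n) (g n) - b x y)
        \<le> ?p n * ?q n + ?p n * sqrt (b y y) + sqrt (b x x) * ?q n"
      using f(1) g(1)
    proof eventually_elim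
      case (elim n)
      note [simp] = elim f(2) g(2)
      have "b (f n) (g n) - b x y = b (f n - x) (g n - y) + b (f n - x) y + b x (g n - y)"
        by (simp add: form_simps)
      then show ?case
        using abs_form_le[of "f n - x" "g n - y"] abs_form_le[of "f n - x" y]
          abs_form_le[of x "g n - y"] by simp
    qed
  qed
  then show ?thesis by (simp add: LIM_zero_iff)
qed

lemma tendsto_form_left:
  assumes "\<forall>\<^sub>F n in F. f n \<in> X" "x \<in> X" "((\<lambda>n. b (f n - x) (f n - x)) \<longlongrightarrow> 0) F" "y \<in> X"
  shows "((\<lambda>n. b (f n) y) \<longlongrightarrow> b x y) F"
  using tendsto_form[OF assms(1-3), of "\<lambda>_. y" y] assms(4) by (simp add: form_zero_left)

text \<open>A product rule for curves differentiable merely in the seminorm of \<open>b\<close>. The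
  filter admits only increments that stay at nonnegative times, so at time 0 it yields the one-sided
  derivative.\<close>

lemma has_real_derivative_form:
  assumes t: "0 \<le> t"
    and X: "\<And>s. 0 \<le> s \<Longrightarrow> u s \<in> X" "\<And>s. 0 \<le> s \<Longrightarrow> v s \<in> X" "u' \<in> X" "v' \<in> X"
    and u: "((\<lambda>h. b ((1 / h) *\<^sub>R (u (t + h) - u t) - u') ((1 / h) *\<^sub>R (u (t + h) - u t) - u')) \<longlongrightarrow> 0)
              (at 0 within {h. t + h \<ge> 0})" (is "(_ \<longlongrightarrow> _) ?F")
    and v: "((\<lambda>h. b ((1 / h) *\<^sub>R (v (t + h) - v t) - v') ((1 / h) *\<^sub>R (v (t + h) - v t) - v')) \<longlongrightarrow> 0)
              (at 0 within {h. t + h \<ge> 0})"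
  shows "((\<lambda>s. b (u s) (v s)) has_real_derivative b u' (v t) + b (u t) v') (at t within {0..})"
proof -
  define p where "p h = (1 / h) *\<^sub>R (u (t + h) - u t)" for h
  define q where "q h = (1 / h) *\<^sub>R (v (t + h) - v t)" for h
  have ev: "\<forall>\<^sub>F h in ?F. h \<noteq> 0 \<and> 0 \<le> t + h"
    by (auto simp: eventually_at_filter)
  have pX: "\<forall>\<^sub>F h in ?F. p h \<in> X" and qX: "\<forall>\<^sub>F h in ?F. q h \<in> X"
    using ev by (eventually_elim; use t X in \<open>auto simp: p_def q_def\<close>)+
  have ut: "u t \<in> X" "v t \<in> X" using X t by auto
  have pq: "((\<lambda>h. b (p h) (q h)) \<longlongrightarrow> b u' v') ?F"
    using tendsto_form[OF pX X(3) _ qX X(4)] u v by (simp add: p_def q_def)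
  have pv: "((\<lambda>h. b (p h) (v t)) \<longlongrightarrow> b u' (v t)) ?F"
    using tendsto_form_left[OF pX X(3) _ ut(2)] u by (simp add: p_def)
  have "((\<lambda>h. b (q h) (u t)) \<longlongrightarrow> b v' (u t)) ?F"
    using tendsto_form_left[OF qX X(4) _ ut(1)] v by (simp add: q_def)
  moreover have "((\<lambda>h. h) \<longlongrightarrow> 0) ?F" by (rule tendsto_ident_at)
  ultimately have "((\<lambda>h. b (p h) (v t) + b (q h) (u t) + h * b (p h) (q h))
      \<longlongrightarrow> b u' (v t) + b v' (u t) + 0 * b u' v') ?F"
    using pq pv by (intro tendsto_intros)
  \<comment> \<open>Before the limit the rule is an exact identity, in which the quadratic term
    keeps a factor \<open>h\<close>.\<close>
  moreover have "\<forall>\<^sub>F h in ?F. b (p h) (v t) + b (q h) (u t) + h * b (p h) (q h)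
      = (b (u (t + h)) (v (t + h)) - b (u t) (v t)) / h"
    using ev pX qX
  proof eventually_elim
    case (elim h)
    then have e: "u (t + h) = u t + h *\<^sub>R p h" "v (t + h) = v t + h *\<^sub>R q h"
      by (auto simp: p_def q_def)
    show ?case
      unfolding e using elim ut form_sym[of "u t" "q h"]
      by (simp add: form_simps field_simps)
  qed
  ultimately have lim: "((\<lambda>h. (b (u (t + h)) (v (t + h)) - b (u t) (v t)) / h)
      \<longlongrightarrow> b u' (v t) + b (u t) v') ?F"
    using form_sym[OF ut(1) X(4)] by (simp add: tendsto_cong)
  have "filterlim (\<lambda>s. s - t) ?F (at t within {0..})"
    by (auto simp: filterlim_at eventually_at_filter intro!: tendsto_eq_intros)
  from filterlim_compose[OF lim this] show ?thesis
    by (simp add: has_field_derivative_iff)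
qed

text \<open>The minimising sequence of \<open>v \<mapsto> b v v - 2 l v\<close> is Cauchy by the parallelogram law.\<close>

lemma Riesz_representation_form:
  assumes complete: "\<And>f. (\<And>n. f n \<in> X) \<Longrightarrow>
        (\<And>e. e > 0 \<Longrightarrow> \<exists>M. \<forall>m\<ge>M. \<forall>n\<ge>M. b (f m - f n) (f m - f n) < e) \<Longrightarrow>
        \<exists>x\<in>X. (\<lambda>n. b (f n - x) (f n - x)) \<longlonglongrightarrow> 0"
    and l_add: "\<And>u v. u \<in> X \<Longrightarrow> v \<in> X \<Longrightarrow> l (u + v) = l u + l v"
    and l_scale: "\<And>c u. u \<in> X \<Longrightarrow> l (c *\<^sub>R u) = c * l u"
    and bound: "\<And>v. v \<in> X \<Longrightarrow> (l v)\<^sup>2 \<le> C * b v v"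
  shows "\<exists>w\<in>X. \<forall>v\<in>X. b w v = l v"
proof -
  define J where "J v = b v v - 2 * l v" for v
  \<comment> \<open>The arithmetic-geometric mean inequality bounds \<open>2 * l v\<close>. The
    absolute value appears because no sign of \<open>C\<close> is given.\<close>
  have J_lower: "- \<bar>C\<bar> \<le> J v" if "v \<in> X" for v
  proof -
    have "(l v)\<^sup>2 \<le> \<bar>C\<bar> * b v v"
      using bound[OF that] form_nonneg[OF that] by (smt (verit) mult_right_mono)
    moreover have "4 * (\<bar>C\<bar> * b v v) \<le> (\<bar>C\<bar> + b v v)\<^sup>2"
      using zero_le_power2[of "\<bar>C\<bar> - b v v"] by (simp add: power2_eq_square algebra_simps)
    ultimately have "(2 * l v)\<^sup>2 \<le> (\<bar>C\<bar> + b v v)\<^sup>2"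
      by simp
    then have "2 * l v \<le> \<bar>C\<bar> + b v v"
      using form_nonneg[OF that] by (smt (verit) power2_le_imp_le)
    then show ?thesis by (simp add: J_def)
  qed
  define m where "m = Inf (J ` X)"
  have bdd: "bdd_below (J ` X)"
    using J_lower by (intro bdd_belowI[of _ "- \<bar>C\<bar>"]) auto
  have m_le: "m \<le> J v" if "v \<in> X" for v
    unfolding m_def using bdd that by (intro cInf_lower) auto
  have "\<exists>v\<in>X. J v < m + 1 / (real n + 1)" for n
  proof -
    have "J ` X \<noteq> {}" "Inf (J ` X) < m + 1 / (real n + 1)"
      using mem_zero by (blast, simp add: m_def)
    from cInf_lessD[OF this] show ?thesis by blast
  qed
  then obtain f where f: "\<And>n. f n \<in> X" "\<And>n. J (f n) < m + 1 / (real n + 1)"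
    by metis
  have inv: "1 / (real k + 1) \<le> 1 / (real M + 1)" if "k \<ge> M" for k M
    using that by (simp add: field_simps)
  have cauchy: "\<exists>M. \<forall>m\<ge>M. \<forall>n\<ge>M. b (f m - f n) (f m - f n) < e" if e: "e > 0" for e
  proof -
    obtain M :: nat where M: "1 / (real M + 1) < e / 4"
      using reals_Archimedean[of "e / 4"] e by (auto simp: inverse_eq_divide add.commute)
    have "b (f j - f k) (f j - f k) < e" if "j \<ge> M" "k \<ge> M" for j k
    proof -
      note [simp] = f(1)
      \<comment> \<open>The terms in \<open>l\<close> cancel against those of the midpoint, whose
        value under \<open>J\<close> is at least \<open>m\<close>.\<close>
      have "b (f j - f k) (f j - f k) = 2 * (J (f j) + J (f k) - 2 * J ((1 / 2) *\<^sub>R (f j + f k)))"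
        unfolding J_def using form_sym[of "f j" "f k"]
        by (simp add: form_simps l_add l_scale algebra_simps)
      also have "\<dots> < 2 * (1 / (real j + 1) + 1 / (real k + 1))"
        using f(2)[of j] f(2)[of k] m_le[of "(1 / 2) *\<^sub>R (f j + f k)"] by simp
      also have "\<dots> < e"
        using inv[OF that(1)] inv[OF that(2)] M by simp
      finally show ?thesis .
    qed
    then show ?thesis by blast
  qed
  obtain w where w: "w \<in> X" "(\<lambda>n. b (f n - w) (f n - w)) \<longlonglongrightarrow> 0"
    using complete[of f, OF f(1) cauchy] by blast
  have "b w v = l v" if v: "v \<in> X" for v
  proof -
    have "(\<lambda>n. b (f n) v) \<longlonglongrightarrow> b w v"
      using tendsto_form_left[OF _ w v] f(1) by simp
    then have lim: "(\<lambda>n. s\<^sup>2 * b v v + 2 * s * (b (f n) v - l v) + 1 / (real n + 1))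
        \<longlonglongrightarrow> s\<^sup>2 * b v v + 2 * s * (b w v - l v) + 0" for s
      by (intro tendsto_intros) (use LIMSEQ_inverse_real_of_nat in \<open>auto simp: inverse_eq_divide add.commute\<close>)
    \<comment> \<open>The first variation: \<open>J (f n)\<close> exceeds the infimum by less than
      \<open>1 / (real n + 1)\<close>, so moving along \<open>v\<close> cannot gain more than
      that.\<close>
    have ineq: "0 \<le> s\<^sup>2 * b v v + 2 * s * (b w v - l v)" for s
    proof -
      have "0 \<le> s\<^sup>2 * b v v + 2 * s * (b (f n) v - l v) + 1 / (real n + 1)" for n
      proof -
        note [simp] = f(1) v
        have "J (f n + s *\<^sub>R v) = J (f n) + (s\<^sup>2 * b v v + 2 * s * (b (f n) v - l v))"
          unfolding J_def using form_sym[of "f n" v]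
          by (simp add: form_simps l_add l_scale algebra_simps power2_eq_square)
        then show ?thesis
          using m_le[of "f n + s *\<^sub>R v"] f(2)[of n] by simp
      qed
      then show ?thesis using LIMSEQ_le_const[OF lim] by auto
    qed
    show ?thesis
    proof (rule ccontr)
      define d where "d = b w v - l v"
      assume "b w v \<noteq> l v"
      then have d: "d \<noteq> 0" by (simp add: d_def)
      \<comment> \<open>The step \<open>- d / k\<close> nearly minimises the quadratic. The added 1
        keeps \<open>k\<close> positive when \<open>v\<close> is a null vector.\<close>
      define k where "k = b v v + 1"
      define s where "s = - d / k"
      have k: "k > 0" using form_nonneg[OF v] by (simp add: k_def)
      have sk: "s * k = - d" using k by (simp add: s_def)
      have "s\<^sup>2 * b v v + 2 * s * d = s * (s * k) - s\<^sup>2 + 2 * s * d"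
        by (simp add: k_def power2_eq_square algebra_simps)
      also have "\<dots> = - (d\<^sup>2 / k) - s\<^sup>2"
        unfolding sk by (simp add: s_def power2_eq_square)
      also have "\<dots> < 0"
      proof -
        have "0 < d\<^sup>2 / k" using d k by simp
        then show ?thesis using zero_le_power2[of s] by linarith
      qed
      finally show False using ineq[of s] by (simp add: d_def)
    qed
  qed
  then show ?thesis using w(1) by blast
qed

end

subsection \<open>Positive semidefinite matrices\<close>

text \<open>Vectors are total functions whose entries from \<open>N\<close> on are ignored, so even
  a positive definite matrix gives only a semi-inner product here.\<close>

definition quad_form :: "nat \<Rightarrow> (nat \<Rightarrow> nat \<Rightarrow> real) \<Rightarrow> (nat \<Rightarrow> real) \<Rightarrow> (nat \<Rightarrow> real) \<Rightarrow> real" where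
  "quad_form N M x y = (\<Sum>i<N. \<Sum>j<N. x i * M i j * y j)"

lemma semi_inner_product_quad_form:
  assumes "psd N M"
  shows "semi_inner_product UNIV (quad_form N M)"
proof
  show "quad_form N M u v = quad_form N M v u" for u v
  proof -
    have "quad_form N M u v = (\<Sum>i<N. \<Sum>j<N. v j * M j i * u i)"
      unfolding quad_form_def using assms
      by (intro sum.cong refl) (auto simp: psd_def)
    then show ?thesis unfolding quad_form_def by (subst (asm) sum.swap)
  qed
  show "0 \<le> quad_form N M u u" for u
    using assms by (auto simp: psd_def quad_form_def)
qed (auto simp: quad_form_def sum.distrib sum_distrib_left algebra_simps)

text \<open>Read as a vector, \<open>idm i\<close> is the i-th unit vector; Cauchy-Schwarz for the
  form thus becomes an inequality between matrix entries.\<close>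

lemma quad_form_idm:
  assumes "i < N" "j < N"
  shows "quad_form N M (idm i) (idm j) = M i j"
  using assms
  by (simp add: quad_form_def idm_def if_distrib[of "\<lambda>a. a * _"] if_distrib[of "\<lambda>a. _ * a"] cong: if_cong)

lemma psd_diag_nonneg: "psd N M \<Longrightarrow> i < N \<Longrightarrow> 0 \<le> M i i"
  using quad_form_idm[of i N i M] unfolding psd_def quad_form_def by metis

lemma quad_form_idm_left:
  assumes "i < N"
  shows "quad_form N M (idm i) y = (\<Sum>j<N. M i j * y j)"
proof -
  have "quad_form N M (idm i) y = (\<Sum>j<N. \<Sum>k<N. idm i k * M k j * y j)"
    unfolding quad_form_def by (rule sum.swap)
  then show ?thesis
    using assms by (simp add: idm_def if_distrib[of "\<lambda>a. a * _"] cong: if_cong)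
qed

text \<open>A Cholesky factorisation: split off the last row and column and factor the Schur
  complement. It turns abstract Gram matrices into concrete finite sums.\<close>

lemma psd_imp_gram_matrix:
  assumes "psd n P"
  shows "\<exists>R :: nat \<Rightarrow> nat \<Rightarrow> real. \<forall>i<n. \<forall>j<n. P i j = (\<Sum>k<n. R k i * R k j)"
  using assms
proof (induction n arbitrary: P)
  case 0
  then show ?case by simp
next
  case (Suc n)
  interpret semi_inner_product UNIV "quad_form (Suc n) P"
    using Suc.prems by (rule semi_inner_product_quad_form)
  have sym: "P i j = P j i" if "i < Suc n" "j < Suc n" for i j
    using Suc.prems that by (auto simp: psd_def)
  define p where "p = P n n"
  have p: "0 \<le> p"
    using psd_diag_nonneg[OF Suc.prems] by (simp add: p_def)
  have CS: "(P i n)\<^sup>2 \<le> P i i * p" if "i < Suc n" for i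
    using Cauchy_Schwarz_form[of "idm i" "idm n"] that by (simp add: quad_form_idm p_def)
  \<comment> \<open>The Schur complement; for \<open>p = 0\<close> it is \<open>P\<close> itself because \<open>x / 0 = 0\<close>.\<close>
  define Q where "Q i j = P i j - P i n * P n j / p" for i j
  \<comment> \<open>A vanishing pivot forces its whole row to vanish, so nothing is lost by dividing
    by zero.\<close>
  have row0: "P i n = 0" if "p = 0" "i < Suc n" for i
    using CS[OF that(2)] that(1) by simp
  have "psd n Q"
    unfolding psd_def
  proof (intro conjI allI impI)
    fix i j assume "i < n" "j < n"
    then show "Q i j = Q j i"
      using sym[of i j] sym[of i n] sym[of j n] by (simp add: Q_def mult.commute)
  next
    fix z :: "nat \<Rightarrow> real"
    define c where "c = (\<Sum>i<n. z i * P i n)"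
    \<comment> \<open>The last coordinate minimises the form of \<open>P\<close> with the others
      fixed; the minimum is the form of \<open>Q\<close> at \<open>z\<close>.\<close>
    define y where "y i = (if i < n then z i else - c / p)" for i
    have c2: "(\<Sum>i<n. P n i * z i) = c"
      unfolding c_def by (intro sum.cong) (auto simp: sym mult.commute)
    have "0 \<le> quad_form (Suc n) P y y" by (rule form_nonneg) simp
    also have "quad_form (Suc n) P y y
        = (\<Sum>i<n. \<Sum>j<n. z i * P i j * z j) + (\<Sum>i<n. z i * P i n * (- c / p))
          + (\<Sum>j<n. (- c / p) * P n j * z j) + (- c / p) * p * (- c / p)"
      by (simp add: quad_form_def y_def sum.distrib p_def sum_negf sum_subtractf)
    also have "(\<Sum>i<n. z i * P i n * (- c / p)) = c * (- c / p)"
      by (simp only: sum_distrib_right[symmetric] c_def[symmetric])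
    also have "(\<Sum>j<n. (- c / p) * P n j * z j) = (- c / p) * c"
      by (simp only: mult.assoc sum_distrib_left[symmetric] c2)
    also have "(- c / p) * p * (- c / p) = c * c / p"
      by simp
    also have "(\<Sum>i<n. \<Sum>j<n. z i * P i j * z j) + c * (- c / p) + (- c / p) * c + c * c / p
        = (\<Sum>i<n. \<Sum>j<n. z i * P i j * z j) - c * c / p" by simp
    also have "c * c / p = (\<Sum>i<n. z i * P i n) * (\<Sum>j<n. P n j * z j) / p"
      by (simp only: c2 c_def[symmetric])
    also have "\<dots> = (\<Sum>i<n. \<Sum>j<n. z i * (P i n * P n j / p) * z j)"
      by (simp add: sum_product sum_divide_distrib mult_ac)
    finally show "0 \<le> (\<Sum>i<n. \<Sum>j<n. z i * Q i j * z j)"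
      by (simp only: Q_def right_diff_distrib left_diff_distrib sum_subtractf)
  qed
  from Suc.IH[OF this] obtain R where R: "\<And>i j. i < n \<Longrightarrow> j < n \<Longrightarrow> Q i j = (\<Sum>k<n. R k i * R k j)"
    by blast
  \<comment> \<open>The new row reproduces the rank-one part removed from \<open>P\<close>; the old
    factor is extended by a zero column.\<close>
  define T where "T k i = (if k = n then P i n / sqrt p else if i = n then 0 else R k i)" for k i
  have "P i j = (\<Sum>k<Suc n. T k i * T k j)" if ij: "i < Suc n" "j < Suc n" for i j
  proof -
    have last: "T n i * T n j = P i n * P n j / p"
      using p ij sym[of j n] by (simp add: T_def)
    have "(\<Sum>k<n. T k i * T k j) = (if i < n \<and> j < n then Q i j else 0)"
      using ij R[of i j] by (auto simp: T_def less_Suc_eq)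
    then show ?thesis
      using last ij row0[of i] row0[of j] sym[of i n] sym[of j n]
      by (cases "p = 0") (auto simp: Q_def p_def less_Suc_eq)
  qed
  then show ?case by blast
qed

context semi_inner_product
begin

lemma psd_gram_form:
  assumes "\<And>i. i < n \<Longrightarrow> w i \<in> X"
  shows "psd n (\<lambda>i j. b (w i) (w j))"
  unfolding psd_def
proof (intro conjI allI impI)
  show "b (w i) (w j) = b (w j) (w i)" if "i < n" "j < n" for i j
    using assms that by (intro form_sym) auto
  fix z :: "nat \<Rightarrow> real"
  have "0 \<le> b (\<Sum>i<n. z i *\<^sub>R w i) (\<Sum>i<n. z i *\<^sub>R w i)"
    using assms by (intro form_nonneg) auto
  also have "\<dots> = (\<Sum>i<n. \<Sum>j<n. z i * b (w i) (w j) * z j)"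
  proof -
    have w: "\<And>i. i \<in> {..<n} \<Longrightarrow> w i \<in> X" "\<And>i. i \<in> {..<n} \<Longrightarrow> z i *\<^sub>R w i \<in> X"
      using assms by auto
    show ?thesis
      by (simp only: form_sum_left[OF mem_sum[OF w(2)] w(2)])
        (intro sum.cong refl, simp only: form_sum_right[OF w(2) w(2)], intro sum.cong refl,
          simp add: form_simps w)
  qed
  finally show "0 \<le> (\<Sum>i<n. \<Sum>j<n. z i * b (w i) (w j) * z j)" .
qed

text \<open>In Euclidean coordinates \<open>\<langle>U,U\<rangle> = P\<^sup>TP\<close>, \<open>\<langle>U,W\<rangle> = P\<^sup>TQ\<close> and \<open>\<langle>W,W\<rangle> = Q\<^sup>TQ\<close>; with
  \<open>Y = PQ\<^sup>T\<close> the claim becomes \<open>tr Y\<^sup>2 \<le> tr (Y\<^sup>TY)\<close>.\<close>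

lemma trace_cross_gram_le:
  fixes n :: nat
  assumes u: "\<And>i. i < n \<Longrightarrow> u i \<in> X" and w: "\<And>i. i < n \<Longrightarrow> w i \<in> X"
  shows "(\<Sum>i<n. \<Sum>j<n. b (u i) (w j) * b (u j) (w i)) \<le> (\<Sum>i<n. \<Sum>j<n. b (u i) (u j) * b (w i) (w j))"
proof -
  define m where "m = n + n"
  \<comment> \<open>Both families are listed together, so that one factorisation gives them
    coordinates in the same Euclidean space.\<close>
  define f where "f i = (if i < n then u i else w (i - n))" for i
  have "psd m (\<lambda>i j. b (f i) (f j))"
    using u w by (intro psd_gram_form) (auto simp: f_def m_def)
  from psd_imp_gram_matrix[OF this] obtain R
    where R: "\<And>i j. i < m \<Longrightarrow> j < m \<Longrightarrow> b (f i) (f j) = (\<Sum>k<m. R k i * R k j)"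
    by auto
  define Q where "Q k i = R k (n + i)" for k i :: nat
  have uu: "b (u i) (u j) = (\<Sum>k<m. R k i * R k j)" and uw: "b (u i) (w j) = (\<Sum>k<m. R k i * Q k j)"
    and ww: "b (w i) (w j) = (\<Sum>k<m. Q k i * Q k j)" if "i < n" "j < n" for i j
    using that R[of i j] R[of i "n + j"] R[of "n + i" "n + j"] by (simp_all add: f_def m_def Q_def)
  define Y where "Y k l = (\<Sum>i<n. R k i * Q l i)" for k l
  have swap: "(\<Sum>i<n. \<Sum>j<n. \<Sum>k<m. \<Sum>l<m. F i j k l) = (\<Sum>k<m. \<Sum>l<m. \<Sum>i<n. \<Sum>j<n. F i j k l)"
    for F :: "nat \<Rightarrow> nat \<Rightarrow> nat \<Rightarrow> nat \<Rightarrow> real"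
  proof -
    have "(\<Sum>i<n. \<Sum>j<n. \<Sum>k<m. \<Sum>l<m. F i j k l) = (\<Sum>i<n. \<Sum>k<m. \<Sum>j<n. \<Sum>l<m. F i j k l)"
      by (intro sum.cong refl sum.swap)
    also have "\<dots> = (\<Sum>k<m. \<Sum>i<n. \<Sum>j<n. \<Sum>l<m. F i j k l)"
      by (rule sum.swap)
    also have "\<dots> = (\<Sum>k<m. \<Sum>i<n. \<Sum>l<m. \<Sum>j<n. F i j k l)"
      by (intro sum.cong refl sum.swap)
    also have "\<dots> = (\<Sum>k<m. \<Sum>l<m. \<Sum>i<n. \<Sum>j<n. F i j k l)"
      by (intro sum.cong refl sum.swap)
    finally show ?thesis .
  qed
  have "(\<Sum>i<n. \<Sum>j<n. b (u i) (w j) * b (u j) (w i))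
      = (\<Sum>i<n. \<Sum>j<n. \<Sum>k<m. \<Sum>l<m. (R k i * Q k j) * (R l j * Q l i))"
    by (intro sum.cong refl) (simp add: uw sum_product)
  also have "\<dots> = (\<Sum>k<m. \<Sum>l<m. Y k l * Y l k)"
    unfolding swap Y_def sum_product by (intro sum.cong refl) (simp only: mult_ac)
  also have "\<dots> \<le> (\<Sum>k<m. \<Sum>l<m. ((Y k l)\<^sup>2 + (Y l k)\<^sup>2) / 2)"
  proof (intro sum_mono)
    show "Y k l * Y l k \<le> ((Y k l)\<^sup>2 + (Y l k)\<^sup>2) / 2" for k l
      using sum_squares_bound[of "Y k l" "Y l k"] by simp
  qed
  also have "\<dots> = ((\<Sum>k<m. \<Sum>l<m. (Y k l)\<^sup>2) + (\<Sum>k<m. \<Sum>l<m. (Y l k)\<^sup>2)) / 2"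
    by (simp add: sum_divide_distrib[symmetric] sum.distrib)
  also have "(\<Sum>k<m. \<Sum>l<m. (Y l k)\<^sup>2) = (\<Sum>k<m. \<Sum>l<m. (Y k l)\<^sup>2)"
    by (rule sum.swap)
  also have "((\<Sum>k<m. \<Sum>l<m. (Y k l)\<^sup>2) + (\<Sum>k<m. \<Sum>l<m. (Y k l)\<^sup>2)) / 2
      = (\<Sum>k<m. \<Sum>l<m. \<Sum>i<n. \<Sum>j<n. (R k i * R k j) * (Q l i * Q l j))"
    by (simp add: Y_def power2_eq_square sum_product mult_ac)
  also have "\<dots> = (\<Sum>i<n. \<Sum>j<n. b (u i) (u j) * b (w i) (w j))"
    unfolding swap[symmetric] by (intro sum.cong refl) (simp add: uu ww sum_product)
  finally show ?thesis .
qed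

end

text \<open>The unit sphere of R^N inside sequences with zero tail. It is closed in the cube of all
  functions into [-1, 1], which is compact by Tychonoff; the first-contact argument below needs
  this.\<close>

lemma compact_unit_sphere_fun:
  "compact {z :: nat \<Rightarrow> real. (\<forall>i\<ge>N. z i = 0) \<and> (\<Sum>i<N. (z i)\<^sup>2) = 1}" (is "compact ?Z")
proof -
  define B where "B = (\<Pi>\<^sub>E i\<in>(UNIV :: nat set). {-1..1 :: real})"
  have "compactin (product_topology (\<lambda>i::nat. euclidean :: real topology) UNIV) B"
    unfolding B_def by (subst compactin_PiE) (auto simp: compactin_euclidean_iff)
  then have B: "compact B"
    by (simp add: euclidean_product_topology compactin_euclidean_iff)
  have "?Z = (\<Inter>i\<in>{N..}. {z. z i = 0}) \<inter> {z. (\<Sum>i<N. (z i)\<^sup>2) = 1}"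
    by auto
  moreover have "closed {z :: nat \<Rightarrow> real. z i = 0}" for i
    by (intro closed_Collect_eq continuous_intros continuous_on_product_coordinates)
  moreover have "closed {z :: nat \<Rightarrow> real. (\<Sum>i<N. (z i)\<^sup>2) = 1}"
    by (intro closed_Collect_eq continuous_intros continuous_on_product_coordinates)
  ultimately have "closed ?Z"
    by (simp only:) (intro closed_Int closed_INT ballI; assumption)
  moreover have "?Z \<subseteq> B"
  proof
    fix z assume z: "z \<in> ?Z"
    have "z i \<in> {-1..1}" for i
    proof (cases "i < N")
      case True
      have "(z i)\<^sup>2 \<le> (\<Sum>i<N. (z i)\<^sup>2)"
        using True by (intro member_le_sum) auto
      then have "(z i)\<^sup>2 \<le> 1" using z by simp
      then show ?thesis by (simp add: abs_square_le_1 abs_le_iff)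
    qed (use z in auto)
    then show "z \<in> B" by (auto simp: B_def)
  qed
  ultimately show ?thesis
    using compact_Int_closed[OF B, of ?Z] by (simp add: inf.absorb2)
qed

lemma quad_form_scale:
  "quad_form N M (c *\<^sub>R x) y = c * quad_form N M x y" "quad_form N M x (c *\<^sub>R y) = c * quad_form N M x y"
  by (simp_all add: quad_form_def sum_distrib_left mult_ac)

text \<open>By homogeneity the compact sphere suffices: cut off the ignored entries and
  normalise.\<close>

lemma quad_form_pos_imp_psd:
  assumes "\<And>i j. i < N \<Longrightarrow> j < N \<Longrightarrow> M i j = M j i"
    and "\<And>z. (\<forall>i\<ge>N. z i = 0) \<Longrightarrow> (\<Sum>i<N. (z i)\<^sup>2) = 1 \<Longrightarrow> 0 \<le> quad_form N M z z"
  shows "psd N M"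
  unfolding psd_def
proof (intro conjI allI impI)
  fix z :: "nat \<Rightarrow> real"
  define s where "s = (\<Sum>i<N. (z i)\<^sup>2)"
  define y where "y i = (if i < N then z i / sqrt s else 0)" for i
  have "0 \<le> quad_form N M z z"
  proof (cases "s = 0")
    case True
    then have "\<forall>i<N. z i = 0"
      unfolding s_def by (subst (asm) sum_nonneg_eq_0_iff) auto
    then show ?thesis by (simp add: quad_form_def)
  next
    case False
    moreover have "0 \<le> s" unfolding s_def by (intro sum_nonneg) auto
    ultimately have s: "s > 0" by simp
    have "(\<Sum>i<N. (y i)\<^sup>2) = 1"
      using s by (simp add: y_def power_divide sum_divide_distrib[symmetric] s_def[symmetric])
    then have "0 \<le> quad_form N M y y" using assms(2)[of y] by (simp add: y_def)
    moreover have "quad_form N M z z = quad_form N M (sqrt s *\<^sub>R y) (sqrt s *\<^sub>R y)"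
      unfolding quad_form_def using s by (intro sum.cong) (auto simp: y_def)
    then have "quad_form N M z z = s * quad_form N M y y"
      using s by (simp add: quad_form_scale)
    ultimately show ?thesis using s by simp
  qed
  then show "0 \<le> (\<Sum>i<N. \<Sum>j<N. z i * M i j * z j)" by (simp add: quad_form_def)
qed (use assms in auto)

text \<open>At the first time \<open>D + \<epsilon> (1 + t) I\<close> acquires a unit null vector \<open>z\<close>, the derivative of its
  quadratic form at \<open>z\<close> is \<open>\<epsilon> + 2 \<epsilon> (1 + t) (z, A z) > 0\<close>, although the form was
  positive before.\<close>

lemma psd_preserved_Lyapunov:
  assumes deriv: "\<And>t i j. 0 \<le> t \<Longrightarrow> i < N \<Longrightarrow> j < N \<Longrightarrow>
      ((\<lambda>s. D s i j) has_real_derivative - (\<Sum>k<N. A t i k * D t k j + D t i k * A t k j)) (at t within {0..})"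
    and sym: "\<And>t i j. 0 \<le> t \<Longrightarrow> i < N \<Longrightarrow> j < N \<Longrightarrow> D t i j = D t j i"
    and A: "\<And>t. 0 \<le> t \<Longrightarrow> psd N (A t)"
    and D0: "psd N (D 0)"
    and T: "0 \<le> T"
  shows "psd N (D T)"
proof -
  define Z where "Z = {z :: nat \<Rightarrow> real. (\<forall>i\<ge>N. z i = 0) \<and> (\<Sum>i<N. (z i)\<^sup>2) = 1}"
  have Z: "compact Z" unfolding Z_def by (rule compact_unit_sphere_fun)
  define q where "q t z = quad_form N (D t) z z" for t z
  have q_cont: "continuous_on ({0..} \<times> UNIV) (\<lambda>p. q (fst p) (snd p))"
  proof -
    have 1: "continuous_on ({0..} \<times> UNIV) (\<lambda>p. D (fst p) i j)" if "i < N" "j < N" for i j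
    proof (rule continuous_on_compose2[of "{0..}" "\<lambda>t. D t i j"])
      show "continuous_on {0..} (\<lambda>t. D t i j)"
        using deriv[OF _ that] DERIV_continuous by (fastforce simp: continuous_on_eq_continuous_within)
    qed (auto intro: continuous_intros)
    have 2: "continuous_on ({0..} \<times> UNIV) (\<lambda>p :: real \<times> (nat \<Rightarrow> real). snd p i)" for i
      by (rule continuous_on_compose2[of UNIV "\<lambda>z. z i"]) (auto intro: continuous_intros)
    show ?thesis
      unfolding q_def quad_form_def by (intro continuous_on_sum continuous_on_mult 1 2) auto
  qed
  have pos: "0 \<le> q T z + e * (1 + T)" if e: "e > 0" and z: "z \<in> Z" for e z
  proof (rule ccontr)
    assume neg: "\<not> 0 \<le> q T z + e * (1 + T)"
    \<comment> \<open>The perturbation grows with time, and its slope \<open>e\<close> makes the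
      final contradiction strict.\<close>
    define Q where "Q p = q (fst p) (snd p) + e * (1 + fst p)" for p
    define C where "C = {p \<in> {0..T} \<times> Z. Q p \<le> 0}"
    have Qc: "continuous_on ({0..} \<times> UNIV) Q"
      unfolding Q_def by (intro continuous_intros q_cont)
    have "closedin (top_of_set ({0..T} \<times> Z)) C"
    proof -
      have "continuous_on ({0..T} \<times> Z) Q"
        by (rule continuous_on_subset[OF Qc]) auto
      from continuous_closedin_preimage[OF this, of "{..0}"] show ?thesis
        by (simp add: C_def vimage_def Int_def)
    qed
    moreover have cTZ: "compact ({0..T} \<times> Z)"
      using Z by (intro compact_Times) auto
    ultimately have "compact C"
      by (metis closedin_compact)
    moreover have "(T, z) \<in> C"
      using neg z T by (auto simp: C_def Q_def)
    \<comment> \<open>The earliest pair of a time and a direction at which the perturbed form is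
      nonpositive.\<close>
    ultimately obtain p where p: "p \<in> C" "\<And>p'. p' \<in> C \<Longrightarrow> fst p \<le> fst p'"
      using continuous_attains_inf[of C fst] continuous_on_fst[OF continuous_on_id] by blast
    define t w where "t = fst p" and "w = snd p"
    have t: "0 \<le> t" "t \<le> T" and w: "w \<in> Z" and Qtw: "q t w + e * (1 + t) \<le> 0"
      using p(1) by (auto simp: C_def t_def w_def Q_def)
    have before: "0 < q s y + e * (1 + s)" if "0 \<le> s" "s < t" "y \<in> Z" for s y
      using p(2)[of "(s, y)"] that t by (force simp: C_def Q_def t_def)
    have "q 0 w \<ge> 0"
      using D0 by (auto simp: q_def psd_def quad_form_def)
    then have t_pos: "t > 0"
      using Qtw e t(1) by (cases "t = 0") auto
    \<comment> \<open>By continuity from the left, the form is still nonnegative in every direction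
      at the contact time.\<close>
    have at_t: "0 \<le> q t y + e * (1 + t)" if y: "y \<in> Z" for y
    proof (rule tendsto_lowerbound)
      have "continuous_on {0..} (\<lambda>s. Q (s, y))"
        by (rule continuous_on_compose2[OF Qc]) (auto intro: continuous_intros)
      then have "((\<lambda>s. Q (s, y)) \<longlongrightarrow> Q (t, y)) (at t within {0..})"
        using t(1) by (auto simp: continuous_on_def)
      then have "((\<lambda>s. Q (s, y)) \<longlongrightarrow> Q (t, y)) (at t within {0..t})"
        by (rule tendsto_within_subset) auto
      then show "((\<lambda>s. q s y + e * (1 + s)) \<longlongrightarrow> q t y + e * (1 + t)) (at t within {0..t})"
        by (simp add: Q_def)
      show "\<forall>\<^sub>F s in at t within {0..t}. 0 \<le> q s y + e * (1 + s)"
        using before[OF _ _ y] by (auto simp: eventually_at_filter less_imp_le)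
      show "at t within {0..t} \<noteq> bot"
        using t_pos by (simp add: at_within_Icc_at_left)
    qed
    define M where "M i j = D t i j + (e * (1 + t)) * idm i j" for i j
    have idm_sum: "(\<Sum>j<N. x i * (c * idm i j) * y j) = c * (x i * y i)" if "i < N" for i x y c
      using that by (simp add: idm_def if_distrib[of "\<lambda>a. a * _"] if_distrib[of "\<lambda>a. _ * a"] cong: if_cong)
    have M_form: "quad_form N M x y = quad_form N (D t) x y + e * (1 + t) * (\<Sum>i<N. x i * y i)" for x y
    proof -
      have "quad_form N M x y = quad_form N (D t) x y + (\<Sum>i<N. \<Sum>j<N. x i * ((e * (1 + t)) * idm i j) * y j)"
        by (simp add: quad_form_def M_def distrib_left distrib_right sum.distrib)
      also have "(\<Sum>i<N. \<Sum>j<N. x i * ((e * (1 + t)) * idm i j) * y j) = (\<Sum>i<N. (e * (1 + t)) * (x i * y i))"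
        by (intro sum.cong refl idm_sum) auto
      finally show ?thesis by (simp add: sum_distrib_left)
    qed
    have M_psd: "psd N M"
    proof (rule quad_form_pos_imp_psd)
      show "M i j = M j i" if "i < N" "j < N" for i j
        using sym[OF t(1) that] by (simp add: M_def idm_def)
      fix y :: "nat \<Rightarrow> real" assume y: "\<forall>i\<ge>N. y i = 0" "(\<Sum>i<N. (y i)\<^sup>2) = 1"
      then show "0 \<le> quad_form N M y y"
        using at_t[of y] by (simp add: M_form q_def Z_def power2_eq_square)
    qed
    interpret M: semi_inner_product UNIV "quad_form N M"
      using M_psd by (rule semi_inner_product_quad_form)
    have w1: "(\<Sum>i<N. w i * w i) = 1" using w by (simp add: Z_def power2_eq_square)
    \<comment> \<open>A nonnegative form vanishing at \<open>w\<close> has \<open>w\<close> in its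
      kernel, so \<open>w\<close> is an eigenvector of \<open>D t\<close> with eigenvalue
      \<open>- (e * (1 + t))\<close>. This evaluates both products with \<open>A t\<close>.\<close>
    have "quad_form N M w w = 0"
      using M.form_nonneg[of w] Qtw w1 by (simp add: M_form q_def)
    then have "quad_form N M w (idm i) = 0" for i
      using M.form_null_left[OF UNIV_I UNIV_I] by blast
    then have Mw: "(\<Sum>j<N. M i j * w j) = 0" if "i < N" for i
      using M.form_sym[OF UNIV_I UNIV_I, of w "idm i"] quad_form_idm_left[OF that, of M w] by metis
    have Dw: "(\<Sum>j<N. D t i j * w j) = - (e * (1 + t)) * w i" if "i < N" for i
    proof -
      have "(\<Sum>j<N. M i j * w j) = (\<Sum>j<N. D t i j * w j) + (\<Sum>j<N. 1 * ((e * (1 + t)) * idm i j) * w j)"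
        by (simp add: M_def distrib_right sum.distrib)
      then show ?thesis using Mw[OF that] idm_sum[OF that, of "\<lambda>_. 1" "e * (1 + t)" w] by simp
    qed
    have ADw: "(\<Sum>i<N. \<Sum>j<N. w i * (\<Sum>k<N. A t i k * D t k j) * w j) = - (e * (1 + t)) * quad_form N (A t) w w"
    proof -
      have "(\<Sum>i<N. \<Sum>j<N. w i * (\<Sum>k<N. A t i k * D t k j) * w j)
          = (\<Sum>i<N. \<Sum>j<N. \<Sum>k<N. w i * A t i k * (D t k j * w j))"
        by (simp add: sum_distrib_left sum_distrib_right mult_ac)
      also have "\<dots> = (\<Sum>i<N. \<Sum>k<N. \<Sum>j<N. w i * A t i k * (D t k j * w j))"
        by (intro sum.cong refl sum.swap)
      also have "\<dots> = (\<Sum>i<N. \<Sum>k<N. w i * A t i k * (- (e * (1 + t)) * w k))"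
        by (intro sum.cong refl) (simp only: sum_distrib_left[symmetric] Dw lessThan_iff)
      finally show ?thesis
        by (simp only: quad_form_def sum_distrib_left mult_ac)
    qed
    have DAw: "(\<Sum>i<N. \<Sum>j<N. w i * (\<Sum>k<N. D t i k * A t k j) * w j) = - (e * (1 + t)) * quad_form N (A t) w w"
    proof -
      have "(\<Sum>i<N. \<Sum>j<N. w i * (\<Sum>k<N. D t i k * A t k j) * w j)
          = (\<Sum>i<N. \<Sum>j<N. w j * (\<Sum>k<N. A t j k * D t k i) * w i)"
        using A[OF t(1)] by (intro sum.cong refl) (simp add: sym[OF t(1)] psd_def mult_ac)
      also have "\<dots> = (\<Sum>i<N. \<Sum>j<N. w i * (\<Sum>k<N. A t i k * D t k j) * w j)"
        by (rule sum.swap)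
      finally show ?thesis using ADw by simp
    qed
    have der: "((\<lambda>s. q s w + e * (1 + s)) has_real_derivative
        (\<Sum>i<N. \<Sum>j<N. w i * (- (\<Sum>k<N. A t i k * D t k j + D t i k * A t k j)) * w j) + e) (at t within {0..})"
      unfolding q_def quad_form_def
      by (rule derivative_eq_intros deriv[OF t(1)] refl | simp add: mult_ac)+
    have eq: "(\<Sum>i<N. \<Sum>j<N. w i * (- (\<Sum>k<N. A t i k * D t k j + D t i k * A t k j)) * w j) + e
        = 2 * (e * (1 + t)) * quad_form N (A t) w w + e"
    proof -
      have "(\<Sum>i<N. \<Sum>j<N. w i * (- (\<Sum>k<N. A t i k * D t k j + D t i k * A t k j)) * w j)
          = - (\<Sum>i<N. \<Sum>j<N. w i * (\<Sum>k<N. A t i k * D t k j) * w j)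
            - (\<Sum>i<N. \<Sum>j<N. w i * (\<Sum>k<N. D t i k * A t k j) * w j)"
        by (simp only: sum.distrib distrib_left distrib_right mult_minus_left mult_minus_right
            sum_negf minus_add_distrib diff_conv_add_uminus)
      then show ?thesis using ADw DAw by simp
    qed
    have gt: "0 < 2 * (e * (1 + t)) * quad_form N (A t) w w + e"
      using A[OF t(1)] e t(1) by (intro add_nonneg_pos mult_nonneg_nonneg) (auto simp: psd_def quad_form_def)
    from has_real_derivative_pos_inc_left[OF der[unfolded eq] gt] obtain d where d: "d > 0" "\<And>h. 0 < h \<Longrightarrow> t - h \<in> {0..} \<Longrightarrow> h < d \<Longrightarrow>
        q (t - h) w + e * (1 + (t - h)) < q t w + e * (1 + t)"
      by blast
    define h where "h = min (d / 2) (t / 2)"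
    have h: "0 < h" "h < d" "h < t" using d(1) t_pos by (auto simp: h_def)
    show False
      using d(2)[OF h(1) _ h(2)] before[of "t - h" w] h w Qtw by simp
  qed
  show ?thesis
  proof (rule quad_form_pos_imp_psd)
    show "D T i j = D T j i" if "i < N" "j < N" for i j using sym[OF T that] .
    fix z :: "nat \<Rightarrow> real" assume "\<forall>i\<ge>N. z i = 0" "(\<Sum>i<N. (z i)\<^sup>2) = 1"
    then have z: "z \<in> Z" by (simp add: Z_def)
    show "0 \<le> quad_form N (D T) z z"
    proof (rule field_le_epsilon)
      \<comment> \<open>The perturbation at time \<open>T\<close> is \<open>e * (1 + T)\<close>,
        hence the rescaling before \<open>e\<close> tends to zero.\<close>
      fix e :: real assume "e > 0"
      then show "0 \<le> quad_form N (D T) z z + e"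
        using pos[of "e / (1 + T)" z] z T by (simp add: q_def)
    qed
  qed
qed

subsection \<open>Square-integrable functions\<close>

text \<open>Values in any Euclidean space are allowed, so one theory serves functions, gradients and
  pairs of the two.\<close>

definition sq_integrable :: "'a measure \<Rightarrow> ('a \<Rightarrow> 'b::euclidean_space) \<Rightarrow> bool" where
  "sq_integrable M f \<longleftrightarrow> f \<in> borel_measurable M \<and> integrable M (\<lambda>x. (norm (f x))\<^sup>2)"

definition l2prod :: "'a measure \<Rightarrow> ('a \<Rightarrow> 'b::euclidean_space) \<Rightarrow> ('a \<Rightarrow> 'b) \<Rightarrow> real" where
  "l2prod M f g = (LINT x|M. f x \<bullet> g x)"

lemma l2prod_self: "l2prod M f f = (LINT x|M. (norm (f x))\<^sup>2)"
  by (simp add: l2prod_def power2_norm_eq_inner)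

lemma sq_integrable_inner:
  assumes "sq_integrable M f" "sq_integrable M g"
  shows "integrable M (\<lambda>x. f x \<bullet> g x)"
proof (rule Bochner_Integration.integrable_bound)
  show "integrable M (\<lambda>x. (norm (f x))\<^sup>2 + (norm (g x))\<^sup>2)"
    using assms by (auto simp: sq_integrable_def)
  show "(\<lambda>x. f x \<bullet> g x) \<in> borel_measurable M"
    using assms by (auto simp: sq_integrable_def)
  have "\<bar>f x \<bullet> g x\<bar> \<le> (norm (f x))\<^sup>2 + (norm (g x))\<^sup>2" for x
  proof -
    have "2 * (norm (f x) * norm (g x)) \<le> (norm (f x))\<^sup>2 + (norm (g x))\<^sup>2"
      using sum_squares_bound[of "norm (f x)" "norm (g x)"] by (simp add: mult.assoc)
    moreover have "0 \<le> norm (f x) * norm (g x)" by simp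
    ultimately show ?thesis
      using Cauchy_Schwarz_ineq2[of "f x" "g x"] by linarith
  qed
  then show "AE x in M. norm (f x \<bullet> g x) \<le> norm ((norm (f x))\<^sup>2 + (norm (g x))\<^sup>2)"
    by (auto simp: abs_of_nonneg)
qed

lemma sq_integrable_add:
  assumes "sq_integrable M f" "sq_integrable M g"
  shows "sq_integrable M (\<lambda>x. f x + g x)"
proof -
  have "(\<lambda>x. (norm (f x + g x))\<^sup>2) = (\<lambda>x. (norm (f x))\<^sup>2 + (norm (g x))\<^sup>2 + 2 * (f x \<bullet> g x))"
    by (simp add: fun_eq_iff power2_norm_eq_inner algebra_simps inner_commute)
  then show ?thesis
    using assms sq_integrable_inner[OF assms] by (auto simp: sq_integrable_def)
qed

lemma sq_integrable_scaleR: "sq_integrable M f \<Longrightarrow> sq_integrable M (\<lambda>x. c *\<^sub>R f x)"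
  by (auto simp: sq_integrable_def power_mult_distrib)

lemma semi_inner_product_l2:
  "semi_inner_product {f :: 'a \<Rightarrow> 'b::euclidean_space. sq_integrable M f} (l2prod M)"
proof
  show "subspace {f :: 'a \<Rightarrow> 'b. sq_integrable M f}"
    unfolding subspace_def
    by (auto simp: plus_fun_def scaleR_fun_def zero_fun_def intro: sq_integrable_add sq_integrable_scaleR)
      (auto simp: sq_integrable_def)
  fix u v w :: "'a \<Rightarrow> 'b" and c :: real
  show "l2prod M u v = l2prod M v u"
    by (simp add: l2prod_def inner_commute)
  show "0 \<le> l2prod M u u"
    by (simp add: l2prod_self)
  assume u: "u \<in> {f. sq_integrable M f}" and w: "w \<in> {f. sq_integrable M f}"
  then show "l2prod M (c *\<^sub>R u) w = c * l2prod M u w"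
    by (simp add: l2prod_def)
  assume "v \<in> {f. sq_integrable M f}"
  then show "l2prod M (u + v) w = l2prod M u w + l2prod M v w"
    using u w by (simp add: l2prod_def inner_add_left sq_integrable_inner)
qed

interpretation l2: semi_inner_product "{f :: 'a \<Rightarrow> 'b::euclidean_space. sq_integrable M f}" "l2prod M" for M
  by (rule semi_inner_product_l2)

lemma sq_integrable_diff:
  "sq_integrable M f \<Longrightarrow> sq_integrable M g \<Longrightarrow> sq_integrable M (\<lambda>x. f x - g x)"
  using l2.mem_diff[of f M g] by (simp add: fun_diff_def)

lemma sq_integrable_imp_integrable:
  assumes "finite_measure M" "sq_integrable M f"
  shows "integrable M f"
proof -
  interpret finite_measure M by fact
  show ?thesis
  proof (rule Bochner_Integration.integrable_bound)
    show "integrable M (\<lambda>x. 1 + (norm (f x))\<^sup>2)" "f \<in> borel_measurable M"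
      using assms by (auto simp: sq_integrable_def)
    have "norm (f x) \<le> 1 + (norm (f x))\<^sup>2" for x
      using sum_squares_bound[of 1 "norm (f x)"] norm_ge_zero[of "f x"]
      by (simp del: norm_ge_zero)
    then show "AE x in M. norm (f x) \<le> norm (1 + (norm (f x))\<^sup>2)"
      by (auto simp: abs_of_nonneg)
  qed
qed

text \<open>Riesz--Fischer: along a subsequence with \<open>\<parallel>f (r (k+1)) - f (r k)\<parallel>\<^sup>2 < 8\<^sup>-\<^sup>k\<close> the series
  \<open>\<Sum> 4\<^sup>k |f (r (k+1)) - f (r k)|\<^sup>2\<close> is finite almost everywhere, which forces pointwise
  convergence; Fatou's lemma then gives convergence in norm.\<close>

lemma sq_integrable_complete:
  fixes f :: "nat \<Rightarrow> 'a \<Rightarrow> 'b::euclidean_space"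
  assumes f: "\<And>n. sq_integrable M (f n)"
    and cauchy: "\<And>e. e > 0 \<Longrightarrow> \<exists>K. \<forall>m\<ge>K. \<forall>n\<ge>K. l2prod M (f m - f n) (f m - f n) < e"
  shows "\<exists>g. sq_integrable M g \<and> (\<lambda>n. l2prod M (f n - g) (f n - g)) \<longlonglongrightarrow> 0"
proof -
  have [measurable]: "f n \<in> borel_measurable M" for n
    using f by (simp add: sq_integrable_def)
  define d where "d m n = (LINT x|M. (norm (f m x - f n x))\<^sup>2)" for m n
  have d_eq: "d m n = l2prod M (f m - f n) (f m - f n)" for m n
    by (simp add: d_def l2prod_self)
  have int_d: "integrable M (\<lambda>x. (norm (f m x - f n x))\<^sup>2)" for m n
    using sq_integrable_diff[OF f[of m] f[of n]] by (simp add: sq_integrable_def)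
  have "\<exists>K. \<forall>m\<ge>K. \<forall>n\<ge>K. d m n < (1/8) ^ k" for k
    unfolding d_eq by (intro cauchy) simp
  then obtain K where K: "\<And>k m n. m \<ge> K k \<Longrightarrow> n \<ge> K k \<Longrightarrow> d m n < (1/8) ^ k"
    by metis
  \<comment> \<open>A partial sum dominates every earlier threshold at once and is monotone, without
    choosing indices recursively.\<close>
  define r where "r k = (\<Sum>i\<le>k. K i)" for k
  have r_ge: "K j \<le> r k" if "j \<le> k" for j k
    unfolding r_def using that by (intro member_le_sum) auto
  define h where "h k x = norm (f (r (Suc k)) x - f (r k) x)" for k x
  have [measurable]: "h k \<in> borel_measurable M" for k
    unfolding h_def by measurable
  have "(\<integral>\<^sup>+ x. (\<Sum>k. ennreal (4 ^ k * (h k x)\<^sup>2)) \<partial>M) = (\<Sum>k. \<integral>\<^sup>+ x. ennreal (4 ^ k * (h k x)\<^sup>2) \<partial>M)"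
    by (intro nn_integral_suminf) measurable
  also have "\<dots> \<le> (\<Sum>k. ennreal ((1/2) ^ k))"
  proof (intro suminf_le)
    fix k
    have "(\<integral>\<^sup>+ x. ennreal (4 ^ k * (h k x)\<^sup>2) \<partial>M) = ennreal (LINT x|M. 4 ^ k * (h k x)\<^sup>2)"
      by (intro nn_integral_eq_integral) (auto simp: h_def int_d)
    also have "(LINT x|M. 4 ^ k * (h k x)\<^sup>2) = 4 ^ k * d (r (Suc k)) (r k)"
      by (simp add: h_def d_def)
    also have "ennreal (4 ^ k * d (r (Suc k)) (r k)) \<le> ennreal (4 ^ k * (1/8) ^ k)"
      using K[of k "r (Suc k)" "r k"] r_ge[of k "Suc k"] r_ge[of k k]
      by (intro ennreal_leI mult_left_mono) auto
    also have "(4::real) ^ k * (1/8) ^ k = (1/2) ^ k"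
      by (simp add: power_mult_distrib[symmetric])
    finally show "(\<integral>\<^sup>+ x. ennreal (4 ^ k * (h k x)\<^sup>2) \<partial>M) \<le> ennreal ((1/2) ^ k)" .
  qed auto
  also have "\<dots> < \<infinity>"
    by (subst suminf_ennreal2) (auto intro: summable_geometric)
  finally have "AE x in M. (\<Sum>k. ennreal (4 ^ k * (h k x)\<^sup>2)) \<noteq> \<infinity>"
    by (intro nn_integral_PInf_AE) auto
  then have AE_conv: "AE x in M. convergent (\<lambda>k. f (r k) x)"
  proof eventually_elim
    case (elim x)
    then have "summable (\<lambda>k. 4 ^ k * (h k x)\<^sup>2)"
      by (intro summable_suminf_not_top) auto
    then have "(\<lambda>k. 4 ^ k * (h k x)\<^sup>2) \<longlonglongrightarrow> 0"
      by (rule summable_LIMSEQ_zero)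
    then have "\<forall>\<^sub>F k in sequentially. 4 ^ k * (h k x)\<^sup>2 < 1"
      by (rule order_tendstoD) simp
    then have "\<forall>\<^sub>F k in sequentially. norm (h k x) \<le> (1/2) ^ k"
    proof eventually_elim
      case (elim k)
      have "(2 ^ k * h k x)\<^sup>2 = 4 ^ k * (h k x)\<^sup>2"
        by (simp add: power_mult_distrib power_mult[symmetric] mult.commute[of k 2] power_mult)
      then have "(2 ^ k * h k x)\<^sup>2 \<le> 1\<^sup>2" using elim by simp
      then have "2 ^ k * h k x \<le> 1" by (rule power2_le_imp_le) simp
      then show ?case by (simp add: h_def field_simps power_divide)
    qed
    then have "summable (\<lambda>k. h k x)"
      by (rule summable_comparison_test_ev) (auto intro: summable_geometric)
    then have "summable (\<lambda>k. f (r (Suc k)) x - f (r k) x)"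
      unfolding h_def by (rule summable_norm_cancel)
    then obtain s where "(\<lambda>n. \<Sum>k<n. f (r (Suc k)) x - f (r k) x) \<longlonglongrightarrow> s"
      unfolding summable_def sums_def by blast
    then have "(\<lambda>n. f (r n) x - f (r 0) x) \<longlonglongrightarrow> s"
      by (simp only: sum_lessThan_telescope[of "\<lambda>k. f (r k) x"])
    from tendsto_add[OF this tendsto_const[of "f (r 0) x"]] show ?case
      by (auto simp: convergent_def)
  qed
  define g where "g x = lim (\<lambda>k. f (r k) x)" for x
  have [measurable]: "g \<in> borel_measurable M"
    unfolding g_def by (rule borel_measurable_lim_metric) measurable
  have AE_lim: "AE x in M. (\<lambda>k. f (r k) x) \<longlonglongrightarrow> g x"
    using AE_conv by eventually_elim (simp add: g_def convergent_LIMSEQ_iff)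
  have bound: "(\<integral>\<^sup>+ x. ennreal ((norm (f n x - g x))\<^sup>2) \<partial>M) \<le> ennreal ((1/8) ^ j)" if n: "n \<ge> K j" for n j
  proof -
    have "(\<integral>\<^sup>+ x. ennreal ((norm (f n x - g x))\<^sup>2) \<partial>M)
        \<le> (\<integral>\<^sup>+ x. liminf (\<lambda>k. ennreal ((norm (f n x - f (r k) x))\<^sup>2)) \<partial>M)"
    proof (intro nn_integral_mono_AE)
      show "AE x in M. ennreal ((norm (f n x - g x))\<^sup>2) \<le> liminf (\<lambda>k. ennreal ((norm (f n x - f (r k) x))\<^sup>2))"
        using AE_lim
      proof eventually_elim
        case (elim x)
        have "(\<lambda>k. ennreal ((norm (f n x - f (r k) x))\<^sup>2)) \<longlonglongrightarrow> ennreal ((norm (f n x - g x))\<^sup>2)"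
          by (intro tendsto_ennrealI tendsto_intros elim)
        then have "liminf (\<lambda>k. ennreal ((norm (f n x - f (r k) x))\<^sup>2)) = ennreal ((norm (f n x - g x))\<^sup>2)"
          by (intro lim_imp_Liminf) auto
        then show ?case by simp
      qed
    qed
    also have "\<dots> \<le> liminf (\<lambda>k. \<integral>\<^sup>+ x. ennreal ((norm (f n x - f (r k) x))\<^sup>2) \<partial>M)"
      by (intro nn_integral_liminf) measurable
    also have "\<dots> \<le> ennreal ((1/8) ^ j)"
    proof (rule Liminf_le)
      show "\<forall>\<^sub>F k in sequentially. (\<integral>\<^sup>+ x. ennreal ((norm (f n x - f (r k) x))\<^sup>2) \<partial>M) \<le> ennreal ((1/8) ^ j)"
        using eventually_ge_at_top[of j]
      proof eventually_elim
        case (elim k)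
        have "(\<integral>\<^sup>+ x. ennreal ((norm (f n x - f (r k) x))\<^sup>2) \<partial>M) = ennreal (d n (r k))"
          unfolding d_def by (intro nn_integral_eq_integral int_d) auto
        also have "\<dots> \<le> ennreal ((1/8) ^ j)"
          using K[OF n r_ge[OF elim]] by (intro ennreal_leI) simp
        finally show ?case .
      qed
    qed simp
    finally show ?thesis .
  qed
  have int_g: "integrable M (\<lambda>x. (norm (f n x - g x))\<^sup>2)" if "n \<ge> K j" for n j
    using order_le_less_trans[OF bound[OF that]] by (intro integrableI_nonneg) auto
  \<comment> \<open>Fatou bounds only differences, so square integrability of \<open>g\<close> is
    recovered by subtracting from one member of the sequence.\<close>
  have "sq_integrable M (\<lambda>x. f (K 0) x - g x)"
    using int_g[of 0 "K 0"] by (simp add: sq_integrable_def)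
  from sq_integrable_diff[OF f[of "K 0"] this] have g: "sq_integrable M g" by simp
  moreover have "(\<lambda>n. l2prod M (f n - g) (f n - g)) \<longlonglongrightarrow> 0"
  proof (rule LIMSEQ_I)
    fix e :: real assume "e > 0"
    then obtain j where j: "(1/8 :: real) ^ j < e"
      using real_arch_pow_inv[of e "1/8"] by auto
    have "norm (l2prod M (f n - g) (f n - g) - 0) < e" if n: "n \<ge> K j" for n
    proof -
      have "ennreal (l2prod M (f n - g) (f n - g)) = (\<integral>\<^sup>+ x. ennreal ((norm (f n x - g x))\<^sup>2) \<partial>M)"
        by (subst nn_integral_eq_integral[OF int_g[OF n]]) (auto simp: l2prod_self)
      also have "\<dots> \<le> ennreal ((1/8) ^ j)" by (rule bound[OF n])
      finally have "l2prod M (f n - g) (f n - g) \<le> (1/8) ^ j" by simp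
      moreover have "0 \<le> l2prod M (f n - g) (f n - g)" by (simp add: l2prod_self)
      ultimately show ?thesis using j by simp
    qed
    then show "\<exists>no. \<forall>n\<ge>no. norm (l2prod M (f n - g) (f n - g) - 0) < e" by blast
  qed
  ultimately show ?thesis by blast
qed

text \<open>The positive and negative parts of \<open>h\<close> are densities of two measures that
  agree on open boxes. Boxes are stable under intersection and generate the Borel sets, so the
  measures coincide, and then so do the densities.\<close>

lemma AE_zero_of_integral_box_zero:
  fixes h :: "'a::euclidean_space \<Rightarrow> real"
  assumes h: "integrable lborel h"
    and box: "\<And>a b. (LINT x|lborel. indicator (box a b) x * h x) = 0"
  shows "AE x in lborel. h x = 0"
proof -
  have [measurable]: "h \<in> borel_measurable borel" using h by auto
  define p where "p x = max 0 (h x)" for x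
  define m where "m x = max 0 (- h x)" for x
  have pm: "p x - m x = h x" for x by (simp add: p_def m_def)
  have [measurable]: "p \<in> borel_measurable borel" "m \<in> borel_measurable borel"
    unfolding p_def m_def by measurable
  have p: "integrable lborel p" and m: "integrable lborel m"
    using h unfolding p_def m_def by auto
  have em: "emeasure (density lborel (\<lambda>x. ennreal (q x))) X = ennreal (LINT x|lborel. indicator X x * q x)"
    if q: "integrable lborel q" "\<And>x. 0 \<le> q x" and X: "X \<in> sets borel" for q X
  proof -
    have "emeasure (density lborel (\<lambda>x. ennreal (q x))) X = (\<integral>\<^sup>+ x. ennreal (q x) * indicator X x \<partial>lborel)"
      using q X by (intro emeasure_density) auto
    also have "\<dots> = (\<integral>\<^sup>+ x. ennreal (indicator X x * q x) \<partial>lborel)"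
      by (intro nn_integral_cong) (auto split: split_indicator)
    also have "\<dots> = ennreal (LINT x|lborel. indicator X x * q x)"
      using q X integrable_real_mult_indicator[of X lborel q]
      by (intro nn_integral_eq_integral) (auto simp: mult.commute)
    finally show ?thesis .
  qed
  have "density lborel (\<lambda>x. ennreal (p x)) = density lborel (\<lambda>x. ennreal (m x))"
  proof (rule measure_eqI_generator_eq[where \<Omega> = UNIV and E = "range (\<lambda>(a, b). box a b :: 'a set)"
        and A = "\<lambda>n. box (- (real n *\<^sub>R One)) (real n *\<^sub>R One)"])
    show "Int_stable (range (\<lambda>(a, b). box a b :: 'a set))"
      by (auto simp: Int_stable_def box_Int_box)
    show "sets (density lborel (\<lambda>x. ennreal (p x))) = sigma_sets UNIV (range (\<lambda>(a, b). box a b :: 'a set))"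
      "sets (density lborel (\<lambda>x. ennreal (m x))) = sigma_sets UNIV (range (\<lambda>(a, b). box a b :: 'a set))"
      by (simp_all add: borel_eq_box)
    fix X assume "X \<in> range (\<lambda>(a, b). box a b :: 'a set)"
    then obtain a b where X: "X = box a b" by auto
    have "integrable lborel (\<lambda>x. indicator X x * p x)" "integrable lborel (\<lambda>x. indicator X x * m x)"
      using integrable_real_mult_indicator[OF _ p, of X] integrable_real_mult_indicator[OF _ m, of X] X
      by (auto simp: mult.commute)
    from Bochner_Integration.integral_diff[OF this]
    have "(LINT x|lborel. indicator X x * p x) - (LINT x|lborel. indicator X x * m x)
        = (LINT x|lborel. indicator X x * h x)"
      by (simp add: right_diff_distrib[symmetric] pm)
    then show "emeasure (density lborel (\<lambda>x. ennreal (p x))) X = emeasure (density lborel (\<lambda>x. ennreal (m x))) X"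
      using em[OF p, of X] em[OF m, of X] box[of a b] X by (simp add: p_def m_def)
  next
    show "(\<Union>n. box (- (real n *\<^sub>R One)) (real n *\<^sub>R One)) = (UNIV :: 'a set)"
      by (rule UN_box_eq_UNIV)
    show "emeasure (density lborel (\<lambda>x. ennreal (p x))) (box (- (real n *\<^sub>R One)) (real n *\<^sub>R One)) \<noteq> \<infinity>" for n
      by (subst em[OF p]) (auto simp: p_def)
  qed auto
  then have "AE x in lborel. ennreal (p x) = ennreal (m x)"
    by (intro sigma_finite_measure.density_unique[OF lborel.sigma_finite_measure_axioms]) auto
  then show ?thesis
  proof eventually_elim
    case (elim x)
    then have "p x = m x" by (simp add: p_def m_def)
    then show ?case using pm[of x] by simp
  qed
qed

text \<open>Lebesgue measurability is reduced to the Borel case by changing \<open>h\<close> on a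
  null set, which affects no integral.\<close>

lemma AE_lebesgue_zero_of_integral_box_zero:
  fixes h :: "'a::euclidean_space \<Rightarrow> real"
  assumes h: "integrable lebesgue h"
    and box: "\<And>a b. (LINT x|lebesgue. indicator (box a b) x * h x) = 0"
  shows "AE x in lebesgue. h x = 0"
proof -
  have hm: "h \<in> borel_measurable lebesgue" using h by auto
  then obtain h' where h': "h' \<in> borel_measurable lborel" "AE x in lborel. h x = h' x"
    using completion_ex_borel_measurable_real by blast
  have h'm: "h' \<in> borel_measurable lebesgue"
    using h'(1) by (rule measurable_completion)
  have ae: "AE x in lebesgue. h x = h' x" using h'(2) by (rule AE_completion)
  have "integrable lebesgue h'"
    using h integrable_cong_AE[OF hm h'm ae] by simp
  then have int: "integrable lborel h'" using integrable_completion[OF h'(1)] by simp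
  have "(LINT x|lborel. indicator (box a b) x * h' x) = 0" for a b
  proof -
    have [measurable]: "h' \<in> borel_measurable borel" using h'(1) by simp
    have "(LINT x|lborel. indicator (box a b) x * h' x) = (LINT x|lebesgue. indicator (box a b) x * h' x)"
      by (rule integral_completion[symmetric]) measurable
    also have "\<dots> = (LINT x|lebesgue. indicator (box a b) x * h x)"
    proof (rule integral_cong_AE)
      have "box a b \<in> sets lebesgue" by (intro fmeasurableD lmeasurable_box)
      then show "(\<lambda>x. indicator (box a b) x * h' x) \<in> borel_measurable lebesgue"
        "(\<lambda>x. indicator (box a b) x * h x) \<in> borel_measurable lebesgue"
        using hm h'm by (auto intro!: borel_measurable_times borel_measurable_indicator)
      show "AE x in lebesgue. indicator (box a b) x * h' x = indicator (box a b) x * h x"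
        using ae by eventually_elim simp
    qed
    finally show ?thesis using box by simp
  qed
  then have "AE x in lborel. h' x = 0"
    using AE_zero_of_integral_box_zero[OF int] by blast
  then have "AE x in lebesgue. h' x = 0" by (rule AE_completion)
  with ae show ?thesis by eventually_elim simp
qed

subsection \<open>Test functions and integration by parts\<close>

text \<open>The class of multipliers for integration by parts. The gradient is an argument so that
  product and chain rules can state it explicitly.\<close>

definition C1 :: "('a::euclidean_space \<Rightarrow> real) \<Rightarrow> ('a \<Rightarrow> 'a) \<Rightarrow> bool" where
  "C1 f f' \<longleftrightarrow> (\<forall>x. (f has_derivative (\<lambda>h. f' x \<bullet> h)) (at x)) \<and> continuous_on UNIV f'"

lemma C1_cont: "C1 f f' \<Longrightarrow> continuous_on UNIV f"
  unfolding C1_def by (meson continuous_at_imp_continuous_on has_derivative_continuous)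

lemma C1_mult:
  assumes "C1 f f'" "C1 g g'"
  shows "C1 (\<lambda>x. f x * g x) (\<lambda>x. f x *\<^sub>R g' x + g x *\<^sub>R f' x)"
  unfolding C1_def
proof (intro conjI allI)
  show "((\<lambda>x. f x * g x) has_derivative (\<lambda>h. (f x *\<^sub>R g' x + g x *\<^sub>R f' x) \<bullet> h)) (at x)" for x
    using assms unfolding C1_def
    by (auto intro!: derivative_eq_intros simp: inner_add_left algebra_simps)
  show "continuous_on UNIV (\<lambda>x. f x *\<^sub>R g' x + g x *\<^sub>R f' x)"
    using assms C1_cont[OF assms(1)] C1_cont[OF assms(2)] unfolding C1_def by (auto intro!: continuous_intros)
qed

lemma C1_const: "C1 (\<lambda>x. c) (\<lambda>x. 0)"
  by (auto simp: C1_def)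

lemma C1_prod:
  assumes "finite I" "\<And>i. i \<in> I \<Longrightarrow> \<exists>f'. C1 (f i) f'"
  shows "\<exists>f'. C1 (\<lambda>x. \<Prod>i\<in>I. f i x) f'"
  using assms
proof (induction I)
  case empty
  then show ?case using C1_const[of 1] by auto
next
  case (insert i I)
  obtain f' where f': "C1 (f i) f'" using insert.prems by blast
  obtain g' where "C1 (\<lambda>x. \<Prod>i\<in>I. f i x) g'" using insert.IH insert.prems by blast
  from C1_mult[OF f' this] show ?case using insert by auto
qed

lemma C1_compose_inner:
  assumes "\<And>s. (f has_real_derivative f' s) (at s)" "continuous_on UNIV f'"
  shows "C1 (\<lambda>x. f (x \<bullet> v + c)) (\<lambda>x. f' (x \<bullet> v + c) *\<^sub>R v)"
  unfolding C1_def
proof (intro conjI allI)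
  fix x
  have "((\<lambda>x. x \<bullet> v + c) has_derivative (\<lambda>h. h \<bullet> v)) (at x)"
    by (auto intro!: derivative_eq_intros)
  from has_derivative_compose[OF this, of f "\<lambda>h. f' (x \<bullet> v + c) * h"]
  show "((\<lambda>x. f (x \<bullet> v + c)) has_derivative (\<lambda>h. (f' (x \<bullet> v + c) *\<^sub>R v) \<bullet> h)) (at x)"
    using assms(1) by (simp add: has_field_derivative_def inner_commute)
  show "continuous_on UNIV (\<lambda>x. f' (x \<bullet> v + c) *\<^sub>R v)"
    by (intro continuous_intros continuous_on_compose2[OF assms(2)]) auto
qed

text \<open>The integral of a difference quotient vanishes by translation invariance; pass to the limit.\<close>

lemma integral_C1_compact_support:
  assumes F: "C1 F F'"
    and K: "compact K" "\<And>x. x \<notin> K \<Longrightarrow> F x = 0"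
  shows "(LINT x|lborel. F' x \<bullet> e) = 0"
proof -
  have der: "\<And>x. (F has_derivative (\<lambda>h. F' x \<bullet> h)) (at x)" and F'c: "continuous_on UNIV F'"
    using F by (auto simp: C1_def)
  have Fc: "continuous_on UNIV F" using F by (rule C1_cont)
  have [measurable]: "F \<in> borel_measurable borel" "F' \<in> borel_measurable borel"
    using Fc F'c by (auto intro: borel_measurable_continuous_onI)
  \<comment> \<open>A thickening of \<open>K\<close> that contains the supports of all difference
    quotients with step at most 1.\<close>
  define K1 where "K1 = {x + y |x y. x \<in> K \<and> y \<in> cball 0 (norm e)}"
  have K1: "compact K1" unfolding K1_def using K(1) by (intro compact_sums) auto
  have F'0: "F' x = 0" if "x \<notin> K" for x
  proof -
    have "((\<lambda>_. 0) has_derivative (\<lambda>h. F' x \<bullet> h)) (at x)"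
      by (rule has_derivative_transform_within_open[OF der[of x], of "- K"])
        (use K that in \<open>auto intro: compact_imp_closed\<close>)
    then have "(\<lambda>h. F' x \<bullet> h) = (\<lambda>h. 0)"
      by (rule has_derivative_unique) auto
    then have "F' x \<bullet> F' x = 0" by metis
    then show ?thesis by simp
  qed
  have "bounded (F' ` K)"
    using K(1) F'c by (intro compact_imp_bounded compact_continuous_image) (auto intro: continuous_on_subset)
  then obtain B where "B > 0" "\<And>x. x \<in> K \<Longrightarrow> norm (F' x) \<le> B"
    by (auto simp: bounded_pos)
  then have B: "norm (F' x) \<le> B" for x
    using F'0[of x] by (cases "x \<in> K") auto
  \<comment> \<open>The global Lipschitz bound gives the dominating function
    \<open>B * norm e\<close> on \<open>K1\<close>.\<close>
  have lip: "norm (F x - F y) \<le> B * norm (x - y)" for x y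
  proof (rule differentiable_bound[of UNIV F "\<lambda>x h. F' x \<bullet> h"])
    show "onorm (\<lambda>h. F' x \<bullet> h) \<le> B" for x
    proof (rule onorm_le)
      fix h
      have "norm (F' x \<bullet> h) \<le> norm (F' x) * norm h" using Cauchy_Schwarz_ineq2 by auto
      also have "\<dots> \<le> B * norm h" using B by (intro mult_right_mono) auto
      finally show "norm (F' x \<bullet> h) \<le> B * norm h" .
    qed
  qed (use der in auto)
  define c where "c n = 1 / (real n + 1)" for n
  have c: "0 < c n" "c n \<le> 1" for n by (auto simp: c_def)
  have c0: "c \<longlonglongrightarrow> 0"
    unfolding c_def using LIMSEQ_inverse_real_of_nat by (simp add: inverse_eq_divide add.commute)
  define s where "s n x = (F (c n *\<^sub>R e + x) - F x) / c n" for n x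
  have Fint: "integrable lborel F"
  proof -
    have "integrable lborel (\<lambda>x. indicator K x *\<^sub>R F x)"
      using K(1) Fc by (intro borel_integrable_compact) (auto intro: continuous_on_subset)
    also have "(\<lambda>x. indicator K x *\<^sub>R F x) = F"
      using K(2) by (auto simp: fun_eq_iff indicator_def)
    finally show ?thesis .
  qed
  have s_int: "(LINT x|lborel. s n x) = 0" for n
  proof -
    have "integrable (distr lborel borel ((+) (c n *\<^sub>R e))) F"
      unfolding lborel_distr_plus by (rule Fint)
    then have 1: "integrable lborel (\<lambda>x. F (c n *\<^sub>R e + x))"
      by (subst (asm) integrable_distr_eq) auto
    have "(LINT x|lborel. F x) = (LINT x|distr lborel borel ((+) (c n *\<^sub>R e)). F x)"
      unfolding lborel_distr_plus ..
    also have "\<dots> = (LINT x|lborel. F (c n *\<^sub>R e + x))"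
      by (intro integral_distr) auto
    finally show ?thesis using 1 Fint by (simp add: s_def)
  qed
  have "(\<lambda>n. LINT x|lborel. s n x) \<longlonglongrightarrow> (LINT x|lborel. F' x \<bullet> e)"
  proof (rule integral_dominated_convergence[where w = "\<lambda>x. indicator K1 x *\<^sub>R (B * norm e)"])
    show "(\<lambda>x. F' x \<bullet> e) \<in> borel_measurable lborel" "\<And>n. s n \<in> borel_measurable lborel"
      unfolding s_def by measurable
    show "integrable lborel (\<lambda>x. indicator K1 x *\<^sub>R (B * norm e))"
      using K1 by (intro borel_integrable_compact) auto
    show "AE x in lborel. (\<lambda>n. s n x) \<longlonglongrightarrow> F' x \<bullet> e"
    proof (rule AE_I2)
      fix x
      have "((\<lambda>t. t *\<^sub>R e + x) has_derivative (\<lambda>h. h *\<^sub>R e)) (at 0)"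
        by (auto intro!: derivative_eq_intros)
      from has_derivative_compose[OF this, of F "\<lambda>h. F' x \<bullet> h"]
      have "((\<lambda>t. F (t *\<^sub>R e + x)) has_real_derivative F' x \<bullet> e) (at 0)"
        using der[of x] by (simp add: has_field_derivative_def mult_commute_abs)
      then have "((\<lambda>t. (F (t *\<^sub>R e + x) - F x) / t) \<longlongrightarrow> F' x \<bullet> e) (at 0)"
        by (simp add: DERIV_def)
      moreover have "filterlim c (at 0) sequentially"
      proof -
        have "c n \<noteq> 0" for n using c(1)[of n] by simp
        then show ?thesis using c0 by (simp add: filterlim_at)
      qed
      ultimately show "(\<lambda>n. s n x) \<longlonglongrightarrow> F' x \<bullet> e"
        unfolding s_def by (rule filterlim_compose)
    qed
    show "AE x in lborel. norm (s n x) \<le> indicator K1 x *\<^sub>R (B * norm e)" for n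
    proof (rule AE_I2)
      fix x
      show "norm (s n x) \<le> indicator K1 x *\<^sub>R (B * norm e)"
      proof (cases "x \<in> K1")
        case True
        have "norm (s n x) = norm (F (c n *\<^sub>R e + x) - F x) / c n"
          using c(1)[of n] by (simp add: s_def)
        also have "\<dots> \<le> (B * norm (c n *\<^sub>R e)) / c n"
          using lip[of "c n *\<^sub>R e + x" x] c(1)[of n] by (intro divide_right_mono) auto
        also have "\<dots> = B * norm e" using c(1)[of n] by simp
        finally show ?thesis using True by simp
      next
        case False
        have "x \<notin> K" using False unfolding K1_def by (force intro: exI[of _ x] exI[of _ 0])
        moreover have "c n *\<^sub>R e + x \<notin> K"
        proof
          assume "c n *\<^sub>R e + x \<in> K"
          moreover have "- (c n *\<^sub>R e) \<in> cball 0 (norm e)"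
            using c[of n] by (simp add: mult_left_le_one_le)
          ultimately have "(c n *\<^sub>R e + x) + - (c n *\<^sub>R e) \<in> K1" unfolding K1_def by blast
          then show False using False by simp
        qed
        ultimately show ?thesis using K(2) False by (simp add: s_def)
      qed
    qed
  qed
  then have "(\<lambda>n. 0) \<longlonglongrightarrow> (LINT x|lborel. F' x \<bullet> e)" by (simp add: s_int)
  then show ?thesis by (simp add: LIMSEQ_const_iff)
qed

lemma grad_eqI:
  assumes "(f has_derivative (\<lambda>h. g \<bullet> h)) (at x)"
  shows "grad f x = g"
proof -
  have "(f has_derivative (\<lambda>h. grad f x \<bullet> h)) (at x)"
    unfolding grad_def by (rule someI[of "\<lambda>g. (f has_derivative (\<lambda>h. g \<bullet> h)) (at x)"]) (rule assms)
  from has_derivative_unique[OF this assms] have "grad f x \<bullet> h = g \<bullet> h" for h by (rule fun_cong)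
  then have "(grad f x - g) \<bullet> (grad f x - g) = 0" by (simp only: inner_diff_left)
  then show ?thesis by simp
qed

lemma test_fun_C1:
  assumes "test_fun \<Omega> f"
  shows "C1 f (grad f)"
proof -
  have "Ck (Suc 0) f" using assms unfolding test_fun_def smooth_def by blast
  then obtain f' where f': "\<And>x. (f has_derivative (\<lambda>h. f' x \<bullet> h)) (at x)"
    "\<And>i. i \<in> Basis \<Longrightarrow> continuous_on UNIV (\<lambda>x. f' x \<bullet> i)" by auto
  have "grad f = f'" using grad_eqI[OF f'(1)] by auto
  moreover have "continuous_on UNIV f'" using f'(2) by (subst continuous_on_componentwise) auto
  ultimately show ?thesis using f'(1) by (simp add: C1_def)
qed

lemma test_fun_outside: "x \<notin> tsupport f \<Longrightarrow> f x = 0"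
  using closure_subset[of "{x. f x \<noteq> 0}"] unfolding tsupport_def by blast

section \<open>The vector space of test functions and linearity of their gradients\<close>

lemma Ck_add: "Ck k f \<Longrightarrow> Ck k g \<Longrightarrow> Ck k (\<lambda>x. f x + g x)"
proof (induction k arbitrary: f g)
  case 0
  then show ?case by (auto intro: continuous_intros)
next
  case (Suc k)
  from Suc.prems(1) obtain f' where f': "\<And>x. (f has_derivative (\<lambda>h. f' x \<bullet> h)) (at x)" "continuous_on UNIV f"
      "\<And>i. i \<in> Basis \<Longrightarrow> Ck k (\<lambda>x. f' x \<bullet> i)" by auto
  from Suc.prems(2) obtain g' where g': "\<And>x. (g has_derivative (\<lambda>h. g' x \<bullet> h)) (at x)" "continuous_on UNIV g"
      "\<And>i. i \<in> Basis \<Longrightarrow> Ck k (\<lambda>x. g' x \<bullet> i)" by auto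
  have deriv: "((\<lambda>x. f x + g x) has_derivative (\<lambda>h. (f' x + g' x) \<bullet> h)) (at x)" for x
    using has_derivative_add[OF f'(1) g'(1)] by (simp add: inner_add_left)
  have Ck: "Ck k (\<lambda>x. (f' x + g' x) \<bullet> i)" if "i \<in> Basis" for i
    using Suc.IH[OF f'(3) g'(3), OF that that] by (simp add: inner_add_left)
  show ?case
    unfolding Ck.simps
    by (rule exI[of _ "\<lambda>x. f' x + g' x"], intro conjI allI ballI deriv Ck continuous_intros f'(2) g'(2))
qed

lemma Ck_scale: "Ck k f \<Longrightarrow> Ck k (\<lambda>x. c * f x)"
proof (induction k arbitrary: f)
  case 0
  then show ?case by (auto intro: continuous_intros)
next
  case (Suc k)
  then obtain f' where f': "\<And>x. (f has_derivative (\<lambda>h. f' x \<bullet> h)) (at x)" "continuous_on UNIV f"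
      "\<And>i. i \<in> Basis \<Longrightarrow> Ck k (\<lambda>x. f' x \<bullet> i)" by auto
  have deriv: "((\<lambda>x. c * f x) has_derivative (\<lambda>h. (c *\<^sub>R f' x) \<bullet> h)) (at x)" for x
    using has_derivative_mult_right[OF f'(1)] by (simp add: inner_scaleR_left[abs_def])
  have Ck: "Ck k (\<lambda>x. (c *\<^sub>R f' x) \<bullet> i)" if "i \<in> Basis" for i
    using Suc.IH[OF f'(3), OF that] by simp
  show ?case
    unfolding Ck.simps
    by (rule exI[of _ "\<lambda>x. c *\<^sub>R f' x"], intro conjI allI ballI deriv Ck continuous_intros f'(2))
qed

lemma Ck_zero: "Ck k (\<lambda>x. 0)"
proof (induction k)
  case (Suc k)
  have deriv: "((\<lambda>x. 0) has_derivative (\<lambda>h. 0 \<bullet> h)) (at x)" for x :: 'a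
    unfolding inner_zero_left by (rule has_derivative_const)
  show ?case
    unfolding Ck.simps by (rule exI[of _ "\<lambda>x. 0"], intro conjI allI ballI deriv) (use Suc in simp_all)
qed simp

lemma compact_tsupport_subset:
  assumes "compact K" "tsupport f \<subseteq> K"
  shows "compact (tsupport f)"
proof -
  have "closed (tsupport f)" by (simp add: tsupport_def)
  from compact_Int_closed[OF assms(1) this] show ?thesis using assms(2) by (simp add: inf.absorb2)
qed

lemma test_fun_zero: "test_fun \<Omega> 0"
  by (simp add: test_fun_def smooth_def tsupport_def Ck_zero zero_fun_def)

lemma test_fun_add:
  assumes "test_fun \<Omega> f" "test_fun \<Omega> g"
  shows "test_fun \<Omega> (f + g)"
proof -
  have "tsupport (f + g) \<subseteq> tsupport f \<union> tsupport g"
    unfolding tsupport_def closure_Un[symmetric] by (rule closure_mono) auto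
  moreover from this have "compact (tsupport (f + g))"
    using assms by (intro compact_tsupport_subset) (auto simp: test_fun_def)
  moreover have "Ck k (f + g)" for k
    using assms by (simp add: test_fun_def smooth_def plus_fun_def Ck_add)
  ultimately show ?thesis
    using assms unfolding test_fun_def smooth_def by blast
qed

lemma test_fun_scale:
  assumes "test_fun \<Omega> f"
  shows "test_fun \<Omega> (c *\<^sub>R f)"
proof -
  have "tsupport (c *\<^sub>R f) \<subseteq> tsupport f"
    unfolding tsupport_def by (rule closure_mono) auto
  moreover from this have "compact (tsupport (c *\<^sub>R f))"
    using assms by (intro compact_tsupport_subset) (auto simp: test_fun_def)
  moreover have "Ck k (c *\<^sub>R f)" for k
    using Ck_scale[of k f c] assms by (simp add: test_fun_def smooth_def scaleR_fun_def)
  ultimately show ?thesis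
    using assms unfolding test_fun_def smooth_def by blast
qed

lemma grad_add:
  assumes "test_fun \<Omega> f" "test_fun \<Omega> g"
  shows "grad (f + g) = grad f + grad g"
proof
  fix x
  show "grad (f + g) x = (grad f + grad g) x"
    using test_fun_C1[OF assms(1)] test_fun_C1[OF assms(2)] unfolding C1_def plus_fun_def
    by (intro grad_eqI) (auto intro!: derivative_eq_intros simp: inner_add_left)
qed

lemma grad_scale:
  assumes "test_fun \<Omega> f"
  shows "grad (c *\<^sub>R f) = c *\<^sub>R grad f"
proof
  fix x
  show "grad (c *\<^sub>R f) x = (c *\<^sub>R grad f) x"
    using test_fun_C1[OF assms(1)] unfolding C1_def scaleR_fun_def
    by (intro grad_eqI) (auto intro!: derivative_eq_intros)
qed

subsection \<open>Approximation in the Sobolev norm\<close>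

text \<open>Pairing a function with its gradient makes the Sobolev norm an ordinary L^2 norm of a
  vector-valued function, so completeness and limits come from the L^2 theory.\<close>

definition jet :: "('a \<Rightarrow> real) \<Rightarrow> ('a \<Rightarrow> 'b) \<Rightarrow> 'a \<Rightarrow> real \<times> 'b" where
  "jet u g = (\<lambda>x. (u x, g x))"

lemma jet_add: "jet u g + jet v k = jet (u + v) (g + k)"
  and jet_diff: "jet u g - jet v k = jet (u - v) (g - k)"
  and jet_scale: "c *\<^sub>R jet u g = jet (c *\<^sub>R u) (c *\<^sub>R g)"
  by (auto simp: jet_def fun_eq_iff)

lemma norm_jet: "(norm (jet u g x))\<^sup>2 = (u x)\<^sup>2 + (norm (g x))\<^sup>2"
  by (simp add: jet_def norm_Pair)

lemma sq_integrable_jet: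
  "sq_integrable M (jet u g) \<longleftrightarrow> sq_integrable M u \<and> sq_integrable M g"
proof
  assume *: "sq_integrable M (jet u g)"
  then have m: "u \<in> borel_measurable M" "g \<in> borel_measurable M"
    using borel_measurable_continuous_on[of fst "jet u g" M] borel_measurable_continuous_on[of snd "jet u g" M]
    by (auto simp: sq_integrable_def jet_def continuous_on_fst continuous_on_snd)
  have i: "integrable M (\<lambda>x. (u x)\<^sup>2 + (norm (g x))\<^sup>2)"
    using * by (simp add: sq_integrable_def norm_jet)
  have "integrable M (\<lambda>x. (u x)\<^sup>2)" "integrable M (\<lambda>x. (norm (g x))\<^sup>2)"
    by (rule Bochner_Integration.integrable_bound[OF i]; use m in auto)+
  then show "sq_integrable M u \<and> sq_integrable M g"
    using m by (auto simp: sq_integrable_def)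
next
  assume "sq_integrable M u \<and> sq_integrable M g"
  then show "sq_integrable M (jet u g)"
    by (auto simp: sq_integrable_def norm_jet) (auto simp: jet_def)
qed

lemma l2prod_jet:
  assumes "sq_integrable M u" "sq_integrable M g" "sq_integrable M v" "sq_integrable M k"
  shows "l2prod M (jet u g) (jet v k) = l2prod M u v + l2prod M g k"
  unfolding l2prod_def jet_def inner_Pair
  using sq_integrable_inner[OF assms(1,3)] sq_integrable_inner[OF assms(2,4)] by simp

section \<open>Sobolev approximation on a bounded open set\<close>

locale bounded_domain =
  fixes \<Omega> :: "'a::euclidean_space set"
  assumes open_dom: "open \<Omega>" and bounded_dom: "bounded \<Omega>"
begin

abbreviation "M \<equiv> lebesgue_on \<Omega>"

lemma dom_lmeasurable: "\<Omega> \<in> lmeasurable"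
  using bounded_dom open_dom by (rule lmeasurable_open)

lemma dom_sets [simp]: "\<Omega> \<in> sets lebesgue"
  using dom_lmeasurable by (rule fmeasurableD)

lemma finite_M: "finite_measure M"
  using dom_lmeasurable by (rule finite_measure_lebesgue_on)

lemma integral_M: "(LINT x:\<Omega>|lebesgue. f x) = (LINT x|M. f x)"
  for f :: "'a \<Rightarrow> 'b::{banach, second_countable_topology}"
  by (simp add: set_lebesgue_integral_def integral_restrict_space)

lemma integrable_M: "set_integrable lebesgue \<Omega> f \<longleftrightarrow> integrable M f"
  for f :: "'a \<Rightarrow> 'b::{banach, second_countable_topology}"
  by (simp add: set_integrable_def integrable_restrict_space)

lemma measurable_M: "set_borel_measurable lebesgue \<Omega> f \<longleftrightarrow> f \<in> borel_measurable M"
  for f :: "'a \<Rightarrow> 'b::real_normed_vector"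
  by (simp add: set_borel_measurable_def borel_measurable_restrict_space_iff)

lemma continuous_measurable_M: "continuous_on UNIV f \<Longrightarrow> f \<in> borel_measurable M"
  for f :: "'a \<Rightarrow> 'b::euclidean_space"
  by (intro measurable_restrict_space1 measurable_completion)
    (simp add: borel_measurable_continuous_onI)

lemma sq_integrable_continuous:
  fixes f :: "'a \<Rightarrow> 'b::euclidean_space"
  assumes "continuous_on UNIV f"
  shows "sq_integrable M f"
proof -
  interpret finite_measure M by (rule finite_M)
  have "bounded (f ` closure \<Omega>)"
    using assms bounded_dom
    by (intro compact_imp_bounded compact_continuous_image) (auto intro: continuous_on_subset simp: compact_closure)
  then obtain B where B: "\<And>x. x \<in> \<Omega> \<Longrightarrow> norm (f x) \<le> B"
    using closure_subset[of \<Omega>] by (auto simp: bounded_iff)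
  have "integrable M (\<lambda>x. (norm (f x))\<^sup>2)"
  proof (rule integrable_const_bound[of _ "B\<^sup>2"])
    show "AE x in M. norm ((norm (f x))\<^sup>2) \<le> B\<^sup>2"
      using B by (intro AE_I2) (auto intro: power_mono)
  qed (use continuous_measurable_M[OF assms] in auto)
  then show ?thesis
    using continuous_measurable_M[OF assms] by (simp add: sq_integrable_def)
qed

lemma integrable_continuous: "continuous_on UNIV f \<Longrightarrow> integrable M f"
  for f :: "'a \<Rightarrow> 'b::euclidean_space"
  by (intro sq_integrable_imp_integrable finite_M sq_integrable_continuous)

lemma integral_M_lborel:
  fixes f :: "'a \<Rightarrow> real"
  assumes "continuous_on UNIV f" "\<And>x. x \<notin> \<Omega> \<Longrightarrow> f x = 0"
  shows "(LINT x|M. f x) = (LINT x|lborel. f x)"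
proof -
  have "(LINT x|M. f x) = (LINT x|lebesgue. indicator \<Omega> x *\<^sub>R f x)"
    by (simp add: integral_restrict_space)
  also have "(\<lambda>x. indicator \<Omega> x *\<^sub>R f x) = f"
    using assms(2) by (auto simp: fun_eq_iff indicator_def)
  also have "(LINT x|lebesgue. f x) = (LINT x|lborel. f x)"
    using assms(1) by (intro integral_completion) (simp add: borel_measurable_continuous_onI)
  finally show ?thesis .
qed

text \<open>The derivative of \<open>\<phi> \<psi>\<close> along \<open>e\<close> integrates to
  zero, the compact support being supplied by \<open>\<phi>\<close> alone. Stated as an
  orthogonality of jets, the identity survives Sobolev limits of \<open>\<phi>\<close>.\<close>

lemma test_fun_integration_by_parts:
  assumes \<phi>: "test_fun \<Omega> \<phi>" and \<psi>: "C1 \<psi> \<psi>'"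
  shows "l2prod M (jet \<phi> (grad \<phi>)) (jet (\<lambda>x. \<psi>' x \<bullet> e) (\<lambda>x. \<psi> x *\<^sub>R e)) = 0"
proof -
  note \<phi>1 = test_fun_C1[OF \<phi>]
  define F' where "F' x = \<phi> x *\<^sub>R \<psi>' x + \<psi> x *\<^sub>R grad \<phi> x" for x
  have F: "C1 (\<lambda>x. \<phi> x * \<psi> x) F'" unfolding F'_def using C1_mult[OF \<phi>1 \<psi>] .
  have supp: "compact (tsupport \<phi>)" "tsupport \<phi> \<subseteq> \<Omega>"
    using \<phi> by (auto simp: test_fun_def)
  have "grad \<phi> x = 0" if "x \<notin> tsupport \<phi>" for x
  proof (rule grad_eqI)
    have "(\<phi> has_derivative (\<lambda>_. 0)) (at x)"
    proof (rule has_derivative_transform_within_open)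
      show "((\<lambda>_. 0) has_derivative (\<lambda>_. 0)) (at x)" by (rule has_derivative_const)
      show "open (- tsupport \<phi>)" by (simp add: tsupport_def open_Compl)
    qed (use that test_fun_outside[of _ \<phi>] in auto)
    then show "(\<phi> has_derivative (\<lambda>h. 0 \<bullet> h)) (at x)" unfolding inner_zero_left .
  qed
  then have out: "F' x \<bullet> e = 0" if "x \<notin> \<Omega>" for x
  proof -
    have "x \<notin> tsupport \<phi>" using that supp(2) by blast
    then show ?thesis using \<open>\<And>x. x \<notin> tsupport \<phi> \<Longrightarrow> grad \<phi> x = 0\<close> test_fun_outside[of x \<phi>] by (simp add: F'_def)
  qed
  have "l2prod M (jet \<phi> (grad \<phi>)) (jet (\<lambda>x. \<psi>' x \<bullet> e) (\<lambda>x. \<psi> x *\<^sub>R e)) = (LINT x|M. F' x \<bullet> e)"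
    unfolding l2prod_def jet_def by (intro Bochner_Integration.integral_cong) (auto simp: F'_def inner_add_left)
  also have "\<dots> = (LINT x|lborel. F' x \<bullet> e)"
    using F out by (intro integral_M_lborel) (auto simp: C1_def intro!: continuous_intros)
  also have "\<dots> = 0"
    using integral_C1_compact_support[OF F supp(1)] test_fun_outside[of _ \<phi>] by simp
  finally show ?thesis .
qed

lemma sq_integrable_test_fun:
  assumes "test_fun \<Omega> \<phi>"
  shows "sq_integrable M \<phi>" "sq_integrable M (grad \<phi>)"
  using test_fun_C1[OF assms] C1_cont[OF test_fun_C1[OF assms]]
  by (auto intro!: sq_integrable_continuous simp: C1_def)

text \<open>Integrating \<open>\<phi>\<^sup>2 = \<phi>\<^sup>2 \<partial>\<^sub>e (x \<bullet> e)\<close> by parts gives \<open>\<parallel>\<phi>\<parallel>\<^sup>2 = -2 \<integral> \<phi> (x \<bullet> e) \<partial>\<^sub>e\<phi>\<close>.\<close>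

lemma Poincare_test_fun:
  assumes R: "\<And>x. x \<in> \<Omega> \<Longrightarrow> norm x \<le> R" and \<phi>: "test_fun \<Omega> \<phi>"
  shows "l2prod M \<phi> \<phi> \<le> 4 * R\<^sup>2 * l2prod M (grad \<phi>) (grad \<phi>)"
proof -
  obtain e :: 'a where e: "e \<in> Basis" using nonempty_Basis by blast
  note \<phi>1 = test_fun_C1[OF \<phi>]
  have c: "continuous_on UNIV \<phi>" "continuous_on UNIV (grad \<phi>)"
    using C1_cont[OF \<phi>1] \<phi>1 by (auto simp: C1_def)
  have "C1 (\<lambda>x. x \<bullet> e) (\<lambda>x. e)"
    using C1_compose_inner[of "\<lambda>s. s" "\<lambda>s. 1" e 0] by simp
  note \<psi> = C1_mult[OF \<phi>1 this]
  define q where "q x = \<phi> x * (x \<bullet> e) * (grad \<phi> x \<bullet> e)" for x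
  have "0 = (LINT x|M. (\<phi> x)\<^sup>2 + 2 * q x)"
    unfolding test_fun_integration_by_parts[OF \<phi> \<psi>, of e, symmetric] l2prod_def jet_def
    using e by (intro Bochner_Integration.integral_cong)
      (auto simp: q_def inner_add_left inner_Basis power2_eq_square algebra_simps)
  also have "\<dots> = l2prod M \<phi> \<phi> + (LINT x|M. 2 * q x)"
    unfolding l2prod_def q_def using c
    by (subst Bochner_Integration.integral_add)
      (auto intro!: integrable_continuous continuous_intros simp: power2_eq_square)
  finally have "l2prod M \<phi> \<phi> = (LINT x|M. - (2 * q x))" by simp
  also have "\<dots> \<le> (LINT x|M. (\<phi> x)\<^sup>2 / 2 + 2 * R\<^sup>2 * (norm (grad \<phi> x))\<^sup>2)"
  proof (rule integral_mono)
    show "integrable M (\<lambda>x. - (2 * q x))" "integrable M (\<lambda>x. (\<phi> x)\<^sup>2 / 2 + 2 * R\<^sup>2 * (norm (grad \<phi> x))\<^sup>2)"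
      unfolding q_def using c by (auto intro!: integrable_continuous continuous_intros)
    fix x assume "x \<in> space M"
    then have x: "x \<in> \<Omega>" by simp
    define r where "r = (x \<bullet> e) * (grad \<phi> x \<bullet> e)"
    have "\<bar>r\<bar> \<le> R * norm (grad \<phi> x)"
      unfolding r_def abs_mult
    proof (rule mult_mono)
      show "\<bar>x \<bullet> e\<bar> \<le> R" using R[OF x] Basis_le_norm[OF e, of x] by linarith
      then show "0 \<le> R" by linarith
    qed (use Basis_le_norm[OF e] in auto)
    then have "r\<^sup>2 \<le> (R * norm (grad \<phi> x))\<^sup>2"
      by (metis abs_ge_zero power2_abs power_mono)
    \<comment> \<open>Young's inequality, weighted so that half of the square norm is absorbed on
      the left; doubling then yields the constant \<open>4 * R\<^sup>2\<close>.\<close>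
    moreover have "- (2 * (\<phi> x * r)) \<le> (\<phi> x)\<^sup>2 / 2 + 2 * r\<^sup>2"
      using zero_le_power2[of "\<phi> x + 2 * r"] by (simp add: power2_eq_square algebra_simps)
    ultimately show "- (2 * q x) \<le> (\<phi> x)\<^sup>2 / 2 + 2 * R\<^sup>2 * (norm (grad \<phi> x))\<^sup>2"
      by (simp add: q_def r_def power_mult_distrib mult.assoc)
  qed
  also have "\<dots> = l2prod M \<phi> \<phi> / 2 + 2 * R\<^sup>2 * l2prod M (grad \<phi>) (grad \<phi>)"
    unfolding l2prod_self using c
    by (subst Bochner_Integration.integral_add) (auto intro!: integrable_continuous continuous_intros)
  finally show ?thesis by simp
qed

text \<open>Trading sequences for an epsilon condition in one joint norm spares diagonal sequences
  when sums, multiples and limits are approximated.\<close>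

lemma H01_approx_iff:
  "H01_approx \<Omega> u g \<longleftrightarrow> sq_integrable M (jet u g) \<and>
    (\<forall>e>0. \<exists>\<phi>. test_fun \<Omega> \<phi> \<and> l2prod M (jet \<phi> (grad \<phi>) - jet u g) (jet \<phi> (grad \<phi>) - jet u g) < e)"
proof -
  have sq: "L2 \<Omega> u \<and> L2vec \<Omega> g \<longleftrightarrow> sq_integrable M (jet u g)"
    unfolding sq_integrable_jet
    by (simp add: L2_def L2vec_def sq_integrable_def measurable_M integrable_M)
  have dist: "l2prod M (jet \<phi> (grad \<phi>) - jet u g) (jet \<phi> (grad \<phi>) - jet u g)
      = (LINT x:\<Omega>|lebesgue. (\<phi> x - u x)\<^sup>2) + (LINT x:\<Omega>|lebesgue. (norm (grad \<phi> x - g x))\<^sup>2)"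
    if "test_fun \<Omega> \<phi>" "sq_integrable M (jet u g)" for \<phi>
  proof -
    have "sq_integrable M (\<phi> - u)" "sq_integrable M (grad \<phi> - g)"
      using sq_integrable_test_fun[OF that(1)] that(2)
      by (auto simp: sq_integrable_jet fun_diff_def intro: sq_integrable_diff)
    then show ?thesis
      by (simp add: jet_diff l2prod_jet) (simp add: integral_M l2prod_self)
  qed
  have nonneg: "0 \<le> (LINT x:\<Omega>|lebesgue. (\<phi> x - u x)\<^sup>2)" "0 \<le> (LINT x:\<Omega>|lebesgue. (norm (grad \<phi> x - g x))\<^sup>2)" for \<phi>
    by (auto simp: integral_M)
  show ?thesis
  proof
    assume L: "H01_approx \<Omega> u g"
    then have s: "sq_integrable M (jet u g)" using sq by (auto simp: H01_approx_def)
    from L obtain \<phi> where \<phi>: "\<And>n. test_fun \<Omega> (\<phi> n)"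
      "(\<lambda>n. LINT x:\<Omega>|lebesgue. (\<phi> n x - u x)\<^sup>2) \<longlonglongrightarrow> 0"
      "(\<lambda>n. LINT x:\<Omega>|lebesgue. (norm (grad (\<phi> n) x - g x))\<^sup>2) \<longlonglongrightarrow> 0"
      unfolding H01_approx_def by blast
    have lim: "(\<lambda>n. l2prod M (jet (\<phi> n) (grad (\<phi> n)) - jet u g) (jet (\<phi> n) (grad (\<phi> n)) - jet u g)) \<longlonglongrightarrow> 0"
      using tendsto_add[OF \<phi>(2,3)] by (simp add: dist[OF \<phi>(1) s])
    have "\<exists>\<phi>. test_fun \<Omega> \<phi> \<and> l2prod M (jet \<phi> (grad \<phi>) - jet u g) (jet \<phi> (grad \<phi>) - jet u g) < e"
      if "e > 0" for e
    proof -
      from order_tendstoD(2)[OF lim that] obtain n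
        where "l2prod M (jet (\<phi> n) (grad (\<phi> n)) - jet u g) (jet (\<phi> n) (grad (\<phi> n)) - jet u g) < e"
        by (auto simp: eventually_sequentially)
      then show ?thesis using \<phi>(1) by blast
    qed
    with s show "sq_integrable M (jet u g) \<and>
      (\<forall>e>0. \<exists>\<phi>. test_fun \<Omega> \<phi> \<and> l2prod M (jet \<phi> (grad \<phi>) - jet u g) (jet \<phi> (grad \<phi>) - jet u g) < e)" by blast
  next
    assume R: "sq_integrable M (jet u g) \<and>
      (\<forall>e>0. \<exists>\<phi>. test_fun \<Omega> \<phi> \<and> l2prod M (jet \<phi> (grad \<phi>) - jet u g) (jet \<phi> (grad \<phi>) - jet u g) < e)"
    then have "\<exists>\<phi>. test_fun \<Omega> \<phi> \<and> l2prod M (jet \<phi> (grad \<phi>) - jet u g) (jet \<phi> (grad \<phi>) - jet u g) < inverse (real (Suc n))" for n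
      by simp
    then obtain \<phi> where \<phi>: "\<And>n. test_fun \<Omega> (\<phi> n)"
      "\<And>n. l2prod M (jet (\<phi> n) (grad (\<phi> n)) - jet u g) (jet (\<phi> n) (grad (\<phi> n)) - jet u g) < inverse (real (Suc n))"
      by metis
    have bound: "(LINT x:\<Omega>|lebesgue. (\<phi> n x - u x)\<^sup>2) + (LINT x:\<Omega>|lebesgue. (norm (grad (\<phi> n) x - g x))\<^sup>2) < inverse (real (Suc n))" for n
      using \<phi>(2)[of n] dist[OF \<phi>(1)] R by simp
    have "(\<lambda>n. LINT x:\<Omega>|lebesgue. (\<phi> n x - u x)\<^sup>2) \<longlonglongrightarrow> 0"
    proof (rule Lim_null_comparison[OF always_eventually[OF allI] LIMSEQ_inverse_real_of_nat])
      show "norm (LINT x:\<Omega>|lebesgue. (\<phi> n x - u x)\<^sup>2) \<le> inverse (real (Suc n))" for n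
        using bound[of n] nonneg[of "\<phi> n"] by simp
    qed
    moreover have "(\<lambda>n. LINT x:\<Omega>|lebesgue. (norm (grad (\<phi> n) x - g x))\<^sup>2) \<longlonglongrightarrow> 0"
    proof (rule Lim_null_comparison[OF always_eventually[OF allI] LIMSEQ_inverse_real_of_nat])
      show "norm (LINT x:\<Omega>|lebesgue. (norm (grad (\<phi> n) x - g x))\<^sup>2) \<le> inverse (real (Suc n))" for n
        using bound[of n] nonneg[of "\<phi> n"] by simp
    qed
    ultimately show "H01_approx \<Omega> u g"
      using \<phi>(1) R sq unfolding H01_approx_def by blast
  qed
qed

lemma H01_approx_sq_integrable:
  "H01_approx \<Omega> u g \<Longrightarrow> sq_integrable M (jet u g)"
  "H01_approx \<Omega> u g \<Longrightarrow> sq_integrable M u"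
  "H01_approx \<Omega> u g \<Longrightarrow> sq_integrable M g"
  by (auto simp: H01_approx_iff sq_integrable_jet)

lemma sq_integrable_jet_test_fun: "test_fun \<Omega> \<phi> \<Longrightarrow> sq_integrable M (jet \<phi> (grad \<phi>))"
  using sq_integrable_test_fun by (auto simp: sq_integrable_jet)

lemma H01_approx_add:
  assumes u: "H01_approx \<Omega> u g" and v: "H01_approx \<Omega> v k"
  shows "H01_approx \<Omega> (u + v) (g + k)"
  unfolding H01_approx_iff
proof (intro conjI allI impI)
  note s = H01_approx_sq_integrable(1)[OF u] H01_approx_sq_integrable(1)[OF v]
  show "sq_integrable M (jet (u + v) (g + k))"
    using l2.mem_add[of "jet u g" M "jet v k"] s by (simp add: jet_add)
  fix e :: real assume "e > 0"
  then have "e / 4 > 0" by simp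
  then obtain \<phi> \<psi> where \<phi>: "test_fun \<Omega> \<phi>" "l2prod M (jet \<phi> (grad \<phi>) - jet u g) (jet \<phi> (grad \<phi>) - jet u g) < e / 4"
    and \<psi>: "test_fun \<Omega> \<psi>" "l2prod M (jet \<psi> (grad \<psi>) - jet v k) (jet \<psi> (grad \<psi>) - jet v k) < e / 4"
    using u v unfolding H01_approx_iff by meson
  have eq: "jet (\<phi> + \<psi>) (grad (\<phi> + \<psi>)) - jet (u + v) (g + k)
      = (jet \<phi> (grad \<phi>) - jet u g) + (jet \<psi> (grad \<psi>) - jet v k)"
    unfolding grad_add[OF \<phi>(1) \<psi>(1)] jet_add[symmetric] by simp
  have "l2prod M (jet (\<phi> + \<psi>) (grad (\<phi> + \<psi>)) - jet (u + v) (g + k)) (jet (\<phi> + \<psi>) (grad (\<phi> + \<psi>)) - jet (u + v) (g + k)) < e"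
    unfolding eq
    using l2.form_add_sq_le[of "jet \<phi> (grad \<phi>) - jet u g" M "jet \<psi> (grad \<psi>) - jet v k"] \<phi>(2) \<psi>(2)
      l2.mem_diff[of "jet \<phi> (grad \<phi>)" M "jet u g"] l2.mem_diff[of "jet \<psi> (grad \<psi>)" M "jet v k"]
      sq_integrable_jet_test_fun[OF \<phi>(1)] sq_integrable_jet_test_fun[OF \<psi>(1)] s by simp
  then show "\<exists>\<phi>. test_fun \<Omega> \<phi> \<and> l2prod M (jet \<phi> (grad \<phi>) - jet (u + v) (g + k)) (jet \<phi> (grad \<phi>) - jet (u + v) (g + k)) < e"
    using test_fun_add[OF \<phi>(1) \<psi>(1)] by blast
qed

lemma H01_approx_scale:
  assumes u: "H01_approx \<Omega> u g"
  shows "H01_approx \<Omega> (c *\<^sub>R u) (c *\<^sub>R g)"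
  unfolding H01_approx_iff
proof (intro conjI allI impI)
  note s = H01_approx_sq_integrable(1)[OF u]
  show "sq_integrable M (jet (c *\<^sub>R u) (c *\<^sub>R g))"
    using l2.mem_scale[of "jet u g" M c] s by (simp add: jet_scale)
  fix e :: real assume e: "e > 0"
  \<comment> \<open>The added 1 covers \<open>c = 0\<close>.\<close>
  define d where "d = e / (c\<^sup>2 + 1)"
  have c: "c\<^sup>2 + 1 > 0" by (simp add: add_nonneg_pos)
  have "d > 0" using e c by (simp add: d_def)
  then obtain \<phi> where \<phi>: "test_fun \<Omega> \<phi>" "l2prod M (jet \<phi> (grad \<phi>) - jet u g) (jet \<phi> (grad \<phi>) - jet u g) < d"
    using u unfolding H01_approx_iff by meson
  define w where "w = jet \<phi> (grad \<phi>) - jet u g"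
  have w: "w \<in> {f. sq_integrable M f}" unfolding w_def
    using sq_integrable_jet_test_fun[OF \<phi>(1)] s by (intro l2.mem_diff) auto
  have eq: "jet (c *\<^sub>R \<phi>) (grad (c *\<^sub>R \<phi>)) - jet (c *\<^sub>R u) (c *\<^sub>R g) = c *\<^sub>R w"
    unfolding grad_scale[OF \<phi>(1)] jet_scale[symmetric] w_def by (simp add: scaleR_diff_right)
  have "l2prod M (c *\<^sub>R w) (c *\<^sub>R w) = c\<^sup>2 * l2prod M w w"
    by (simp add: l2.form_scale_left[OF w l2.mem_scale[OF w]] l2.form_scale_right[OF w w] power2_eq_square)
  also have "\<dots> \<le> c\<^sup>2 * d" using \<phi>(2) by (intro mult_left_mono) (auto simp: w_def)
  also have "\<dots> < (c\<^sup>2 + 1) * d" using \<open>d > 0\<close> by (simp add: algebra_simps)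
  also have "\<dots> = e" using c by (simp add: d_def)
  finally show "\<exists>\<phi>. test_fun \<Omega> \<phi> \<and> l2prod M (jet \<phi> (grad \<phi>) - jet (c *\<^sub>R u) (c *\<^sub>R g)) (jet \<phi> (grad \<phi>) - jet (c *\<^sub>R u) (c *\<^sub>R g)) < e"
    using test_fun_scale[OF \<phi>(1), of c] eq by metis
qed

lemma H01_approx_test_fun: "test_fun \<Omega> \<phi> \<Longrightarrow> H01_approx \<Omega> \<phi> (grad \<phi>)"
  unfolding H01_approx_iff
  using sq_integrable_jet_test_fun[of \<phi>] l2.form_zero_left[OF l2.mem_zero, where 'b = "real \<times> 'a", of M]
  by (auto intro!: exI[of _ \<phi>])

text \<open>The relation between a function and its weak gradient is closed in the jet norm:
  approximate one sufficiently late member and use the triangle inequality.\<close>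

lemma H01_approx_limit:
  assumes f: "\<And>n. H01_approx \<Omega> (u n) (g n)"
    and s: "sq_integrable M (jet v k)"
    and lim: "(\<lambda>n. l2prod M (jet (u n) (g n) - jet v k) (jet (u n) (g n) - jet v k)) \<longlonglongrightarrow> 0"
  shows "H01_approx \<Omega> v k"
  unfolding H01_approx_iff
proof (intro conjI allI impI s)
  fix e :: real assume "e > 0"
  then have e: "e / 4 > 0" by simp
  from order_tendstoD(2)[OF lim e] obtain n
    where n: "l2prod M (jet (u n) (g n) - jet v k) (jet (u n) (g n) - jet v k) < e / 4"
    by (auto simp: eventually_sequentially)
  obtain \<phi> where \<phi>: "test_fun \<Omega> \<phi>" "l2prod M (jet \<phi> (grad \<phi>) - jet (u n) (g n)) (jet \<phi> (grad \<phi>) - jet (u n) (g n)) < e / 4"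
    using f[of n] e unfolding H01_approx_iff by blast
  have "l2prod M (jet \<phi> (grad \<phi>) - jet v k) (jet \<phi> (grad \<phi>) - jet v k) < e"
    using l2.form_triangle_sq[of "jet \<phi> (grad \<phi>)" M "jet (u n) (g n)" "jet v k"] \<phi>(2) n
      sq_integrable_jet_test_fun[OF \<phi>(1)] H01_approx_sq_integrable(1)[OF f[of n]] s by simp
  then show "\<exists>\<phi>. test_fun \<Omega> \<phi> \<and> l2prod M (jet \<phi> (grad \<phi>) - jet v k) (jet \<phi> (grad \<phi>) - jet v k) < e"
    using \<phi>(1) by blast
qed

end

subsection \<open>Uniqueness of weak gradients and completeness\<close>

text \<open>A logistic approximation of the unit step, steepened by n^2 and centred at 1/n. The
  shift makes the limit at 0 equal to 0, so products converge to the indicator of an open box at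
  every point, its boundary included.\<close>

definition sigmoid :: "nat \<Rightarrow> real \<Rightarrow> real" where
  "sigmoid n s = 1 / (1 + exp (real n - (real n)\<^sup>2 * s))"

lemma sigmoid_bounds: "0 \<le> sigmoid n s" "sigmoid n s \<le> 1"
proof -
  define E where "E = exp (real n - (real n)\<^sup>2 * s)"
  have "0 < E" by (simp add: E_def)
  then show "0 \<le> sigmoid n s" "sigmoid n s \<le> 1"
    unfolding sigmoid_def E_def[symmetric] by simp_all
qed

lemma sigmoid_tendsto: "(\<lambda>n. sigmoid n s) \<longlonglongrightarrow> (if s > 0 then 1 else 0)"
proof -
  consider "s > 0" | "s = 0" | "s < 0" by linarith
  then show ?thesis
  proof cases
    case 1
    then have "(\<lambda>n. sigmoid n s) \<longlonglongrightarrow> 1" unfolding sigmoid_def by real_asymp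
    then show ?thesis using 1 by simp
  next
    case 2
    have "(\<lambda>n. sigmoid n 0) \<longlonglongrightarrow> 0" unfolding sigmoid_def by real_asymp
    then show ?thesis using 2 by simp
  next
    case 3
    then have "(\<lambda>n. sigmoid n s) \<longlonglongrightarrow> 0" unfolding sigmoid_def by real_asymp
    then show ?thesis using 3 by simp
  qed
qed

lemma C1_sigmoid: "\<exists>f'. C1 (\<lambda>x. sigmoid n (x \<bullet> v + c)) f'"
proof -
  define E where "E s = exp (real n - (real n)\<^sup>2 * s)" for s :: real
  have E: "1 + E s \<noteq> 0" "0 < 1 + E s" for s
    using exp_gt_zero[of "real n - (real n)\<^sup>2 * s"] unfolding E_def by linarith+
  have deriv: "(sigmoid n has_real_derivative (real n)\<^sup>2 * E s / (1 + E s)\<^sup>2) (at s)" for s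
    unfolding sigmoid_def[abs_def] using E[of s] unfolding E_def
    by (auto intro!: derivative_eq_intros simp: power2_eq_square)
  have cont: "continuous_on UNIV (\<lambda>s. (real n)\<^sup>2 * E s / (1 + E s)\<^sup>2)"
    using E(1) unfolding E_def by (auto intro!: continuous_intros)
  from C1_compose_inner[OF deriv cont] show ?thesis by blast
qed

text \<open>It serves as a multiplier only, so it may be positive outside the box and needs no
  compact support.\<close>

definition box_bump :: "nat \<Rightarrow> 'a::euclidean_space \<Rightarrow> 'a \<Rightarrow> 'a \<Rightarrow> real" where
  "box_bump n a b x = (\<Prod>i\<in>Basis. sigmoid n (x \<bullet> i - a \<bullet> i) * sigmoid n (b \<bullet> i - x \<bullet> i))"

lemma C1_box_bump: "\<exists>f'. C1 (box_bump n a b) f'"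
proof -
  have f: "\<exists>f'. C1 (\<lambda>x. sigmoid n (x \<bullet> i - a \<bullet> i) * sigmoid n (b \<bullet> i - x \<bullet> i)) f'" for i :: 'a
  proof -
    obtain f' g' where "C1 (\<lambda>x. sigmoid n (x \<bullet> i + (- (a \<bullet> i)))) f'" "C1 (\<lambda>x. sigmoid n (x \<bullet> (- i) + b \<bullet> i)) g'"
      using C1_sigmoid by metis
    from C1_mult[OF this] show ?thesis by auto
  qed
  show ?thesis unfolding box_bump_def[abs_def] by (intro C1_prod finite_Basis f)
qed

lemma box_bump_bounds: "\<bar>box_bump n a b x\<bar> \<le> 1"
proof -
  have "0 \<le> box_bump n a b x" "box_bump n a b x \<le> 1"
    unfolding box_bump_def
    by (auto intro!: prod_nonneg prod_le_1 mult_nonneg_nonneg mult_le_one simp: sigmoid_bounds)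
  then show ?thesis by simp
qed

lemma box_bump_tendsto: "(\<lambda>n. box_bump n a b x) \<longlonglongrightarrow> indicator (box a b) x"
proof -
  define c where "c i = (if x \<bullet> i - a \<bullet> i > 0 then 1 else 0) * (if b \<bullet> i - x \<bullet> i > 0 then 1 else (0::real))" for i
  have "(\<lambda>n. box_bump n a b x) \<longlonglongrightarrow> (\<Prod>i\<in>Basis. c i)"
    unfolding box_bump_def c_def by (intro tendsto_prod tendsto_mult sigmoid_tendsto)
  also have "(\<Prod>i\<in>Basis. c i) = indicator (box a b) x"
  proof (cases "x \<in> box a b")
    case True
    then show ?thesis by (auto simp: c_def mem_box intro!: prod.neutral)
  next
    case False
    then obtain i where "i \<in> Basis" "c i = 0" by (auto simp: c_def mem_box)
    then have "(\<Prod>i\<in>Basis. c i) = 0" by (intro prod_zero) auto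
    then show ?thesis using False by simp
  qed
  finally show ?thesis .
qed

context bounded_domain
begin

lemma H01_approx_sequence:
  assumes "H01_approx \<Omega> u g"
  shows "\<exists>\<phi>. (\<forall>n. test_fun \<Omega> (\<phi> n)) \<and>
    (\<lambda>n. l2prod M (\<phi> n - u) (\<phi> n - u)) \<longlonglongrightarrow> 0 \<and>
    (\<lambda>n. l2prod M (grad (\<phi> n) - g) (grad (\<phi> n) - g)) \<longlonglongrightarrow> 0 \<and>
    (\<lambda>n. l2prod M (jet (\<phi> n) (grad (\<phi> n)) - jet u g) (jet (\<phi> n) (grad (\<phi> n)) - jet u g)) \<longlonglongrightarrow> 0"
proof -
  from assms obtain \<phi> where \<phi>: "\<And>n. test_fun \<Omega> (\<phi> n)"
    "(\<lambda>n. LINT x:\<Omega>|lebesgue. (\<phi> n x - u x)\<^sup>2) \<longlonglongrightarrow> 0"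
    "(\<lambda>n. LINT x:\<Omega>|lebesgue. (norm (grad (\<phi> n) x - g x))\<^sup>2) \<longlonglongrightarrow> 0"
    unfolding H01_approx_def by blast
  have 1: "(\<lambda>n. l2prod M (\<phi> n - u) (\<phi> n - u)) \<longlonglongrightarrow> 0"
    "(\<lambda>n. l2prod M (grad (\<phi> n) - g) (grad (\<phi> n) - g)) \<longlonglongrightarrow> 0"
    using \<phi>(2,3) by (simp_all add: l2prod_self integral_M)
  have "sq_integrable M (\<phi> n - u)" "sq_integrable M (grad (\<phi> n) - g)" for n
    using sq_integrable_test_fun[OF \<phi>(1)[of n]] H01_approx_sq_integrable(2,3)[OF assms]
    by (auto simp: fun_diff_def intro: sq_integrable_diff)
  then have "l2prod M (jet (\<phi> n) (grad (\<phi> n)) - jet u g) (jet (\<phi> n) (grad (\<phi> n)) - jet u g)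
      = l2prod M (\<phi> n - u) (\<phi> n - u) + l2prod M (grad (\<phi> n) - g) (grad (\<phi> n) - g)" for n
    by (simp add: jet_diff l2prod_jet)
  then have "(\<lambda>n. l2prod M (jet (\<phi> n) (grad (\<phi> n)) - jet u g) (jet (\<phi> n) (grad (\<phi> n)) - jet u g)) \<longlonglongrightarrow> 0"
    using tendsto_add[OF 1] by simp
  with \<phi>(1) 1 show ?thesis by blast
qed

text \<open>Integration by parts passes to the limit jet, whose function part is zero. What remains
  says that each component of \<open>k\<close> is orthogonal to all C1 multipliers, hence, by
  dominated convergence along \<open>box_bump\<close>, to box indicators.\<close>

lemma weak_gradient_of_zero:
  assumes "H01_approx \<Omega> 0 k"
  shows "AE x in M. k x = 0"
proof -
  obtain \<phi> where \<phi>: "\<And>n. test_fun \<Omega> (\<phi> n)"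
    and lim: "(\<lambda>n. l2prod M (jet (\<phi> n) (grad (\<phi> n)) - jet 0 k) (jet (\<phi> n) (grad (\<phi> n)) - jet 0 k)) \<longlonglongrightarrow> 0"
    using H01_approx_sequence[OF assms] by blast
  note sk = H01_approx_sq_integrable[OF assms]
  have ke: "integrable M (\<lambda>x. k x \<bullet> e)" for e
    using sq_integrable_imp_integrable[OF finite_M sk(3)] by simp
  have orth: "(LINT x|M. (k x \<bullet> e) * \<psi> x) = 0" if \<psi>: "C1 \<psi> \<psi>'" for \<psi> \<psi>' e
  proof -
    define w where "w = jet (\<lambda>x. \<psi>' x \<bullet> e) (\<lambda>x. \<psi> x *\<^sub>R e)"
    have w: "sq_integrable M w"
      unfolding w_def sq_integrable_jet using \<psi> C1_cont[OF \<psi>]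
      by (auto simp: C1_def intro!: sq_integrable_continuous continuous_intros)
    have "(\<lambda>n. l2prod M (jet (\<phi> n) (grad (\<phi> n))) w) \<longlonglongrightarrow> l2prod M (jet 0 k) w"
      using sk w sq_integrable_jet_test_fun[OF \<phi>] by (intro l2.tendsto_form_left lim) auto
    then have "l2prod M (jet 0 k) w = 0"
      unfolding w_def test_fun_integration_by_parts[OF \<phi> \<psi>] by (simp add: LIMSEQ_const_iff)
    then show ?thesis by (simp add: w_def l2prod_def jet_def mult.commute)
  qed
  have box0: "(LINT x|M. (k x \<bullet> e) * indicator (box a b) x) = 0" for e a b
  proof -
    have "(\<lambda>n. LINT x|M. (k x \<bullet> e) * box_bump n a b x) \<longlonglongrightarrow> (LINT x|M. (k x \<bullet> e) * indicator (box a b) x)"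
    proof (rule integral_dominated_convergence[where w = "\<lambda>x. \<bar>k x \<bullet> e\<bar>"])
      have "box a b \<in> sets lebesgue" by (intro fmeasurableD lmeasurable_box)
      then have "indicator (box a b) \<in> borel_measurable M"
        by (intro measurable_restrict_space1 borel_measurable_indicator)
      then show "(\<lambda>x. (k x \<bullet> e) * indicator (box a b) x) \<in> borel_measurable M"
        using ke[of e] by (auto intro: borel_measurable_times)
      have "box_bump n a b \<in> borel_measurable M" for n
        using C1_box_bump C1_cont continuous_measurable_M by blast
      then show "(\<lambda>x. (k x \<bullet> e) * box_bump n a b x) \<in> borel_measurable M" for n
        using ke[of e] by (auto intro: borel_measurable_times)
      show "integrable M (\<lambda>x. \<bar>k x \<bullet> e\<bar>)" using ke by simp
      show "AE x in M. (\<lambda>n. (k x \<bullet> e) * box_bump n a b x) \<longlonglongrightarrow> (k x \<bullet> e) * indicator (box a b) x"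
        by (intro AE_I2 tendsto_mult_left box_bump_tendsto)
      show "AE x in M. norm ((k x \<bullet> e) * box_bump n a b x) \<le> \<bar>k x \<bullet> e\<bar>" for n
        using box_bump_bounds[of n a b] by (intro AE_I2) (auto simp: abs_mult intro: mult_left_le)
    qed
    moreover have "(LINT x|M. (k x \<bullet> e) * box_bump n a b x) = 0" for n
      using C1_box_bump[of n a b] orth by blast
    ultimately show ?thesis by (simp add: LIMSEQ_const_iff)
  qed
  have "AE x in M. k x \<bullet> e = 0" for e
  proof -
    \<comment> \<open>Extension by zero moves the question to the whole space, where boxes need not
      lie inside the domain.\<close>
    have "AE x in lebesgue. indicator \<Omega> x * (k x \<bullet> e) = 0"
    proof (rule AE_lebesgue_zero_of_integral_box_zero)
      show "integrable lebesgue (\<lambda>x. indicator \<Omega> x * (k x \<bullet> e))"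
        using ke[of e] by (simp add: integrable_restrict_space)
      show "(LINT x|lebesgue. indicator (box a b) x * (indicator \<Omega> x * (k x \<bullet> e))) = 0" for a b
        using box0[of e a b] by (simp add: integral_restrict_space mult_ac)
    qed
    then show ?thesis by (subst AE_restrict_space_iff) (auto elim!: eventually_mono)
  qed
  then have "AE x in M. \<forall>e\<in>Basis. k x \<bullet> e = 0"
    by (intro AE_finite_allI) auto
  then show ?thesis by eventually_elim (simp add: euclidean_all_zero_iff)
qed

lemma weak_gradient_unique:
  assumes "H01_approx \<Omega> u g" "H01_approx \<Omega> u k"
  shows "AE x in M. g x = k x"
proof -
  have "H01_approx \<Omega> (u + (-1) *\<^sub>R u) (g + (-1) *\<^sub>R k)"
    by (intro H01_approx_add H01_approx_scale assms)
  then have "H01_approx \<Omega> 0 (g + (-1) *\<^sub>R k)" by simp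
  from weak_gradient_of_zero[OF this] have "AE x in M. (g + (-1) *\<^sub>R k) x = 0" .
  then show ?thesis by eventually_elim simp
qed

lemma H01_approx_wgrad: "u \<in> H01 \<Omega> \<Longrightarrow> H01_approx \<Omega> u (wgrad \<Omega> u)"
  unfolding wgrad_def by (rule someI_ex[of "H01_approx \<Omega> u"]) (simp add: H01_def)

text \<open>Makes the choice in \<open>wgrad\<close> harmless: any computed weak gradient may
  replace it under an integral.\<close>

lemma wgrad_AE: "H01_approx \<Omega> u g \<Longrightarrow> AE x in M. wgrad \<Omega> u x = g x"
  by (intro weak_gradient_unique[of u] H01_approx_wgrad) (auto simp: H01_def)

lemma sq_integrable_H01: "u \<in> H01 \<Omega> \<Longrightarrow> sq_integrable M u"
  and sq_integrable_wgrad: "u \<in> H01 \<Omega> \<Longrightarrow> sq_integrable M (wgrad \<Omega> u)"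
  using H01_approx_sq_integrable[OF H01_approx_wgrad] by auto

lemma subspace_H01: "subspace (H01 \<Omega>)"
  unfolding subspace_def H01_def
  using H01_approx_test_fun[OF test_fun_zero] H01_approx_add H01_approx_scale by blast

lemma wgrad_add_AE:
  "u \<in> H01 \<Omega> \<Longrightarrow> v \<in> H01 \<Omega> \<Longrightarrow> AE x in M. wgrad \<Omega> (u + v) x = wgrad \<Omega> u x + wgrad \<Omega> v x"
  using wgrad_AE[OF H01_approx_add[OF H01_approx_wgrad H01_approx_wgrad]] by simp

lemma wgrad_scale_AE:
  "u \<in> H01 \<Omega> \<Longrightarrow> AE x in M. wgrad \<Omega> (c *\<^sub>R u) x = c *\<^sub>R wgrad \<Omega> u x"
  using wgrad_AE[OF H01_approx_scale[OF H01_approx_wgrad]] by simp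

lemma wgrad_diff_AE:
  assumes "u \<in> H01 \<Omega>" "H01_approx \<Omega> v g"
  shows "AE x in M. wgrad \<Omega> (u - v) x = wgrad \<Omega> u x - g x"
  using wgrad_AE[OF H01_approx_add[OF H01_approx_wgrad[OF assms(1)] H01_approx_scale[OF assms(2), of "-1"]]]
  by simp

lemma l2inner_eq: "l2inner \<Omega> u v = l2prod M u v"
  by (simp add: l2inner_def l2prod_def integral_M)

lemma grad_sq_eq: "grad_sq \<Omega> u = l2prod M (wgrad \<Omega> u) (wgrad \<Omega> u)"
  by (simp add: grad_sq_def l2prod_self integral_M)

lemma grad_sq_nonneg: "0 \<le> grad_sq \<Omega> u"
  by (simp add: grad_sq_eq l2prod_self)

text \<open>Density: both sides are continuous along an approximating sequence of test
  functions.\<close>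

lemma Poincare_H01:
  assumes R: "\<And>x. x \<in> \<Omega> \<Longrightarrow> norm x \<le> R" and u: "u \<in> H01 \<Omega>"
  shows "l2prod M u u \<le> 4 * R\<^sup>2 * grad_sq \<Omega> u"
proof -
  let ?g = "wgrad \<Omega> u"
  obtain \<phi> where \<phi>: "\<And>n. test_fun \<Omega> (\<phi> n)" "(\<lambda>n. l2prod M (\<phi> n - u) (\<phi> n - u)) \<longlonglongrightarrow> 0"
    "(\<lambda>n. l2prod M (grad (\<phi> n) - ?g) (grad (\<phi> n) - ?g)) \<longlonglongrightarrow> 0"
    using H01_approx_sequence[OF H01_approx_wgrad[OF u]] by blast
  have "(\<lambda>n. l2prod M (\<phi> n) (\<phi> n)) \<longlonglongrightarrow> l2prod M u u"
    using sq_integrable_test_fun(1)[OF \<phi>(1)] sq_integrable_H01[OF u]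
    by (intro l2.tendsto_form \<phi>(2)) auto
  moreover have "(\<lambda>n. l2prod M (grad (\<phi> n)) (grad (\<phi> n))) \<longlonglongrightarrow> l2prod M ?g ?g"
    using sq_integrable_test_fun(2)[OF \<phi>(1)] sq_integrable_wgrad[OF u]
    by (intro l2.tendsto_form \<phi>(3)) auto
  then have "(\<lambda>n. 4 * R\<^sup>2 * l2prod M (grad (\<phi> n)) (grad (\<phi> n))) \<longlonglongrightarrow> 4 * R\<^sup>2 * grad_sq \<Omega> u"
    unfolding grad_sq_eq by (rule tendsto_mult_left)
  ultimately show ?thesis
    using Poincare_test_fun[OF R \<phi>(1)] by (intro LIMSEQ_le) auto
qed

text \<open>By the Poincare inequality a Cauchy sequence for the Dirichlet form is Cauchy in \<open>H\<^sup>1\<close>.\<close>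

lemma H01_complete:
  assumes u: "\<And>n. u n \<in> H01 \<Omega>"
    and cauchy: "\<And>e. e > 0 \<Longrightarrow> \<exists>K. \<forall>m\<ge>K. \<forall>n\<ge>K. grad_sq \<Omega> (u m - u n) < e"
  shows "\<exists>v\<in>H01 \<Omega>. (\<lambda>n. grad_sq \<Omega> (u n - v)) \<longlonglongrightarrow> 0"
proof -
  obtain R where R: "\<And>x. x \<in> \<Omega> \<Longrightarrow> norm x \<le> R"
    using bounded_dom by (auto simp: bounded_iff)
  define f where "f n = jet (u n) (wgrad \<Omega> (u n))" for n
  have fs: "sq_integrable M (f n)" for n
    unfolding f_def by (rule H01_approx_sq_integrable(1)[OF H01_approx_wgrad[OF u]])
  have f_le: "l2prod M (f m - f n) (f m - f n) \<le> (4 * R\<^sup>2 + 1) * grad_sq \<Omega> (u m - u n)" for m n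
  proof -
    have s: "sq_integrable M (u m - u n)" "sq_integrable M (wgrad \<Omega> (u m) - wgrad \<Omega> (u n))"
      using sq_integrable_H01[OF u] sq_integrable_wgrad[OF u]
      by (auto simp: fun_diff_def intro: sq_integrable_diff)
    have d: "u m - u n \<in> H01 \<Omega>" using subspace_H01 u by (intro subspace_diff)
    have ae: "AE x in M. wgrad \<Omega> (u m - u n) x = (wgrad \<Omega> (u m) - wgrad \<Omega> (u n)) x"
      using wgrad_diff_AE[OF u[of m] H01_approx_wgrad[OF u[of n]]] by simp
    have "grad_sq \<Omega> (u m - u n) = l2prod M (wgrad \<Omega> (u m) - wgrad \<Omega> (u n)) (wgrad \<Omega> (u m) - wgrad \<Omega> (u n))"
      unfolding grad_sq_eq l2prod_def using s(2) sq_integrable_wgrad[OF d] ae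
      by (intro integral_cong_AE) (auto simp: sq_integrable_def fun_diff_def)
    then have "l2prod M (f m - f n) (f m - f n) = l2prod M (u m - u n) (u m - u n) + grad_sq \<Omega> (u m - u n)"
      unfolding f_def jet_diff using s by (simp add: l2prod_jet)
    then show ?thesis using Poincare_H01[OF R d] by (simp add: algebra_simps)
  qed
  have "\<exists>K. \<forall>m\<ge>K. \<forall>n\<ge>K. l2prod M (f m - f n) (f m - f n) < e" if e: "e > 0" for e
  proof -
    define c where "c = 4 * R\<^sup>2 + 1"
    have c: "c > 0" unfolding c_def by (simp add: add_nonneg_pos)
    obtain K where K: "\<And>m n. m \<ge> K \<Longrightarrow> n \<ge> K \<Longrightarrow> grad_sq \<Omega> (u m - u n) < e / c"
      using cauchy[of "e / c"] e c by auto
    have "l2prod M (f m - f n) (f m - f n) < e" if "m \<ge> K" "n \<ge> K" for m n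
      using f_le[of m n] mult_strict_left_mono[OF K[OF that] c] c by (simp add: c_def)
    then show ?thesis by blast
  qed
  from sq_integrable_complete[OF fs this] obtain p where p: "sq_integrable M p"
    "(\<lambda>n. l2prod M (f n - p) (f n - p)) \<longlonglongrightarrow> 0" by blast
  \<comment> \<open>The L^2 limit of the jets splits into a function and a candidate gradient;
    closedness of \<open>H01_approx\<close> ties the two together.\<close>
  define v g where "v = (\<lambda>x. fst (p x))" and "g = (\<lambda>x. snd (p x))"
  have pj: "p = jet v g" by (simp add: jet_def v_def g_def)
  have vg: "H01_approx \<Omega> v g"
    using H01_approx_limit[OF H01_approx_wgrad[OF u], of v g] p unfolding f_def pj by simp
  then have v: "v \<in> H01 \<Omega>" by (auto simp: H01_def)
  have sp: "sq_integrable M v" "sq_integrable M g"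
    using H01_approx_sq_integrable[OF vg] by auto
  have le: "grad_sq \<Omega> (u n - v) \<le> l2prod M (f n - p) (f n - p)" for n
  proof -
    have s: "sq_integrable M (u n - v)" "sq_integrable M (wgrad \<Omega> (u n) - g)"
      using sq_integrable_H01[OF u] sq_integrable_wgrad[OF u] sp
      by (auto simp: fun_diff_def intro: sq_integrable_diff)
    have d: "u n - v \<in> H01 \<Omega>" using subspace_H01 u v by (intro subspace_diff)
    have "grad_sq \<Omega> (u n - v) = l2prod M (wgrad \<Omega> (u n) - g) (wgrad \<Omega> (u n) - g)"
      unfolding grad_sq_eq l2prod_def using s(2) sq_integrable_wgrad[OF d] wgrad_diff_AE[OF u[of n] vg]
      by (intro integral_cong_AE) (auto simp: sq_integrable_def fun_diff_def)
    moreover have "l2prod M (f n - p) (f n - p) = l2prod M (u n - v) (u n - v) + l2prod M (wgrad \<Omega> (u n) - g) (wgrad \<Omega> (u n) - g)"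
      unfolding f_def pj jet_diff using s by (simp add: l2prod_jet)
    moreover have "0 \<le> l2prod M (u n - v) (u n - v)" by (simp add: l2prod_self)
    ultimately show ?thesis by simp
  qed
  have "(\<lambda>n. grad_sq \<Omega> (u n - v)) \<longlonglongrightarrow> 0"
    by (rule Lim_null_comparison[OF _ p(2)]) (use le grad_sq_nonneg in auto)
  then show ?thesis using v by blast
qed

end

subsection \<open>Lyapunov decay and the solution operator\<close>

text \<open>Only interior derivatives are two-sided; at 0 the one-sided derivative contributes
  continuity.\<close>

lemma nonincreasing_from_zero:
  fixes f :: "real \<Rightarrow> real"
  assumes deriv: "\<And>t. 0 \<le> t \<Longrightarrow> (f has_real_derivative f' t) (at t within {0..})"
    and nonpos: "\<And>t. 0 \<le> t \<Longrightarrow> f' t \<le> 0" and T: "0 \<le> T"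
  shows "f T \<le> f 0"
proof (rule DERIV_nonpos_imp_decreasing_open[OF T])
  fix t assume t: "0 < t" "t < T"
  then have "(f has_real_derivative f' t) (at t)"
    using deriv[of t] at_within_interior[of t "{0..}"] by simp
  then show "\<exists>y. (f has_real_derivative y) (at t) \<and> y \<le> 0"
    using nonpos[of t] t by auto
next
  have "continuous_on {0..} f"
    using deriv DERIV_continuous by (fastforce simp: continuous_on_eq_continuous_within)
  then show "continuous_on {0..T} f" by (rule continuous_on_subset) auto
qed

text \<open>Since \<open>D\<close> is symmetric, each of the two products with \<open>A\<close>
  contributes the sum of the quadratic forms of \<open>A\<close> at the rows of \<open>D\<close>,
  and the lower bound applies row by row.\<close>

lemma Lyapunov_exponential_decay:
  assumes deriv: "\<And>t i j. 0 \<le> t \<Longrightarrow> i < N \<Longrightarrow> j < N \<Longrightarrow>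
      ((\<lambda>s. D s i j) has_real_derivative - (\<Sum>k<N. A t i k * D t k j + D t i k * A t k j)) (at t within {0..})"
    and sym: "\<And>t i j. 0 \<le> t \<Longrightarrow> i < N \<Longrightarrow> j < N \<Longrightarrow> D t i j = D t j i"
    and A: "\<And>t z. 0 \<le> t \<Longrightarrow> m * (\<Sum>i<N. (z i)\<^sup>2) \<le> quad_form N (A t) z z"
    and T: "0 \<le> T"
  shows "frob N (D T) \<le> frob N (D 0) * exp (- (2 * m * T))"
proof -
  define f where "f t = (\<Sum>i<N. \<Sum>j<N. (D t i j)\<^sup>2)" for t
  define f' where "f' t = (\<Sum>i<N. \<Sum>j<N. 2 * D t i j * (- (\<Sum>k<N. A t i k * D t k j + D t i k * A t k j)))" for t
  have df: "(f has_real_derivative f' t) (at t within {0..})" if t: "0 \<le> t" for t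
    unfolding f_def f'_def
    by (rule derivative_eq_intros deriv[OF t] refl | simp add: mult_ac)+
  have f'_le: "f' t \<le> - (4 * m * f t)" if t: "0 \<le> t" for t
  proof -
    have left: "(\<Sum>i<N. \<Sum>j<N. D t i j * (\<Sum>k<N. A t i k * D t k j)) = (\<Sum>i<N. quad_form N (A t) (D t i) (D t i))"
    proof -
      have "(\<Sum>i<N. \<Sum>j<N. D t i j * (\<Sum>k<N. A t i k * D t k j))
          = (\<Sum>j<N. \<Sum>i<N. D t i j * (\<Sum>k<N. A t i k * D t k j))" by (rule sum.swap)
      also have "\<dots> = (\<Sum>j<N. quad_form N (A t) (D t j) (D t j))"
        unfolding quad_form_def sum_distrib_left
        by (intro sum.cong refl) (simp add: sym[OF t] mult.assoc)
      finally show ?thesis .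
    qed
    have right: "(\<Sum>i<N. \<Sum>j<N. D t i j * (\<Sum>k<N. D t i k * A t k j)) = (\<Sum>i<N. quad_form N (A t) (D t i) (D t i))"
    proof (intro sum.cong refl)
      fix i
      have "(\<Sum>j<N. D t i j * (\<Sum>k<N. D t i k * A t k j)) = (\<Sum>j<N. \<Sum>k<N. D t i k * A t k j * D t i j)"
        by (simp add: sum_distrib_left mult_ac)
      also have "\<dots> = quad_form N (A t) (D t i) (D t i)" unfolding quad_form_def by (rule sum.swap)
      finally show "(\<Sum>j<N. D t i j * (\<Sum>k<N. D t i k * A t k j)) = quad_form N (A t) (D t i) (D t i)" .
    qed
    have "f' t = - 2 * (\<Sum>i<N. \<Sum>j<N. D t i j * (\<Sum>k<N. A t i k * D t k j))
        - 2 * (\<Sum>i<N. \<Sum>j<N. D t i j * (\<Sum>k<N. D t i k * A t k j))"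
    proof -
      have "2 * D t i j * (- (\<Sum>k<N. A t i k * D t k j + D t i k * A t k j))
        = - 2 * (D t i j * (\<Sum>k<N. A t i k * D t k j)) + - 2 * (D t i j * (\<Sum>k<N. D t i k * A t k j))" for i j
        by (simp add: sum.distrib algebra_simps)
      then show ?thesis by (simp only: f'_def sum.distrib sum_distrib_left[symmetric])
    qed
    then have "f' t = - 4 * (\<Sum>i<N. quad_form N (A t) (D t i) (D t i))"
      using left right by simp
    moreover have "(\<Sum>i<N. m * (\<Sum>j<N. (D t i j)\<^sup>2)) \<le> (\<Sum>i<N. quad_form N (A t) (D t i) (D t i))"
      by (intro sum_mono A[OF t])
    ultimately show ?thesis by (simp add: f_def sum_distrib_left[symmetric])
  qed
  \<comment> \<open>The integrating factor turns the differential inequality into monotonicity. The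
    final square root halves the exponent.\<close>
  have "f T * exp (4 * m * T) \<le> f 0 * exp (4 * m * 0)"
  proof (rule nonincreasing_from_zero[OF _ _ T])
    show "((\<lambda>t. f t * exp (4 * m * t)) has_real_derivative (f' t + 4 * m * f t) * exp (4 * m * t)) (at t within {0..})"
      if "0 \<le> t" for t
      by (rule derivative_eq_intros df[OF that] refl | simp add: algebra_simps)+
    show "(f' t + 4 * m * f t) * exp (4 * m * t) \<le> 0" if "0 \<le> t" for t
      using f'_le[OF that] by (intro mult_nonpos_nonneg) auto
  qed
  then have "f T * exp (4 * m * T) * exp (- (4 * m * T)) \<le> f 0 * exp (- (4 * m * T))"
    by (intro mult_right_mono) auto
  then have "f T \<le> f 0 * exp (- (4 * m * T))"
    by (simp add: mult.assoc exp_add[symmetric])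
  also have "exp (- (4 * m * T)) = (exp (- (2 * m * T)))\<^sup>2"
    by (simp add: power2_eq_square exp_add[symmetric])
  finally have "sqrt (f T) \<le> sqrt (f 0 * (exp (- (2 * m * T)))\<^sup>2)" by simp
  then show ?thesis by (simp add: frob_def f_def real_sqrt_mult)
qed

section \<open>The elliptic form and its inverse operator\<close>

locale elliptic_form = bounded_domain \<Omega> for \<Omega> :: "'a::euclidean_space set" +
  fixes V :: "'a \<Rightarrow> real" and c1 c2 :: real
  assumes V_int: "u \<in> H01 \<Omega> \<Longrightarrow> v \<in> H01 \<Omega> \<Longrightarrow> set_integrable lebesgue \<Omega> (\<lambda>x. V x * u x * v x)"
    and c1_pos: "c1 > 0"
    and coercive: "u \<in> H01 \<Omega> \<Longrightarrow> c1 * grad_sq \<Omega> u \<le> aform \<Omega> V u u \<and> aform \<Omega> V u u \<le> c2 * grad_sq \<Omega> u"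
begin

lemma aform_eq:
  assumes "u \<in> H01 \<Omega>" "v \<in> H01 \<Omega>"
  shows "aform \<Omega> V u v = l2prod M (wgrad \<Omega> u) (wgrad \<Omega> v) + (LINT x|M. V x * u x * v x)"
  unfolding aform_def integral_M l2prod_def
  using sq_integrable_inner[OF sq_integrable_wgrad sq_integrable_wgrad, OF assms] V_int[OF assms]
  by (simp add: integrable_M)

text \<open>Integrability of the potential term lets the integral be split; linearity of the
  gradient part then follows from linearity of \<open>wgrad\<close> almost everywhere.\<close>

lemma semi_inner_product_aform: "semi_inner_product (H01 \<Omega>) (aform \<Omega> V)"
proof
  show "subspace (H01 \<Omega>)" by (rule subspace_H01)
  fix u v w :: "'a \<Rightarrow> real" and c :: real
  show "aform \<Omega> V u v = aform \<Omega> V v u" by (simp add: aform_def inner_commute mult_ac)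
  assume u: "u \<in> H01 \<Omega>"
  show "0 \<le> aform \<Omega> V u u"
    using coercive[OF u] c1_pos grad_sq_nonneg[of u] by (meson mult_nonneg_nonneg less_imp_le order_trans)
  assume w: "w \<in> H01 \<Omega>"
  note meas = sq_integrable_wgrad[unfolded sq_integrable_def, THEN conjunct1]
  have cu: "c *\<^sub>R u \<in> H01 \<Omega>" using subspace_H01 u by (intro subspace_scale)
  have "l2prod M (wgrad \<Omega> (c *\<^sub>R u)) (wgrad \<Omega> w) = (LINT x|M. c * (wgrad \<Omega> u x \<bullet> wgrad \<Omega> w x))"
    unfolding l2prod_def using meas[OF u] meas[OF w] meas[OF cu] wgrad_scale_AE[OF u, of c]
    by (intro integral_cong_AE) auto
  then show "aform \<Omega> V (c *\<^sub>R u) w = c * aform \<Omega> V u w"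
    by (simp add: aform_eq[OF cu w] aform_eq[OF u w] l2prod_def algebra_simps)
  assume v: "v \<in> H01 \<Omega>"
  have uv: "u + v \<in> H01 \<Omega>" using subspace_H01 u v by (intro subspace_add)
  have "l2prod M (wgrad \<Omega> (u + v)) (wgrad \<Omega> w)
      = (LINT x|M. wgrad \<Omega> u x \<bullet> wgrad \<Omega> w x + wgrad \<Omega> v x \<bullet> wgrad \<Omega> w x)"
    unfolding l2prod_def using meas[OF u] meas[OF v] meas[OF w] meas[OF uv] wgrad_add_AE[OF u v]
    by (intro integral_cong_AE) (auto simp: inner_add_left)
  also have "\<dots> = l2prod M (wgrad \<Omega> u) (wgrad \<Omega> w) + l2prod M (wgrad \<Omega> v) (wgrad \<Omega> w)"
    unfolding l2prod_def
    using sq_integrable_inner[OF sq_integrable_wgrad sq_integrable_wgrad] u v w by simp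
  finally show "aform \<Omega> V (u + v) w = aform \<Omega> V u w + aform \<Omega> V v w"
    using V_int[OF u w] V_int[OF v w]
    by (simp add: aform_eq[OF uv w] aform_eq[OF u w] aform_eq[OF v w] integrable_M distrib_left distrib_right)
qed

sublocale a: semi_inner_product "H01 \<Omega>" "aform \<Omega> V"
  by (rule semi_inner_product_aform)

sublocale b: semi_inner_product "H01 \<Omega>" "l2inner \<Omega>"
proof
  have s: "u \<in> {f. sq_integrable M f}" if "u \<in> H01 \<Omega>" for u using sq_integrable_H01[OF that] by simp
  fix u v w :: "'a \<Rightarrow> real" and c :: real
  show "subspace (H01 \<Omega>)" by (rule subspace_H01)
  show "l2inner \<Omega> u v = l2inner \<Omega> v u" by (simp add: l2inner_def mult.commute)
  assume u: "u \<in> H01 \<Omega>"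
  show "0 \<le> l2inner \<Omega> u u" unfolding l2inner_eq using s[OF u] by (rule l2.form_nonneg)
  assume w: "w \<in> H01 \<Omega>"
  show "l2inner \<Omega> (c *\<^sub>R u) w = c * l2inner \<Omega> u w"
    unfolding l2inner_eq using s[OF u] s[OF w] by (rule l2.form_scale_left)
  assume v: "v \<in> H01 \<Omega>"
  show "l2inner \<Omega> (u + v) w = l2inner \<Omega> u w + l2inner \<Omega> v w"
    unfolding l2inner_eq using s[OF u] s[OF v] s[OF w] by (rule l2.form_add_left)
qed

lemma grad_sq_le_aform: "u \<in> H01 \<Omega> \<Longrightarrow> grad_sq \<Omega> u \<le> aform \<Omega> V u u / c1"
  using coercive[of u] c1_pos by (simp add: pos_le_divide_eq mult.commute)

text \<open>Riesz for the form itself: the two-sided comparison with \<open>grad_sq\<close> carries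
  completeness over, and Poincare makes the functional bounded.\<close>

lemma Gop_exists:
  assumes f: "f \<in> H01 \<Omega>"
  shows "\<exists>w\<in>H01 \<Omega>. \<forall>v\<in>H01 \<Omega>. aform \<Omega> V w v = l2inner \<Omega> f v"
proof -
  obtain R where R: "\<And>x. x \<in> \<Omega> \<Longrightarrow> norm x \<le> R"
    using bounded_dom by (auto simp: bounded_iff)
  show ?thesis
  proof (rule a.Riesz_representation_form)
    fix u :: "nat \<Rightarrow> 'a \<Rightarrow> real"
    assume u: "\<And>n. u n \<in> H01 \<Omega>"
      and cauchy: "\<And>e. e > 0 \<Longrightarrow> \<exists>K. \<forall>m\<ge>K. \<forall>n\<ge>K. aform \<Omega> V (u m - u n) (u m - u n) < e"
    have "\<exists>K. \<forall>m\<ge>K. \<forall>n\<ge>K. grad_sq \<Omega> (u m - u n) < e" if e: "e > 0" for e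
    proof -
      obtain K where K: "\<And>m n. m \<ge> K \<Longrightarrow> n \<ge> K \<Longrightarrow> aform \<Omega> V (u m - u n) (u m - u n) < e * c1"
        using cauchy[of "e * c1"] e c1_pos by auto
      have "grad_sq \<Omega> (u m - u n) < e" if "m \<ge> K" "n \<ge> K" for m n
      proof -
        have "grad_sq \<Omega> (u m - u n) \<le> aform \<Omega> V (u m - u n) (u m - u n) / c1"
          using u by (intro grad_sq_le_aform a.mem_diff)
        also have "\<dots> < e" using K[OF that] c1_pos by (simp add: pos_divide_less_eq)
        finally show ?thesis .
      qed
      then show ?thesis by blast
    qed
    from H01_complete[OF u this] obtain v where v: "v \<in> H01 \<Omega>" "(\<lambda>n. grad_sq \<Omega> (u n - v)) \<longlonglongrightarrow> 0"
      by blast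
    have "(\<lambda>n. aform \<Omega> V (u n - v) (u n - v)) \<longlonglongrightarrow> 0"
    proof (rule Lim_null_comparison[OF always_eventually[OF allI] tendsto_mult_right_zero[OF v(2)]])
      fix n
      have "u n - v \<in> H01 \<Omega>" using u v(1) by (intro a.mem_diff)
      then show "norm (aform \<Omega> V (u n - v) (u n - v)) \<le> c2 * grad_sq \<Omega> (u n - v)"
        using coercive[of "u n - v"] a.form_nonneg[of "u n - v"] by simp
    qed
    then show "\<exists>x\<in>H01 \<Omega>. (\<lambda>n. aform \<Omega> V (u n - x) (u n - x)) \<longlonglongrightarrow> 0"
      using v(1) by blast
  next
    fix v assume v: "v \<in> H01 \<Omega>"
    have "(l2inner \<Omega> f v)\<^sup>2 \<le> l2inner \<Omega> f f * l2inner \<Omega> v v"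
      using f v by (rule b.Cauchy_Schwarz_form)
    also have "\<dots> \<le> l2inner \<Omega> f f * (4 * R\<^sup>2 * (aform \<Omega> V v v / c1))"
    proof (rule mult_left_mono)
      have "l2inner \<Omega> v v \<le> 4 * R\<^sup>2 * grad_sq \<Omega> v"
        unfolding l2inner_eq by (rule Poincare_H01[OF R v])
      also have "\<dots> \<le> 4 * R\<^sup>2 * (aform \<Omega> V v v / c1)"
        using grad_sq_le_aform[OF v] by (intro mult_left_mono) auto
      finally show "l2inner \<Omega> v v \<le> 4 * R\<^sup>2 * (aform \<Omega> V v v / c1)" .
    qed (rule b.form_nonneg[OF f])
    finally show "(l2inner \<Omega> f v)\<^sup>2 \<le> (l2inner \<Omega> f f * 4 * R\<^sup>2 / c1) * aform \<Omega> V v v"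
      by (simp add: mult_ac)
  qed (use f in \<open>auto simp: b.form_simps\<close>)
qed

lemma Gop_H01: "f \<in> H01 \<Omega> \<Longrightarrow> Gop \<Omega> V f \<in> H01 \<Omega>"
  and aform_Gop: "f \<in> H01 \<Omega> \<Longrightarrow> v \<in> H01 \<Omega> \<Longrightarrow> aform \<Omega> V (Gop \<Omega> V f) v = l2inner \<Omega> f v"
proof -
  have "Gop \<Omega> V f \<in> H01 \<Omega> \<and> (\<forall>v\<in>H01 \<Omega>. aform \<Omega> V (Gop \<Omega> V f) v = l2inner \<Omega> f v)" if "f \<in> H01 \<Omega>" for f
    unfolding Gop_def
    by (rule someI_ex[of "\<lambda>w. w \<in> H01 \<Omega> \<and> (\<forall>v\<in>H01 \<Omega>. aform \<Omega> V w v = l2inner \<Omega> f v)"])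
      (use Gop_exists[OF that] in blast)
  then show "f \<in> H01 \<Omega> \<Longrightarrow> Gop \<Omega> V f \<in> H01 \<Omega>"
    "f \<in> H01 \<Omega> \<Longrightarrow> v \<in> H01 \<Omega> \<Longrightarrow> aform \<Omega> V (Gop \<Omega> V f) v = l2inner \<Omega> f v" by auto
qed

text \<open>\<open>(z, \<langle>GU, GU\<rangle>\<^sub>a z) \<ge> |z|\<^sup>2 / tr \<langle>U, U\<rangle>\<^sub>a\<close>: Cauchy--Schwarz for \<open>a\<close> applied to \<open>Uz\<close> and \<open>GUz\<close>, whose
  product is \<open>(z, \<langle>U, U\<rangle> z) \<ge> |z|\<^sup>2\<close>.\<close>

lemma Gop_gram_lower_bound:
  fixes u :: "nat \<Rightarrow> 'a \<Rightarrow> real"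
  assumes u: "\<And>i. i < N \<Longrightarrow> u i \<in> H01 \<Omega>"
    and S: "psd N (\<lambda>i j. l2inner \<Omega> (u i) (u j) - idm i j)"
  shows "(\<Sum>i<N. (z i)\<^sup>2) \<le> quad_form N (\<lambda>i j. aform \<Omega> V (Gop \<Omega> V (u i)) (Gop \<Omega> V (u j))) z z
      * (\<Sum>i<N. aform \<Omega> V (u i) (u i))"
proof -
  define g where "g i = Gop \<Omega> V (u i)" for i
  have g: "g i \<in> H01 \<Omega>" if "i < N" for i using Gop_H01[OF u[OF that]] by (simp add: g_def)
  define w where "w = (\<Sum>i<N. z i *\<^sub>R u i)"
  define h where "h = (\<Sum>i<N. z i *\<^sub>R g i)"
  have wX: "w \<in> H01 \<Omega>" unfolding w_def using u by (intro a.mem_sum a.mem_scale) auto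
  have hX: "h \<in> H01 \<Omega>" unfolding h_def using g by (intro a.mem_sum a.mem_scale) auto
  define r where "r = (\<Sum>i<N. (z i)\<^sup>2)"
  define q where "q = quad_form N (\<lambda>i j. aform \<Omega> V (g i) (g j)) z z"
  have r0: "0 \<le> r" unfolding r_def by (intro sum_nonneg) auto
  have expand: "aform \<Omega> V (\<Sum>i<N. z i *\<^sub>R x i) (\<Sum>i<N. z i *\<^sub>R y i) = quad_form N (\<lambda>i j. aform \<Omega> V (x i) (y j)) z z"
    if x: "\<And>i. i < N \<Longrightarrow> x i \<in> H01 \<Omega>" and y: "\<And>i. i < N \<Longrightarrow> y i \<in> H01 \<Omega>" for x y
  proof -
    have x': "\<And>i. i \<in> {..<N} \<Longrightarrow> z i *\<^sub>R x i \<in> H01 \<Omega>" and y': "\<And>i. i \<in> {..<N} \<Longrightarrow> z i *\<^sub>R y i \<in> H01 \<Omega>"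
      using x y by (auto intro: a.mem_scale)
    show ?thesis
      unfolding quad_form_def
      by (simp only: a.form_sum_left[OF a.mem_sum[OF y'] x'])
        (intro sum.cong refl, simp only: a.form_sum_right[OF x' y'], intro sum.cong refl,
          simp add: a.form_scale_left a.form_scale_right x y a.mem_scale)
  qed
  have hh: "aform \<Omega> V h h = q" unfolding h_def q_def by (rule expand[OF g g])
  have wh: "r \<le> aform \<Omega> V w h"
  proof -
    have "aform \<Omega> V w h = quad_form N (\<lambda>i j. aform \<Omega> V (u i) (g j)) z z"
      unfolding w_def h_def using u g by (rule expand)
    also have "\<dots> = quad_form N (\<lambda>i j. l2inner \<Omega> (u i) (u j)) z z"
      unfolding quad_form_def
    proof (intro sum.cong refl)
      fix i j assume ij: "i \<in> {..<N}" "j \<in> {..<N}"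
      have "aform \<Omega> V (u i) (g j) = aform \<Omega> V (g j) (u i)" using ij u g by (intro a.form_sym) auto
      also have "\<dots> = l2inner \<Omega> (u j) (u i)" unfolding g_def using ij u by (intro aform_Gop) auto
      also have "\<dots> = l2inner \<Omega> (u i) (u j)" using ij u by (intro b.form_sym) auto
      finally show "z i * aform \<Omega> V (u i) (g j) * z j = z i * l2inner \<Omega> (u i) (u j) * z j" by simp
    qed
    also have "\<dots> = (\<Sum>i<N. \<Sum>j<N. z i * (l2inner \<Omega> (u i) (u j) - idm i j) * z j) + (\<Sum>i<N. \<Sum>j<N. z i * idm i j * z j)"
      by (simp add: quad_form_def sum.distrib[symmetric] algebra_simps)
    also have "(\<Sum>i<N. \<Sum>j<N. z i * idm i j * z j) = r"
      unfolding r_def by (intro sum.cong refl)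
        (simp add: idm_def if_distrib[of "\<lambda>a. a * _"] if_distrib[of "\<lambda>a. _ * a"] power2_eq_square cong: if_cong)
    finally show ?thesis using S by (auto simp: psd_def)
  qed
  define K where "K = (\<Sum>i<N. aform \<Omega> V (u i) (u i))"
  \<comment> \<open>The largest eigenvalue of the Gram matrix is at most its trace: Cauchy-Schwarz
    for each entry, then for the sums.\<close>
  have ww: "aform \<Omega> V w w \<le> r * K"
  proof -
    have "aform \<Omega> V w w = quad_form N (\<lambda>i j. aform \<Omega> V (u i) (u j)) z z"
      unfolding w_def using u u by (rule expand)
    also have "\<dots> \<le> (\<Sum>i<N. \<Sum>j<N. (\<bar>z i\<bar> * sqrt (aform \<Omega> V (u i) (u i))) * (\<bar>z j\<bar> * sqrt (aform \<Omega> V (u j) (u j))))"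
      unfolding quad_form_def
    proof (intro sum_mono)
      fix i j assume ij: "i \<in> {..<N}" "j \<in> {..<N}"
      have "z i * aform \<Omega> V (u i) (u j) * z j \<le> \<bar>z i\<bar> * \<bar>z j\<bar> * \<bar>aform \<Omega> V (u i) (u j)\<bar>"
        using abs_ge_self[of "z i * aform \<Omega> V (u i) (u j) * z j"] by (simp add: abs_mult mult_ac)
      also have "\<dots> \<le> \<bar>z i\<bar> * \<bar>z j\<bar> * (sqrt (aform \<Omega> V (u i) (u i)) * sqrt (aform \<Omega> V (u j) (u j)))"
        using ij u by (intro mult_left_mono a.abs_form_le) auto
      finally show "z i * aform \<Omega> V (u i) (u j) * z j
          \<le> (\<bar>z i\<bar> * sqrt (aform \<Omega> V (u i) (u i))) * (\<bar>z j\<bar> * sqrt (aform \<Omega> V (u j) (u j)))"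
        by (simp only: mult_ac)
    qed
    also have "\<dots> = (\<Sum>i<N. \<bar>z i\<bar> * sqrt (aform \<Omega> V (u i) (u i)))\<^sup>2"
      by (simp add: power2_eq_square sum_product)
    also have "\<dots> \<le> (\<Sum>i<N. \<bar>z i\<bar>\<^sup>2) * (\<Sum>i<N. (sqrt (aform \<Omega> V (u i) (u i)))\<^sup>2)"
      by (rule Cauchy_Schwarz_ineq_sum)
    also have "(\<Sum>i<N. (sqrt (aform \<Omega> V (u i) (u i)))\<^sup>2) = K"
      unfolding K_def using u by (intro sum.cong refl) (simp add: a.form_nonneg)
    finally show ?thesis by (simp add: r_def)
  qed
  have q0: "0 \<le> q" using a.form_nonneg[OF hX] hh by simp
  have "r * r \<le> (aform \<Omega> V w h)\<^sup>2"
    using wh r0 by (simp add: power2_eq_square mult_mono)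
  also have "\<dots> \<le> aform \<Omega> V w w * q" using a.Cauchy_Schwarz_form[OF wX hX] hh by simp
  also have "\<dots> \<le> (r * K) * q" using ww q0 by (rule mult_right_mono)
  \<comment> \<open>One factor \<open>r\<close> is cancelled; for \<open>r = 0\<close> the claim is
    the sign of \<open>q * K\<close>.\<close>
  finally have "r * r \<le> r * (q * K)" by (simp add: mult_ac)
  moreover have "0 \<le> q * K"
    unfolding K_def using u q0 by (intro mult_nonneg_nonneg sum_nonneg) (auto simp: a.form_nonneg)
  ultimately have "r \<le> q * K"
    using r0 by (cases "r = 0") auto
  then show ?thesis by (simp add: r_def q_def K_def g_def)
qed

end

theorem theorem3p8:
  fixes \<Omega> :: "'a::euclidean_space set"
    and V :: "'a \<Rightarrow> real"
    and N :: nat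
    and c1 c2 :: real
    and U Ud :: "real \<Rightarrow> nat \<Rightarrow> 'a \<Rightarrow> real"
  assumes dom: "open \<Omega>" "connected \<Omega>" "bounded \<Omega>" "\<Omega> \<noteq> {}"
    and V_meas: "set_borel_measurable lebesgue \<Omega> V"
    and V_int: "\<And>u v. u \<in> H01 \<Omega> \<Longrightarrow> v \<in> H01 \<Omega> \<Longrightarrow> set_integrable lebesgue \<Omega> (\<lambda>x. V x * u x * v x)"
    and c_pos: "c1 > 0" "c2 > 0"
    and coercive: "\<And>u. u \<in> H01 \<Omega> \<Longrightarrow> c1 * grad_sq \<Omega> u \<le> aform \<Omega> V u u \<and> aform \<Omega> V u u \<le> c2 * grad_sq \<Omega> u"
    and U_H01: "\<And>t i. t \<ge> 0 \<Longrightarrow> i < N \<Longrightarrow> U t i \<in> H01 \<Omega>"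
    and Ud_H01: "\<And>t i. t \<ge> 0 \<Longrightarrow> i < N \<Longrightarrow> Ud t i \<in> H01 \<Omega>"
    and U_deriv: "\<And>t i. t \<ge> 0 \<Longrightarrow> i < N \<Longrightarrow>
        ((\<lambda>h. h1norm_sq \<Omega> (\<lambda>x. (U (t + h) i x - U t i x) / h - Ud t i x)) \<longlongrightarrow> 0)
          (at 0 within {h. t + h \<ge> 0})"
    and Ud_cont: "\<And>t i. t \<ge> 0 \<Longrightarrow> i < N \<Longrightarrow>
        ((\<lambda>s. h1norm_sq \<Omega> (\<lambda>x. Ud s i x - Ud t i x)) \<longlongrightarrow> 0) (at t within {0..})"
    and ode: "\<And>t i. t \<ge> 0 \<Longrightarrow> i < N \<Longrightarrow>
        h1norm_sq \<Omega> (\<lambda>x. Ud t i x - flow_rhs \<Omega> V N (U t) i x) = 0"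
    and init: "U 0 \<in> quasi_stiefel \<Omega> N"
  shows "(\<forall>t\<ge>0. frob N (\<lambda>i j. gram \<Omega> N (U t) (U t) i j - idm i j)
            \<le> frob N (\<lambda>i j. gram \<Omega> N (U 0) (U 0) i j - idm i j) * exp (- t / energy \<Omega> V N (U 0)))
       \<and> (\<forall>i<N. \<forall>j<N. ((\<lambda>t. gram \<Omega> N (U t) (U t) i j) \<longlongrightarrow> idm i j) at_top)"
proof -
  interpret elliptic_form \<Omega> V c1 c2
    using dom V_int c_pos coercive by unfold_locales auto
  define G where "G t i = Gop \<Omega> V (U t i)" for t i
  define S where "S t i j = l2inner \<Omega> (U t i) (U t j)" for t i j
  define A where "A t i j = aform \<Omega> V (G t i) (G t j)" for t i j
  define K where "K t i j = aform \<Omega> V (U t i) (U t j)" for t i j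
  define D where "D t i j = S t i j - idm i j" for t i j
  define E where "E t = energy \<Omega> V N (U t)" for t
  have G: "G t i \<in> H01 \<Omega>" if "0 \<le> t" "i < N" for t i
    unfolding G_def by (intro Gop_H01 U_H01 that)
  have aG: "aform \<Omega> V (G t i) v = l2inner \<Omega> (U t i) v" if "0 \<le> t" "i < N" "v \<in> H01 \<Omega>" for t i v
    unfolding G_def by (intro aform_Gop U_H01 that)
  have A_sym: "A t i j = A t j i" and S_sym: "S t i j = S t j i" and K_sym: "K t i j = K t j i"
    if "0 \<le> t" "i < N" "j < N" for t i j
    unfolding A_def S_def K_def using that
    by (auto intro!: a.form_sym b.form_sym G U_H01)
  \<comment> \<open>The coefficient matrix of the flow is a Gram matrix for the energy form, hence
    symmetric and semidefinite.\<close>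
  have A_l2: "l2inner \<Omega> (G t i) (U t j) = A t i j" if "0 \<le> t" "i < N" "j < N" for t i j
    using aG[OF that(1,3) G[OF that(1,2)]] A_sym[OF that] b.form_sym[OF G[OF that(1,2)] U_H01[OF that(1,3)]]
    by (simp add: A_def)
  have aUG: "aform \<Omega> V (U t i) (G t j) = S t i j" if "0 \<le> t" "i < N" "j < N" for t i j
    using aG[OF that(1,3) U_H01[OF that(1,2)]] S_sym[OF that] a.form_sym[OF U_H01[OF that(1,2)] G[OF that(1,3)]]
    by (simp add: S_def)

  \<comment> \<open>The flow and its derivatives in both forms\<close>
  define X where "X t i = G t i - (\<Sum>k<N. A t k i *\<^sub>R U t k)" for t i
  have X: "X t i \<in> H01 \<Omega>" if "0 \<le> t" "i < N" for t i
    unfolding X_def using that by (intro a.mem_diff a.mem_sum a.mem_scale G U_H01) auto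
  have rhs: "(\<lambda>x. Ud t i x - flow_rhs \<Omega> V N (U t) i x) = Ud t i - X t i" if "0 \<le> t" "i < N" for t i
    using that by (auto simp: fun_eq_iff X_def flow_rhs_def Gtuple_def G_def[symmetric] tuple_mult_def gram_def
        A_l2 mult.commute intro!: sum.cong)
  \<comment> \<open>The equation gives no pointwise equality, only Sobolev distance zero; the upper
    bound by \<open>c2\<close> makes the difference null for the energy form as well.\<close>
  have dist0: "l2inner \<Omega> (Ud t i - X t i) (Ud t i - X t i) = 0" "aform \<Omega> V (Ud t i - X t i) (Ud t i - X t i) = 0"
    if "0 \<le> t" "i < N" for t i
  proof -
    have d: "Ud t i - X t i \<in> H01 \<Omega>" using that by (intro a.mem_diff X Ud_H01)
    have "l2inner \<Omega> (Ud t i - X t i) (Ud t i - X t i) + grad_sq \<Omega> (Ud t i - X t i) = 0"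
      using ode[OF that] unfolding rhs[OF that] h1norm_sq_def .
    then have "l2inner \<Omega> (Ud t i - X t i) (Ud t i - X t i) = 0 \<and> grad_sq \<Omega> (Ud t i - X t i) = 0"
      using b.form_nonneg[OF d] grad_sq_nonneg[of "Ud t i - X t i"] by linarith
    then show "l2inner \<Omega> (Ud t i - X t i) (Ud t i - X t i) = 0"
      and "aform \<Omega> V (Ud t i - X t i) (Ud t i - X t i) = 0"
      using coercive[OF d] a.form_nonneg[OF d] by auto
  qed
  have Ud_l2: "l2inner \<Omega> (Ud t i) v = l2inner \<Omega> (X t i) v"
    and Ud_a: "aform \<Omega> V (Ud t i) v = aform \<Omega> V (X t i) v"
    if "0 \<le> t" "i < N" "v \<in> H01 \<Omega>" for t i v
    using a.form_null_left[OF a.mem_diff[OF Ud_H01 X] that(3) dist0(2)]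
      b.form_null_left[OF b.mem_diff[OF Ud_H01 X] that(3) dist0(1)] that
    by (auto simp: a.form_diff_left b.form_diff_left Ud_H01 X)
  have quot: "(\<lambda>x. (U (t + h) i x - U t i x) / h - Ud t i x) = (1 / h) *\<^sub>R (U (t + h) i - U t i) - Ud t i" for t h i
    by (auto simp: fun_eq_iff)
  have ev: "\<forall>\<^sub>F h in at 0 within {h. t + h \<ge> 0}. (1 / h) *\<^sub>R (U (t + h) i - U t i) - Ud t i \<in> H01 \<Omega>"
    if "0 \<le> t" "i < N" for t i
    unfolding eventually_at_filter using that by (auto intro!: always_eventually a.mem_diff a.mem_scale U_H01 Ud_H01)
  have U_l2: "((\<lambda>h. l2inner \<Omega> ((1 / h) *\<^sub>R (U (t + h) i - U t i) - Ud t i) ((1 / h) *\<^sub>R (U (t + h) i - U t i) - Ud t i)) \<longlongrightarrow> 0)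
      (at 0 within {h. t + h \<ge> 0})" if "0 \<le> t" "i < N" for t i
    by (rule Lim_null_comparison[OF eventually_mono[OF ev[OF that]] U_deriv[OF that, unfolded quot]])
      (simp add: h1norm_sq_def b.form_nonneg grad_sq_nonneg)
  \<comment> \<open>Differentiability in the Sobolev norm implies it in the energy seminorm, again
    through \<open>c2\<close>.\<close>
  have U_a: "((\<lambda>h. aform \<Omega> V ((1 / h) *\<^sub>R (U (t + h) i - U t i) - Ud t i) ((1 / h) *\<^sub>R (U (t + h) i - U t i) - Ud t i)) \<longlongrightarrow> 0)
      (at 0 within {h. t + h \<ge> 0})" if "0 \<le> t" "i < N" for t i
  proof (rule Lim_null_comparison[OF eventually_mono[OF ev[OF that]]
        tendsto_mult_right_zero[OF U_deriv[OF that, unfolded quot], of c2]])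
    fix h assume h: "(1 / h) *\<^sub>R (U (t + h) i - U t i) - Ud t i \<in> H01 \<Omega>" (is "?w \<in> _")
    have "aform \<Omega> V ?w ?w \<le> c2 * grad_sq \<Omega> ?w" using coercive[OF h] by simp
    also have "\<dots> \<le> c2 * h1norm_sq \<Omega> ?w"
      using c_pos b.form_nonneg[OF h] by (intro mult_left_mono) (auto simp: h1norm_sq_def)
    finally show "norm (aform \<Omega> V ?w ?w) \<le> c2 * h1norm_sq \<Omega> ?w" using a.form_nonneg[OF h] by simp
  qed
  have X_l2: "l2inner \<Omega> (X t i) (U t j) = A t i j - (\<Sum>k<N. A t i k * S t k j)"
    if "0 \<le> t" "i < N" "j < N" for t i j
  proof -
    have "l2inner \<Omega> (X t i) (U t j) = l2inner \<Omega> (G t i) (U t j) - l2inner \<Omega> (\<Sum>k<N. A t k i *\<^sub>R U t k) (U t j)"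
      unfolding X_def using that by (intro b.form_diff_left G U_H01 a.mem_sum a.mem_scale) auto
    also have "l2inner \<Omega> (\<Sum>k<N. A t k i *\<^sub>R U t k) (U t j) = (\<Sum>k<N. l2inner \<Omega> (A t k i *\<^sub>R U t k) (U t j))"
      using that by (intro b.form_sum_left U_H01 a.mem_scale) auto
    also have "\<dots> = (\<Sum>k<N. A t i k * S t k j)"
      using that by (intro sum.cong refl) (simp add: b.form_scale_left U_H01 S_def A_sym[OF that(1,2)])
    finally show ?thesis using A_l2[OF that] by simp
  qed
  have X_a: "aform \<Omega> V (X t i) (U t i) = S t i i - (\<Sum>k<N. K t i k * A t i k)" if "0 \<le> t" "i < N" for t i
  proof -
    have "aform \<Omega> V (X t i) (U t i) = aform \<Omega> V (G t i) (U t i) - aform \<Omega> V (\<Sum>k<N. A t k i *\<^sub>R U t k) (U t i)"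
      unfolding X_def using that by (intro a.form_diff_left G U_H01 a.mem_sum a.mem_scale) auto
    also have "aform \<Omega> V (\<Sum>k<N. A t k i *\<^sub>R U t k) (U t i) = (\<Sum>k<N. aform \<Omega> V (A t k i *\<^sub>R U t k) (U t i))"
      using that by (intro a.form_sum_left U_H01 a.mem_scale) auto
    also have "\<dots> = (\<Sum>k<N. K t i k * A t i k)"
      using that by (intro sum.cong refl) (simp add: a.form_scale_left U_H01 K_def[symmetric] K_sym[OF that] A_sym[OF that])
    finally show ?thesis using aG[OF that U_H01[OF that]] by (simp add: S_def)
  qed
  \<comment> \<open>The derivative of S is 2A - AS - SA; writing S = I + D absorbs the term
    2A.\<close>
  have deriv: "((\<lambda>s. D s i j) has_real_derivative - (\<Sum>k<N. A t i k * D t k j + D t i k * A t k j)) (at t within {0..})"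
    if t: "0 \<le> t" and ij: "i < N" "j < N" for t i j
  proof -
    have "((\<lambda>s. S s i j) has_real_derivative l2inner \<Omega> (Ud t i) (U t j) + l2inner \<Omega> (U t i) (Ud t j)) (at t within {0..})"
      unfolding S_def using t ij
      by (intro b.has_real_derivative_form[of t "\<lambda>s. U s i" "\<lambda>s. U s j"] U_l2 U_H01 Ud_H01) auto
    also have "l2inner \<Omega> (Ud t i) (U t j) + l2inner \<Omega> (U t i) (Ud t j)
        = (A t i j - (\<Sum>k<N. A t i k * S t k j)) + (A t j i - (\<Sum>k<N. A t j k * S t k i))"
      using Ud_l2[OF t ij(1) U_H01[OF t ij(2)]] Ud_l2[OF t ij(2) U_H01[OF t ij(1)]]
        b.form_sym[OF U_H01[OF t ij(1)] Ud_H01[OF t ij(2)]] X_l2[OF t ij] X_l2[OF t ij(2,1)] by simp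
    also have "\<dots> = - (\<Sum>k<N. A t i k * D t k j + D t i k * A t k j)"
    proof -
      have "(\<Sum>k<N. A t i k * D t k j) = (\<Sum>k<N. A t i k * S t k j) - A t i j"
        using ij by (simp add: D_def right_diff_distrib sum_subtractf idm_def if_distrib[of "\<lambda>a. _ * a"] cong: if_cong)
      moreover have "(\<Sum>k<N. D t i k * A t k j) = (\<Sum>k<N. S t i k * A t k j) - A t i j"
        using ij by (simp add: D_def left_diff_distrib sum_subtractf idm_def if_distrib[of "\<lambda>a. a * _"] cong: if_cong)
      moreover have "(\<Sum>k<N. S t i k * A t k j) = (\<Sum>k<N. A t j k * S t k i)"
        using t ij by (intro sum.cong refl) (simp add: S_sym[OF t ij(1)] A_sym[OF t ij(2)])
      ultimately show ?thesis using A_sym[OF t ij] by (simp add: sum.distrib)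
    qed
    finally show ?thesis unfolding D_def by (auto intro!: derivative_eq_intros)
  qed
  have D_sym: "D t i j = D t j i" if "0 \<le> t" "i < N" "j < N" for t i j
    using S_sym[OF that] by (simp add: D_def idm_def)
  have D0: "psd N (D 0)"
    using init unfolding D_def S_def by (simp add: quasi_stiefel_def gram_def)
  have A_psd: "psd N (A t)" if "0 \<le> t" for t
    unfolding A_def using that by (intro a.psd_gram_form G)
  have D_psd: "psd N (D t)" if "0 \<le> t" for t
    using psd_preserved_Lyapunov[of N D A t] deriv D_sym A_psd D0 that by blast
  have E_eq: "E t = (1 / 2) * (\<Sum>i<N. K t i i)" for t
    by (simp add: E_def energy_def K_def)

  \<comment> \<open>Energy decrease and exponential decay\<close>
  have E_mono: "E t \<le> E 0" if "0 \<le> t" for t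
  proof (rule nonincreasing_from_zero[OF _ _ that])
    fix t :: real assume t: "0 \<le> t"
    have "((\<lambda>s. K s i i) has_real_derivative 2 * aform \<Omega> V (X t i) (U t i)) (at t within {0..})" if i: "i < N" for i
    proof -
      have "((\<lambda>s. K s i i) has_real_derivative aform \<Omega> V (Ud t i) (U t i) + aform \<Omega> V (U t i) (Ud t i)) (at t within {0..})"
        unfolding K_def using t i
        by (intro a.has_real_derivative_form[of t "\<lambda>s. U s i" "\<lambda>s. U s i"] U_a U_H01 Ud_H01) auto
      then show ?thesis
        using Ud_a[OF t i U_H01[OF t i]] a.form_sym[OF U_H01[OF t i] Ud_H01[OF t i]] by simp
    qed
    then show "(E has_real_derivative (1 / 2) * (\<Sum>i<N. 2 * aform \<Omega> V (X t i) (U t i))) (at t within {0..})"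
      unfolding E_eq[abs_def] by (intro DERIV_cmult DERIV_sum) auto
    \<comment> \<open>Together with discarding the off-diagonal squares, this gives tr S <= tr
      S^2.\<close>
    have S1: "1 \<le> S t i i" if "i < N" for i
      using psd_diag_nonneg[OF D_psd[OF t] that] by (simp add: D_def idm_def)
    have "(\<Sum>i<N. S t i i) \<le> (\<Sum>i<N. \<Sum>j<N. S t i j * S t j i)"
    proof (rule sum_mono)
      fix i assume i: "i \<in> {..<N}"
      have "S t i i \<le> S t i i * S t i i" using S1[of i] i by (simp add: mult_left_mono[of 1 "S t i i" "S t i i", simplified])
      also have "\<dots> \<le> (\<Sum>j<N. S t i j * S t j i)"
        using i t by (intro member_le_sum[of i "{..<N}" "\<lambda>j. S t i j * S t j i"]) (auto simp: S_sym[of t _ i])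
      finally show "S t i i \<le> (\<Sum>j<N. S t i j * S t j i)" .
    qed
    also have "\<dots> = (\<Sum>i<N. \<Sum>j<N. aform \<Omega> V (U t i) (G t j) * aform \<Omega> V (U t j) (G t i))"
      using t by (intro sum.cong refl) (simp add: aUG)
    also have "\<dots> \<le> (\<Sum>i<N. \<Sum>j<N. K t i j * A t i j)"
      unfolding K_def A_def using t by (intro a.trace_cross_gram_le U_H01 G)
    finally have "(\<Sum>i<N. aform \<Omega> V (X t i) (U t i)) \<le> 0"
      using t by (simp add: X_a sum_subtractf)
    then show "(1 / 2) * (\<Sum>i<N. 2 * aform \<Omega> V (X t i) (U t i)) \<le> 0"
      by (simp add: sum_distrib_left[symmetric])
  qed
  have decay: "frob N (D t) \<le> frob N (D 0) * exp (- t / E 0)" if t: "0 \<le> t" for t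
  proof (cases "N = 0")
    case True
    then show ?thesis by (simp add: frob_def)
  next
    case False
    \<comment> \<open>The trace of K is twice the energy, which never exceeds its initial value; so
      the constant does not depend on \<open>t\<close>.\<close>
    have lower: "(\<Sum>i<N. (z i)\<^sup>2) \<le> quad_form N (A t) z z * (2 * E 0)" if t: "0 \<le> t" for t z
    proof -
      have "(\<Sum>i<N. (z i)\<^sup>2) \<le> quad_form N (A t) z z * (\<Sum>i<N. K t i i)"
        using Gop_gram_lower_bound[of N "U t" z] D_psd[OF t] U_H01[OF t]
        unfolding D_def S_def A_def G_def K_def by simp
      also have "\<dots> \<le> quad_form N (A t) z z * (2 * E 0)"
        using E_mono[OF t] A_psd[OF t] by (intro mult_left_mono) (auto simp: E_eq psd_def quad_form_def)
      finally show ?thesis .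
    qed
    \<comment> \<open>Tested on the all-ones vector, whose square norm is \<open>N > 0\<close>, the
      lower bound excludes a nonpositive energy.\<close>
    have "E 0 > 0"
    proof (rule ccontr)
      assume "\<not> E 0 > 0"
      moreover have "0 \<le> quad_form N (A 0) (\<lambda>_. 1) (\<lambda>_. 1)"
        by (rule semi_inner_product.form_nonneg[OF semi_inner_product_quad_form[OF A_psd[OF order_refl]] UNIV_I])
      ultimately have "quad_form N (A 0) (\<lambda>_. 1) (\<lambda>_. 1) * (2 * E 0) \<le> 0"
        by (intro mult_nonneg_nonpos) auto
      from order_trans[OF lower[OF order_refl] this] show False using False by simp
    qed
    then have "1 / (2 * E 0) * (\<Sum>i<N. (z i)\<^sup>2) \<le> quad_form N (A t) z z" if "0 \<le> t" for t z
      using lower[OF that, of z] by (simp add: pos_divide_le_eq)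
    from Lyapunov_exponential_decay[OF deriv D_sym this t] show ?thesis by simp
  qed
  have lim: "((\<lambda>t. S t i j) \<longlongrightarrow> idm i j) at_top" if ij: "i < N" "j < N" for i j
  proof -
    have "1 \<le> S 0 i i" using psd_diag_nonneg[OF D0 ij(1)] by (simp add: D_def idm_def)
    have K0: "0 \<le> K 0 k k" if "k < N" for k
      unfolding K_def using that by (intro a.form_nonneg U_H01) auto
    \<comment> \<open>If \<open>U 0 i\<close> were null for the energy form, pairing it with
      \<open>G 0 i\<close> would give \<open>S 0 i i = 0\<close>, against
      \<open>S 0 i i \<ge> 1\<close>. So the rate is finite and positive.\<close>
    have "K 0 i i \<noteq> 0"
    proof
      assume "K 0 i i = 0"
      then have "aform \<Omega> V (U 0 i) (G 0 i) = 0"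
        unfolding K_def by (rule a.form_null_left[OF U_H01 G, OF order_refl ij(1) order_refl ij(1)])
      then show False using aUG[of 0 i i] ij \<open>1 \<le> S 0 i i\<close> by simp
    qed
    then have "0 < (\<Sum>k<N. K 0 k k)"
    proof (intro sum_pos2[of _ i])
      show "0 < K 0 i i" using K0[OF ij(1)] \<open>K 0 i i \<noteq> 0\<close> by linarith
    qed (use K0 ij in auto)
    then have E0: "E 0 > 0" by (simp add: E_eq)
    have "((\<lambda>t. D t i j) \<longlongrightarrow> 0) at_top"
    proof (rule Lim_null_comparison)
      show "\<forall>\<^sub>F t in at_top. norm (D t i j) \<le> frob N (D 0) * exp (- t / E 0)"
        using eventually_ge_at_top[of 0]
      proof eventually_elim
        case (elim t)
        have "(D t i j)\<^sup>2 \<le> (\<Sum>j<N. (D t i j)\<^sup>2)"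
          using ij by (intro member_le_sum) auto
        also have "\<dots> \<le> (\<Sum>i<N. \<Sum>j<N. (D t i j)\<^sup>2)"
          using ij by (intro member_le_sum[of i _ "\<lambda>i. \<Sum>j<N. (D t i j)\<^sup>2"]) (auto intro: sum_nonneg)
        finally have "\<bar>D t i j\<bar> \<le> frob N (D t)"
          unfolding frob_def by (intro real_le_rsqrt) simp
        then show ?case using decay[OF elim] by simp
      qed
      have "((\<lambda>t. exp (- t / E 0)) \<longlongrightarrow> 0) at_top"
        using E0 by real_asymp
      then show "((\<lambda>t. frob N (D 0) * exp (- t / E 0)) \<longlongrightarrow> 0) at_top"
        by (rule tendsto_mult_right_zero)
    qed
    from tendsto_add[OF this tendsto_const[of "idm i j"]] show ?thesis by (simp add: D_def)
  qed
  show ?thesis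
    using decay lim unfolding D_def S_def gram_def E_def by simp
qed

end
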